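(* (i) Every nonempty shell of the even selfdual lattice $W_8$ of rank $8$ is a spherical $7\tfrac12$-design. (ii) Every nonempty shell of each even selfdual lattice of rank $16$ is a spherical $3\tfrac12$-design. (iii) Every nonempty shell of the Leech lattice is a spherical $11\tfrac12$-design. (iv) Every nonempty shell of every even selfdual lattice of rank $24$ and minimum $2$ is a spherical $3$-design.
   Context: A selfdual lattice is an integral lattice equal to its dual; it is even if all norms $\langle x,x\rangle$ are even. $W_8=\{x\in\mathbb R^8:2x_i\in\mathbb Z,\ x_i-x_1\in\mathbb Z,\ \sum x_i\in2\mathbb Z\}$ is (up to isometry) the unique even selfdual lattice of rank 8. The Leech lattice is the (unique up to isometry) even selfdual lattice of rank $24$ with minimum $4$ (no vectors of norm 2). Shell of norm $m$: $\Lambda_m=\{x\in\Lambda:\langle x,x\rangle=m\}$. Designs (antipodal sets $X$): $(C_{2j})$ means $\sum_{x\in X}P(x)=0$ for every homogeneous harmonic polynomial $P$ of degree $2j$; $X$ is a spherical $t$-design iff $(C_{2j})$ holds for all $2\le 2j\le t$; $X$ is a spherical $(2s+1+\tfrac12)$-design iff $(C_{2j})$ holds for $2\le2j\le2s$ and for $2j=2s+4$ (e.g. a $7\tfrac12$-design satisfies $(C_2),(C_4),(C_6),(C_{10})$; an $11\tfrac12$-design satisfies $(C_2),\dots,(C_{10}),(C_{14})$). *)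

theory Defs
  imports "HOL-Analysis.Analysis"
begin

definition is_lattice :: "(real ^ 'n) set \<Rightarrow> bool" where
  "is_lattice L \<longleftrightarrow> (\<exists>B :: 'n \<Rightarrow> real ^ 'n. inj B \<and> independent (range B) \<and>
      L = {(\<Sum>i\<in>UNIV. of_int (z i) *\<^sub>R B i) | z :: 'n \<Rightarrow> int. True})"

definition dual_lattice :: "(real ^ 'n) set \<Rightarrow> (real ^ 'n) set" where
  "dual_lattice L = {y. \<forall>x\<in>L. x \<bullet> y \<in> \<int>}"

definition integral_lattice :: "(real ^ 'n) set \<Rightarrow> bool" where
  "integral_lattice L \<longleftrightarrow> (\<forall>x\<in>L. \<forall>y\<in>L. x \<bullet> y \<in> \<int>)"

definition selfdual_lattice :: "(real ^ 'n) set \<Rightarrow> bool" where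
  "selfdual_lattice L \<longleftrightarrow> is_lattice L \<and> integral_lattice L \<and> dual_lattice L = L"

definition even_lattice :: "(real ^ 'n) set \<Rightarrow> bool" where
  "even_lattice L \<longleftrightarrow> (\<forall>x\<in>L. \<exists>k::int. x \<bullet> x = 2 * of_int k)"

definition lattice_min :: "(real ^ 'n) set \<Rightarrow> real" where
  "lattice_min L = Inf {x \<bullet> x | x. x \<in> L \<and> x \<noteq> 0}"

definition shell :: "(real ^ 'n) set \<Rightarrow> real \<Rightarrow> (real ^ 'n) set" where
  "shell L m = {x \<in> L. x \<bullet> x = m}"

text \<open>The lattice W_8 (coordinates indexed by the numeral type 8; x_1 is index 0).\<close>
definition W8 :: "(real ^ 8) set" where
  "W8 = {x. (\<forall>i. 2 * x $ i \<in> \<int>) \<and> (\<forall>i. x $ i - x $ 0 \<in> \<int>) \<and>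
            (\<exists>k::int. (\<Sum>i\<in>UNIV. x $ i) = 2 * of_int k)}"

definition homogeneous_poly :: "nat \<Rightarrow> (real ^ 'n \<Rightarrow> real) \<Rightarrow> bool" where
  "homogeneous_poly d P \<longleftrightarrow> (\<exists>c :: ('n \<Rightarrow> nat) \<Rightarrow> real.
      \<forall>x. P x = (\<Sum>\<alpha>\<in>{\<alpha> :: 'n \<Rightarrow> nat. sum \<alpha> UNIV = d}. c \<alpha> * (\<Prod>i\<in>UNIV. (x $ i) ^ \<alpha> i)))"

definition harmonic :: "(real ^ 'n \<Rightarrow> real) \<Rightarrow> bool" where
  "harmonic P \<longleftrightarrow> (\<forall>x. (\<Sum>i\<in>UNIV. deriv (deriv (\<lambda>t. P (x + t *\<^sub>R axis i 1))) 0) = 0)"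

definition design_cond :: "(real ^ 'n) set \<Rightarrow> nat \<Rightarrow> bool" where
  "design_cond X k \<longleftrightarrow> (\<forall>P. homogeneous_poly k P \<and> harmonic P \<longrightarrow> (\<Sum>x\<in>X. P x) = 0)"

definition antipodal :: "(real ^ 'n) set \<Rightarrow> bool" where
  "antipodal X \<longleftrightarrow> (\<forall>x\<in>X. - x \<in> X)"

definition spherical_design :: "nat \<Rightarrow> (real ^ 'n) set \<Rightarrow> bool" where
  "spherical_design t X \<longleftrightarrow> finite X \<and> antipodal X \<and>
     (\<forall>j. 1 \<le> j \<and> 2 * j \<le> t \<longrightarrow> design_cond X (2 * j))"

text \<open>Spherical (2s+1+1/2)-design: (C_2j) for 2 \<le> 2j \<le> 2s and (C_{2s+4}).\<close>
definition spherical_half_design :: "nat \<Rightarrow> (real ^ 'n) set \<Rightarrow> bool" where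
  "spherical_half_design s X \<longleftrightarrow> finite X \<and> antipodal X \<and>
     (\<forall>j. 1 \<le> j \<and> j \<le> s \<longrightarrow> design_cond X (2 * j)) \<and> design_cond X (2 * s + 4)"

end

theory Submission
  imports Defs "HOL-Complex_Analysis.Complex_Analysis" "HOL-Probability.Probability"
    "HOL-Real_Asymp.Real_Asymp"
begin

text \<open>
For a harmonic homogeneous polynomial \<open>P\<close> of degree \<open>d > 0\<close> the series
\<open>\<Sum>x\<in>L. P(x) q^(x\<bullet>x/2)\<close> of an even selfdual lattice of rank \<open>n\<close> is a cusp form of weight
\<open>k = n/2 + d\<close>, vanishing at infinity to order \<open>r\<close> if \<open>L\<close> has minimum at least \<open>2r\<close>.
It suffices that such a form is zero, since its coefficients are the sums of \<open>P\<close> over the shells.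

The functional equation is Poisson summation, proved by testing against the periodic kernel
\<open>\<Prod>cos(\<pi>\<langle>b\<^sub>i*,u\<rangle>)^(2N)\<close>, a trigonometric polynomial that concentrates on the lattice; the
Fourier transform of \<open>P\<close> times a Gaussian is computed by Hermite polynomials and the heat equation.

The valence formula is replaced by maximum principles. If the form \<open>f\<close> is not zero, the invariant function
\<open>|f|\<^sup>2 y\<^sup>k\<close> has a maximum at some \<open>\<tau>\<close> in the standard fundamental domain. The maximum principle for
\<open>f/q\<^sup>r\<close> in the disc \<open>|q| < 1\<close> gives \<open>Im \<tau> \<le> k/(4\<pi>r)\<close>. For \<open>k = 14, 22, 26\<close> the form must vanish at the
elliptic points \<open>exp(2\<pi>i/3)\<close> and \<open>i\<close>, and the Schwarz lemma keeps the maximum away from them. In each case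
these constraints exclude the whole fundamental domain.
\<close>

section \<open>Vanishing of cusp forms of small weight\<close>

text \<open>The half-integral strength reflects the first weights that carry cusp forms: the degree
  skipped by each half-design gives weight 12, or 24 if \<open>r = 2\<close>, where the discriminant
  form and its square live. Height alone settles \<open>k <= 10 * r\<close>, since a point of the
  fundamental domain has height at least \<open>sqrt 3 / 2\<close> and
  \<open>4 * pi * sqrt 3 / 2\<close> is about 10.88. The weights 14, 22 and 26 lie beyond this, but
  their residues modulo 12 force zeros at elliptic points. All estimates concern one maximum point
  and discs around a centre, so no contour has to be led around zeros on the boundary of the
  fundamental domain, the delicate point of the valence formula.

  On the Poisson side the obstacle is convergence of a Fourier series at a point. Powers of the
  cosine are nonnegative and have explicit Fourier coefficients, so one integral can be evaluated
  twice: by concentration in a cell, and by dominated convergence over the dual lattice. The two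
  normalisations differ by a factor independent of the test function. Comparison with a Gaussian,
  for which both lattice sums agree, removes it without a determinant.\<close>

lemma max_modulus_cball:
  fixes g :: "complex \<Rightarrow> complex"
  assumes "g holomorphic_on ball 0 1" "r < 1" "norm z \<le> r" "\<And>w. norm w = r \<Longrightarrow> norm (g w) \<le> B"
  shows "norm (g z) \<le> B"
proof (cases "r > 0")
  case True
  show ?thesis
  proof (rule maximum_modulus_frontier[of g "cball 0 r"])
    show "g holomorphic_on interior (cball 0 r)"
      by (rule holomorphic_on_subset[OF assms(1)]) (use assms in auto)
    show "continuous_on (closure (cball 0 r)) g"
      by (rule holomorphic_on_imp_continuous_on, rule holomorphic_on_subset[OF assms(1)]) (use assms in auto)
    show "norm (g w) \<le> B" if "w \<in> frontier (cball 0 r)" for w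
      using that True by (intro assms(4)) (auto simp: frontier_cball)
  qed (use assms in auto)
next
  case False
  then have "norm z \<le> 0" using assms(3) by linarith
  then have "z = 0" "r = 0" using False assms(3) by auto
  then show ?thesis using assms(4)[of z] by simp
qed

text \<open>The value \<open>g p\<close> is recorded because it decides whether a second factor
  \<open>z - p\<close> splits off; two applications then exhibit a double zero.\<close>

lemma holomorphic_factor_zero:
  assumes "f holomorphic_on S" "open S" "f p = 0"
  obtains g where "g holomorphic_on S" "\<And>z. f z = (z - p) * g z" "g p = deriv f p"
proof
  let ?g = "\<lambda>z. if z = p then deriv f p else (f z - f p)/(z-p)"
  show "?g holomorphic_on S" by (rule pole_lemma_open[OF assms(1,2)])
qed (use assms(3) in auto)

definition uhp :: "complex set" where "uhp = {\<tau>. Im \<tau> > 0}"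

lemma open_uhp: "open uhp"
  unfolding uhp_def by (rule open_halfspace_Im_gt)

text \<open>Schwarz lemma in the disc coordinate centred at \<open>p\<close>, applied to a function whose
  invariant norm \<open>|f|\<^sup>2 y\<^sup>k\<close> is maximal at \<open>\<tau>0\<close>: the maximum cannot be close to a zero.\<close>

lemma maximum_far_from_zero:
  fixes g :: "complex \<Rightarrow> complex" and k e :: nat
  assumes hol: "g holomorphic_on uhp" and p: "Im p > 0" and t0: "Im \<tau>0 > 0" and e: "e \<ge> 1"
    and bd: "\<And>\<tau>. Im \<tau> > 0 \<Longrightarrow> norm ((\<tau> - p)^e * g \<tau>)^2 * Im \<tau>^k \<le> M"
    and M: "norm ((\<tau>0 - p)^e * g \<tau>0)^2 * Im \<tau>0^k = M" "M > 0"
  shows "real e * norm (\<tau>0 - cnj p)^2 \<le> real (k + e) * norm (\<tau>0 - p)^2"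
proof -
  \<comment> \<open>\<open>T\<close> inverts the Cayley transform
    \<open>(\<tau> - p) / (\<tau> - cnj p)\<close>: it maps the unit disc into the upper half plane
    and 0 to \<open>p\<close>. The exponent \<open>k + e\<close> in \<open>G\<close> collects the
    powers of \<open>1 - w\<close> coming from \<open>Im (T w)^k\<close> and from
    \<open>(T w - p)^e\<close>, so that the invariant norm splits into a function of
    \<open>norm w\<close> and the factor \<open>norm (G w)^2\<close>.\<close>
  define T where "T w = (p - cnj p * w) / (1 - w)" for w
  define G where "G w = g (T w) / (1 - w)^(k+e)" for w
  define w0 where "w0 = (\<tau>0 - p) / (\<tau>0 - cnj p)"
  define C where "C = norm (p - cnj p)^(2*e) * Im p ^ k"
  have ImT: "Im (T w) = Im p * (1 - norm w^2) / norm (1 - w)^2" if "w \<noteq> 1" for w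
  proof -
    have "1 - w \<noteq> 0" using that by auto
    then have "Im (T w) = Im ((p - cnj p * w) * cnj (1 - w)) / norm (1 - w)^2"
      unfolding T_def by (simp add: complex_div_cnj[of _ "1 - w"] Im_divide_of_real flip: of_real_power)
    also have "Im ((p - cnj p * w) * cnj (1 - w)) = Im p * (1 - norm w^2)"
      unfolding cmod_power2 by (simp add: algebra_simps power2_eq_square)
    finally show ?thesis .
  qed
  have Tuhp: "T w \<in> uhp" if "norm w < 1" for w
  proof -
    have "w \<noteq> 1" using that by auto
    moreover have "norm w^2 < 1" using that by (simp add: power_less_one_iff)
    ultimately show ?thesis using p by (simp add: uhp_def ImT divide_pos_pos)
  qed
  have holG: "G holomorphic_on ball 0 1"
  proof -
    have "T holomorphic_on ball 0 1" unfolding T_def by (intro holomorphic_intros) auto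
    then have "(g \<circ> T) holomorphic_on ball 0 1"
      by (rule holomorphic_on_compose_gen[OF _ hol]) (use Tuhp in auto)
    then show ?thesis unfolding G_def by (intro holomorphic_intros) (auto simp: o_def)
  qed
  have key: "norm ((T w - p)^e * g (T w))^2 * Im (T w)^k = C * (norm w^2)^e * (1 - norm w^2)^k * norm (G w)^2"
    if "norm w < 1" for w
  proof -
    have w1: "1 - w \<noteq> 0" using that by auto
    have Tp: "T w - p = w * (p - cnj p) / (1 - w)" using w1 by (simp add: T_def field_simps)
    have g: "g (T w) = G w * (1 - w)^(k+e)" using w1 by (simp add: G_def)
    have n: "norm (1 - w) \<noteq> 0" using w1 by simp
    have "norm ((T w - p)^e * g (T w)) = norm w^e * norm (p - cnj p)^e * norm (G w) * norm (1-w)^k"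
      unfolding Tp g using n by (simp add: norm_mult norm_power norm_divide power_mult_distrib power_divide power_add)
    moreover have "Im (T w)^k = Im p^k * (1 - norm w^2)^k / norm (1-w)^(2*k)"
      using w1 by (simp add: ImT power_mult_distrib power_divide power_mult)
    moreover have "norm (1-w)^(2*k) = (norm (1-w)^k)^2" by (simp add: power_mult mult.commute flip: power_mult)
    ultimately show ?thesis using n
      by (simp add: C_def power_mult_distrib power_even_eq power2_eq_square)
  qed
  have C: "C > 0"
  proof -
    have "p - cnj p \<noteq> 0" using p by (auto simp: complex_eq_iff)
    then show ?thesis using p by (simp add: C_def)
  qed
  have nz: "\<tau>0 - cnj p \<noteq> 0" using p t0 by (auto simp: complex_eq_iff)
  have w01: "w0 \<noteq> 1"
  proof
    assume "w0 = 1"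
    then have "\<tau>0 - p = \<tau>0 - cnj p" using nz by (simp add: w0_def)
    then show False using p by (simp add: complex_eq_iff)
  qed
  have T0: "T w0 = \<tau>0"
  proof -
    have "1 - w0 = (p - cnj p)/(\<tau>0 - cnj p)" using nz by (simp add: w0_def field_simps)
    moreover have "p - cnj p * w0 = \<tau>0 * (p - cnj p)/(\<tau>0 - cnj p)" using nz by (simp add: w0_def field_simps)
    moreover have "p - cnj p \<noteq> 0" using p by (auto simp: complex_eq_iff)
    ultimately show ?thesis using nz by (simp add: T_def)
  qed
  define s0 where "s0 = norm w0^2"
  have n1: "norm w0 < 1"
  proof -
    have "Im \<tau>0 = Im p * (1 - norm w0^2) / norm (1 - w0)^2" using ImT[OF w01] T0 by simp
    then have "0 < (1 - norm w0^2) / norm (1 - w0)^2" using t0 p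
      by (metis mult_pos_pos not_less_iff_gr_or_eq times_divide_eq_right zero_less_mult_pos)
    then have "1 - norm w0^2 > 0" using w01 by (simp add: zero_less_divide_iff)
    then show ?thesis by (simp add: power_less_one_iff)
  qed
  have Meq: "M = C * s0^e * (1 - s0)^k * norm (G w0)^2"
    using key[OF n1] M(1) T0 by (simp add: s0_def)
  have s0: "s0 > 0" "s0 < 1"
  proof -
    have "s0 \<noteq> 0" using Meq M(2) e by (auto simp: zero_power)
    then show "s0 > 0" by (simp add: s0_def)
    show "s0 < 1" using n1 by (simp add: s0_def power_less_one_iff)
  qed
  \<comment> \<open>On the circle \<open>norm w^2 = s\<close> the weight
    \<open>s^e * (1 - s)^k\<close> is constant, so \<open>M\<close> yields a bound for
    \<open>G\<close> there. The maximum principle carries it inward to \<open>w0\<close>, where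
    \<open>M\<close> is attained.\<close>
  have mono: "s^e * (1 - s)^k \<le> s0^e * (1-s0)^k" if s: "s0 < s" "s < 1" for s
  proof -
    define B where "B = M / (C * s^e * (1-s)^k)"
    have pos: "C * s^e * (1-s)^k > 0" using C s s0 by simp
    have rs: "norm w0 \<le> sqrt s" using s by (simp add: s0_def real_le_rsqrt)
    have "norm (G w0) \<le> sqrt B"
    proof (rule max_modulus_cball[OF holG _ rs])
      show "sqrt s < 1" using s by simp
      fix w :: complex assume w: "norm w = sqrt s"
      then have w': "norm w < 1" "norm w^2 = s" using s s0 by auto
      have "C * s^e * (1-s)^k * norm (G w)^2 \<le> M"
        using bd[of "T w"] Tuhp[OF w'(1)] key[OF w'(1)] w'(2) by (simp add: uhp_def)
      then have "norm (G w)^2 \<le> B" using pos by (simp add: B_def field_simps)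
      then show "norm (G w) \<le> sqrt B" by (rule real_le_rsqrt)
    qed
    moreover have "B \<ge> 0" using pos M(2) by (simp add: B_def)
    ultimately have "norm (G w0)^2 \<le> B" by (metis norm_ge_zero real_sqrt_le_iff real_sqrt_pow2 sqrt_le_D power_mono)
    then have "norm (G w0)^2 * (C * s^e * (1-s)^k) \<le> M" using pos by (simp add: B_def field_simps)
    also have "M = norm (G w0)^2 * (C * s0^e * (1-s0)^k)" by (simp add: Meq)
    finally have "norm (G w0)^2 * C * (s^e * (1-s)^k) \<le> norm (G w0)^2 * C * (s0^e * (1-s0)^k)"
      by (simp add: mult_ac)
    moreover have "norm (G w0)^2 * C > 0" using C Meq M(2) by (auto simp: zero_less_mult_iff)
    ultimately show ?thesis by (simp only: mult_le_cancel_left_pos)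
  qed
  \<comment> \<open>By \<open>mono\<close> the weight cannot increase to the right of
    \<open>s0\<close>, so its logarithmic derivative at \<open>s0\<close> is at most 0. This amounts
    to \<open>s0 >= e / (k + e)\<close>.\<close>
  have "real e / s0 \<le> real k / (1 - s0)"
  proof (rule ccontr)
    assume "\<not> ?thesis"
    then have d: "real e / s0 - real k / (1 - s0) > 0" by simp
    have der: "((\<lambda>s. real e * ln s + real k * ln (1 - s)) has_real_derivative (real e / s0 - real k / (1 - s0))) (at s0)"
      using s0 by (auto intro!: derivative_eq_intros)
    obtain d where d: "d > 0" "\<forall>h>0. h < d \<longrightarrow> real e * ln s0 + real k * ln (1 - s0) < real e * ln (s0+h) + real k * ln (1 - (s0+h))"
      using DERIV_pos_inc_right[OF der d] by blast
    define h where "h = min (d/2) ((1-s0)/2)"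
    have h: "h > 0" "h < d" "s0 + h < 1" using d s0 by (auto simp: h_def min_def field_simps)
    then have "real e * ln s0 + real k * ln (1 - s0) < real e * ln (s0+h) + real k * ln (1 - (s0+h))" using d by blast
    moreover have "real e * ln s + real k * ln (1 - s) = ln (s^e * (1-s)^k)" if "0 < s" "s < 1" for s
      using that by (simp add: ln_mult ln_realpow)
    ultimately have "ln (s0^e * (1-s0)^k) < ln ((s0+h)^e * (1-(s0+h))^k)" using s0 h by simp
    then have "s0^e * (1-s0)^k < (s0+h)^e * (1-(s0+h))^k" using s0 h by (subst (asm) ln_less_cancel_iff) auto
    then show False using mono[of "s0+h"] h by auto
  qed
  then have "real e * (1 - s0) \<le> real k * s0" using s0 by (simp add: field_simps)
  then have "real e \<le> real (k+e) * s0" by (simp add: algebra_simps)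
  then have "real e * norm (\<tau>0 - cnj p)^2 \<le> real (k+e) * s0 * norm (\<tau>0 - cnj p)^2"
    by (rule mult_right_mono) simp
  also have "\<dots> = real (k+e) * norm (\<tau>0 - p)^2"
    using nz by (simp add: s0_def w0_def norm_divide power_divide)
  finally show ?thesis .
qed

section \<open>q-expansions as functions on the upper half plane\<close>

locale qseries =
  fixes a :: "nat \<Rightarrow> complex"
  assumes summable_q: "\<And>q. norm q < 1 \<Longrightarrow> summable (\<lambda>m. a m * q^m)"
begin

definition F :: "complex \<Rightarrow> complex" where "F \<tau> = (\<Sum>m. a m * exp (2 * pi * \<i> * \<tau>)^m)"

lemma norm_q: "norm (exp (2 * pi * \<i> * \<tau>)) = exp (- 2 * pi * Im \<tau>)"
  by (simp add: norm_exp_eq_Re)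

lemma norm_q_less: "Im \<tau> > 0 \<Longrightarrow> norm (exp (2 * pi * \<i> * \<tau>)) < 1"
  by (simp add: norm_q)

lemma summable_shift: "norm q < 1 \<Longrightarrow> summable (\<lambda>m. a (m+r) * q^m)"
  using summable_q by (metis summable_powser_ignore_initial_segment)

lemma hol_shift: "(\<lambda>q. \<Sum>m. a (m + r) * q^m) holomorphic_on ball 0 1"
  by (intro power_series_holomorphic[where a = "\<lambda>m. a (m+r)"])
    (auto intro: summable_sums summable_shift)

lemma F_shift:
  assumes "Im \<tau> > 0" "\<And>m. m < r \<Longrightarrow> a m = 0"
  shows "F \<tau> = exp (2 * pi * \<i> * \<tau>)^r * (\<Sum>m. a (m + r) * exp (2 * pi * \<i> * \<tau>)^m)"
proof -
  define q where "q = exp (2 * pi * \<i> * \<tau>)"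
  have s: "summable (\<lambda>m. a m * q^m)" using summable_q norm_q_less assms(1) q_def by blast
  have "F \<tau> = (\<Sum>m. a (m+r) * q^(m+r)) + (\<Sum>m<r. a m * q^m)"
    unfolding F_def q_def[symmetric] by (rule suminf_split_initial_segment[OF s])
  also have "(\<Sum>m<r. a m * q^m) = 0" using assms(2) by simp
  also have "(\<Sum>m. a (m+r) * q^(m+r)) = (\<Sum>m. q^r * (a (m+r) * q^m))" by (simp add: power_add mult_ac)
  also have "\<dots> = q^r * (\<Sum>m. a (m+r) * q^m)"
    by (rule suminf_mult) (use summable_shift norm_q_less assms(1) q_def in blast)
  finally show ?thesis by (simp add: q_def)
qed

lemma F_holomorphic: "F holomorphic_on uhp"
proof -
  have "((\<lambda>q. \<Sum>m. a (m + 0) * q^m) \<circ> (\<lambda>\<tau>. exp (2 * pi * \<i> * \<tau>))) holomorphic_on uhp"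
    by (rule holomorphic_on_compose_gen[OF _ hol_shift])
      (use norm_q_less in \<open>auto intro!: holomorphic_intros simp: uhp_def\<close>)
  then show ?thesis by (simp add: o_def F_def[abs_def])
qed

lemma F_plus1: "F (\<tau> + 1) = F \<tau>"
proof -
  have "exp (2 * pi * \<i> * (\<tau> + 1)) = exp (2 * pi * \<i> * \<tau>) * exp (2 * pi * \<i>)"
    by (simp add: exp_add algebra_simps)
  then show ?thesis by (simp add: F_def)
qed

end

section \<open>The invariant norm of a modular form and its maximum\<close>

text \<open>Invariance under translation by 1 is built into a q-expansion, so the inversion carries
  the whole transformation law.\<close>

locale modular_qseries = qseries +
  fixes k :: nat
  assumes F_S: "\<And>\<tau>. Im \<tau> > 0 \<Longrightarrow> F (-1/\<tau>) = \<tau>^k * F \<tau>"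
begin

text \<open>Squared, so that odd \<open>k\<close> brings in no half-integral power of
  \<open>Im \<tau>\<close>.\<close>

definition h :: "complex \<Rightarrow> real" where "h \<tau> = norm (F \<tau>)^2 * Im \<tau>^k"

lemma h_plus1: "h (\<tau> + 1) = h \<tau>"
  by (simp add: h_def F_plus1)

lemma h_plus_int: "h (\<tau> + of_int n) = h \<tau>"
proof (induction n rule: int_induct[of _ 0])
  case (step1 i) then show ?case using h_plus1[of "\<tau> + of_int i"] by (simp add: add.assoc)
next
  case (step2 i) then show ?case using h_plus1[of "\<tau> + of_int (i-1)"] by (simp add: add.assoc)
qed auto

lemma Im_S: "Im (-1/\<tau>) = Im \<tau> / norm \<tau>^2"
  by (cases "\<tau> = 0") (simp_all add: Im_divide cmod_power2)

lemma h_S: assumes "Im \<tau> > 0" shows "h (-1/\<tau>) = h \<tau>"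
proof -
  have "\<tau> \<noteq> 0" using assms by auto
  then show ?thesis unfolding h_def F_S[OF assms] Im_S
    by (simp add: norm_mult norm_power power_mult_distrib power_divide power_even_eq[symmetric] flip: power_mult)
      (simp add: mult.commute)
qed

lemma exists_int_shift: "\<exists>n::int. \<bar>Re (\<tau> + of_int n)\<bar> \<le> 1/2"
  by (rule exI[of _ "- round (Re \<tau>)"]) (use of_int_round_abs_le[of "Re \<tau>"] in \<open>simp add: abs_minus_commute\<close>)

text \<open>As long as \<open>y < 1/2\<close>, the inversion at least doubles the imaginary part.\<close>

lemma reduce_to_strip:
  assumes "Im \<tau> > 0"
  shows "\<exists>\<sigma>. \<bar>Re \<sigma>\<bar> \<le> 1/2 \<and> Im \<sigma> \<ge> 1/2 \<and> h \<sigma> = h \<tau>"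
proof -
  obtain N :: nat where "(1/2) / Im \<tau> < 2^N" using real_arch_pow[of 2 "(1/2) / Im \<tau>"] by auto
  then have "1/2 \<le> 2^N * Im \<tau>" using assms by (simp add: field_simps)
  then show ?thesis using assms
  proof (induction N arbitrary: \<tau>)
    case 0
    obtain n :: int where "\<bar>Re (\<tau> + of_int n)\<bar> \<le> 1/2" using exists_int_shift by blast
    then show ?case using 0 by (intro exI[of _ "\<tau> + of_int n"]) (simp add: h_plus_int)
  next
    case (Suc N)
    obtain n :: int where n: "\<bar>Re (\<tau> + of_int n)\<bar> \<le> 1/2" using exists_int_shift by blast
    define \<sigma> where "\<sigma> = \<tau> + of_int n"
    have \<sigma>: "h \<sigma> = h \<tau>" "Im \<sigma> = Im \<tau>" "\<bar>Re \<sigma>\<bar> \<le> 1/2" using n by (auto simp: \<sigma>_def h_plus_int)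
    show ?case
    proof (cases "Im \<tau> \<ge> 1/2")
      case True then show ?thesis using \<sigma> by auto
    next
      case False
      have "Re \<sigma>^2 \<le> (1/2)^2" using \<sigma>(3) by (metis abs_ge_zero power2_abs power_mono)
      moreover have "Im \<sigma>^2 \<le> (1/2)^2" using False \<sigma> Suc.prems by (intro power_mono) auto
      ultimately have n2: "norm \<sigma>^2 \<le> 1/2" unfolding cmod_power2 by (simp add: power2_eq_square)
      have "\<sigma> \<noteq> 0" using \<sigma> Suc.prems by auto
      then have np: "norm \<sigma>^2 > 0" by simp
      have "2 * Im \<tau> * norm \<sigma>^2 \<le> 2 * Im \<tau> * (1/2)" using n2 Suc.prems by (intro mult_left_mono) auto
      then have ge: "Im (-1/\<sigma>) \<ge> 2 * Im \<tau>" unfolding Im_S \<sigma> using np by (simp add: field_simps)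
      have "1/2 \<le> 2^N * (2 * Im \<tau>)" using Suc.prems by simp
      also have "\<dots> \<le> 2^N * Im (-1/\<sigma>)" using ge by (intro mult_left_mono) auto
      finally obtain \<sigma>' where "\<bar>Re \<sigma>'\<bar> \<le> 1/2 \<and> Im \<sigma>' \<ge> 1/2 \<and> h \<sigma>' = h (-1/\<sigma>)"
        using Suc.IH[of "-1/\<sigma>"] ge Suc.prems by auto
      then show ?thesis using h_S[of \<sigma>] \<sigma> Suc.prems by auto
    qed
  qed
qed

lemma continuous_h: "continuous_on uhp h"
  unfolding h_def using holomorphic_on_imp_continuous_on[OF F_holomorphic]
  by (intro continuous_intros) auto

text \<open>Because \<open>r >= 1\<close>, \<open>F\<close> has a factor q and \<open>h\<close>
  decays at the cusp, so its supremum over the strip is attained on a compact rectangle. Among the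
  maximum points there, one of greatest height is chosen: if its modulus were below 1, the inversion
  followed by a translation would give a higher one.\<close>

lemma maximum_exists:
  assumes r: "r \<ge> 1" and z: "\<And>m. m < r \<Longrightarrow> a m = 0" and nz: "Im \<tau>1 > 0" "F \<tau>1 \<noteq> 0"
  obtains \<tau>0 where "\<bar>Re \<tau>0\<bar> \<le> 1/2" "norm \<tau>0 \<ge> 1" "Im \<tau>0 > 0" "h \<tau>0 > 0"
    "\<And>\<tau>. Im \<tau> > 0 \<Longrightarrow> h \<tau> \<le> h \<tau>0"
proof -
  define K where "K = {\<tau>. \<bar>Re \<tau>\<bar> \<le> 1/2 \<and> Im \<tau> \<ge> 1/2}"
  have h1: "h \<tau>1 > 0" using nz by (simp add: h_def)
  obtain \<tau>2 where t2: "\<tau>2 \<in> K" "h \<tau>2 = h \<tau>1" using reduce_to_strip[OF nz(1)] by (auto simp: K_def)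
  have strip: "\<exists>\<sigma>. \<sigma> \<in> K \<and> h \<sigma> = h \<tau>" if "Im \<tau> > 0" for \<tau>
    using reduce_to_strip[OF that] by (auto simp: K_def)
  define G where "G q = (\<Sum>m. a (m + r) * q^m)" for q
  have "continuous_on (cball 0 (exp (-pi))) G"
    unfolding G_def by (rule holomorphic_on_imp_continuous_on, rule holomorphic_on_subset[OF hol_shift])
      (use le_less_trans[of _ "exp (-pi)" 1] in auto)
  then have "bounded (G ` cball 0 (exp (-pi)))" by (intro compact_imp_bounded compact_continuous_image) auto
  then obtain C where C: "C > 0" "\<And>q. norm q \<le> exp (-pi) \<Longrightarrow> norm (G q) \<le> C"
    unfolding bounded_pos by (auto simp: image_iff)
  have hle: "h \<tau> \<le> C^2 * (exp (- Im \<tau>) * Im \<tau>^k)" if "Im \<tau> \<ge> 1/2" for \<tau>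
  proof -
    let ?q = "exp (2 * pi * \<i> * \<tau>)"
    have nq: "norm ?q \<le> exp (-pi)" unfolding norm_q using that pi_gt_zero by (simp add: field_simps)
    have "norm (F \<tau>) = norm ?q^r * norm (G ?q)"
      using F_shift[OF _ z] that by (simp add: G_def norm_mult norm_power)
    also have "norm ?q^r \<le> norm ?q^1"
      by (rule power_decreasing) (use r norm_q_less[of \<tau>] that in auto)
    also have "norm ?q^1 \<le> exp (- Im \<tau>)" unfolding norm_q using that pi_ge_two by simp
    also have "norm (G ?q) \<le> C" by (rule C(2)[OF nq])
    finally have "norm (F \<tau>) \<le> exp (- Im \<tau>) * C" using C by (simp add: mult_right_mono mult_left_mono)
    then have "norm (F \<tau>)^2 \<le> (exp (- Im \<tau>) * C)^2" by (intro power_mono) auto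
    also have "\<dots> = C^2 * exp (- Im \<tau>)^2" by (simp add: power_mult_distrib)
    also have "\<dots> \<le> C^2 * exp (- Im \<tau>)^1"
      by (intro mult_left_mono power_decreasing) (use that in auto)
    finally show ?thesis unfolding h_def using that by (simp add: mult_right_mono mult.assoc[symmetric])
  qed
  have lim: "((\<lambda>y::real. C^2 * (y^k / exp y)) \<longlongrightarrow> C^2 * 0) at_top"
    by (intro tendsto_intros tendsto_power_div_exp_0)
  then have "eventually (\<lambda>y. C^2 * (y^k / exp y) < h \<tau>1) at_top"
    by (rule order_tendstoD) (use h1 in simp)
  then obtain Y where Y: "\<And>y. y \<ge> Y \<Longrightarrow> C^2 * (y^k / exp y) < h \<tau>1"
    unfolding eventually_at_top_linorder by blast
  have big: "h \<tau> < h \<tau>1" if "Im \<tau> \<ge> 1/2" "Im \<tau> \<ge> Y" for \<tau>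
    using le_less_trans[OF hle[OF that(1)]] Y[OF that(2)] by (simp add: exp_minus field_simps)
  define KY where "KY = cbox (Complex (-1/2) (1/2)) (Complex (1/2) Y)"
  have KY: "\<tau> \<in> KY \<longleftrightarrow> \<tau> \<in> K \<and> Im \<tau> \<le> Y" for \<tau>
    by (auto simp: KY_def K_def in_cbox_complex_iff abs_le_iff)
  have sub: "KY \<subseteq> uhp" by (auto simp: KY K_def uhp_def)
  have t2Y: "\<tau>2 \<in> KY" using big[of \<tau>2] t2 by (cases "Im \<tau>2 \<le> Y") (auto simp: KY K_def)
  have cont: "continuous_on KY h" using continuous_on_subset[OF continuous_h sub] .
  obtain \<tau>m where m: "\<tau>m \<in> KY" "\<And>\<tau>. \<tau> \<in> KY \<Longrightarrow> h \<tau> \<le> h \<tau>m"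
    using continuous_attains_sup[of KY h] cont t2Y by (auto simp: KY_def)
  have hm: "h \<tau>m \<ge> h \<tau>1" using m(2)[OF t2Y] t2 by simp
  have glob: "h \<tau> \<le> h \<tau>m" if "Im \<tau> > 0" for \<tau>
  proof -
    obtain \<sigma> where s: "\<sigma> \<in> K" "h \<sigma> = h \<tau>" using strip[OF \<open>Im \<tau> > 0\<close>] by blast
    show ?thesis
    proof (cases "Im \<sigma> \<le> Y")
      case True then show ?thesis using m(2)[of \<sigma>] s by (simp add: KY)
    next
      case False then show ?thesis using big[of \<sigma>] s hm by (auto simp: K_def)
    qed
  qed
  define Z where "Z = {\<tau> \<in> KY. h \<tau> = h \<tau>m}"
  have "closed Z" unfolding Z_def
    by (rule continuous_closed_preimage_constant[OF cont]) (simp add: KY_def closed_cbox)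
  then have "compact (KY \<inter> Z)" by (intro compact_Int_closed) (simp_all add: KY_def compact_cbox)
  moreover have "KY \<inter> Z = Z" by (auto simp: Z_def)
  ultimately have "compact Z" by simp
  then obtain \<tau>0 where t0: "\<tau>0 \<in> Z" "\<And>\<tau>. \<tau> \<in> Z \<Longrightarrow> Im \<tau> \<le> Im \<tau>0"
    using continuous_attains_sup[of Z Im] m(1) by (force simp: Z_def intro!: continuous_intros)
  have t0K: "\<tau>0 \<in> K" "h \<tau>0 = h \<tau>m" "Im \<tau>0 > 0" using t0 by (auto simp: Z_def KY K_def)
  have "norm \<tau>0 \<ge> 1"
  proof (rule ccontr)
    assume "\<not> norm \<tau>0 \<ge> 1"
    then have n: "norm \<tau>0^2 < 1" by (simp add: power_less_one_iff)
    have "\<tau>0 \<noteq> 0" using t0K by auto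
    then have Im: "Im (-1/\<tau>0) > Im \<tau>0" unfolding Im_S using n t0K(3) by (simp add: field_simps)
    obtain n :: int where n: "\<bar>Re (-1/\<tau>0 + of_int n)\<bar> \<le> 1/2" using exists_int_shift by blast
    let ?s = "-1/\<tau>0 + of_int n"
    have "h ?s = h \<tau>m" using h_plus_int h_S t0K by metis
    moreover have "Im ?s > Im \<tau>0" using Im by simp
    moreover have "?s \<in> K" using n t0K Im unfolding K_def by (auto simp del: Im_divide)
    moreover have "Im ?s \<le> Y"
    proof (rule ccontr)
      assume "\<not> Im ?s \<le> Y"
      then have "h ?s < h \<tau>1" using big[of ?s] \<open>?s \<in> K\<close> by (simp add: K_def)
      then show False using hm \<open>h ?s = h \<tau>m\<close> by simp
    qed
    ultimately show False using t0(2)[of ?s] by (auto simp: Z_def KY)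
  qed
  then show thesis using that[of \<tau>0] t0K glob hm h1 by (auto simp: K_def)
qed

text \<open>The weight \<open>exp (- 4 * pi * r * y) * y^k\<close> is constant on the circle of q of
  height \<open>y\<close>. The maximum principle on the larger circles \<open>y < y0\<close> shows
  that the weight there is at most its value at \<open>y0\<close>, so its logarithmic derivative
  \<open>k / y0 - 4 * pi * r\<close> is nonnegative.\<close>

lemma maximum_height:
  assumes z: "\<And>m. m < r \<Longrightarrow> a m = 0" and y0: "Im \<tau>0 > 0" "h \<tau>0 > 0"
    and mx: "\<And>\<tau>. Im \<tau> > 0 \<Longrightarrow> h \<tau> \<le> h \<tau>0"
  shows "4 * pi * r * Im \<tau>0 \<le> k"
proof -
  define G where "G q = (\<Sum>m. a (m + r) * q^m)" for q
  define y0 where "y0 = Im \<tau>0"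
  have holG: "G holomorphic_on ball 0 1" unfolding G_def by (rule hol_shift)
  have hG: "h \<tau> = (exp (- 4 * pi * r * Im \<tau>) * Im \<tau>^k) * norm (G (exp (2 * pi * \<i> * \<tau>)))^2" if "Im \<tau> > 0" for \<tau>
  proof -
    have "norm (F \<tau>) = exp (- 2 * pi * Im \<tau>)^r * norm (G (exp (2 * pi * \<i> * \<tau>)))"
      using F_shift[OF that z] by (simp add: G_def norm_mult norm_power norm_q)
    moreover have "(exp (- 2 * pi * Im \<tau>)^r)^2 = exp (- 4 * pi * r * Im \<tau>)"
      by (simp add: exp_of_nat_mult[symmetric] exp_double[symmetric] algebra_simps flip: power_mult)
    ultimately show ?thesis by (simp add: h_def power_mult_distrib)
  qed
  have mono: "exp (- 4 * pi * r * y) * y^k \<le> exp (- 4 * pi * r * y0) * y0^k" if y: "0 < y" "y < y0" for y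
  proof -
    define E where "E = exp (- 4 * pi * r * y) * y^k"
    define E0 where "E0 = exp (- 4 * pi * r * y0) * y0^k"
    have E: "E > 0" using y by (simp add: E_def)
    have "norm (G (exp (2 * pi * \<i> * \<tau>0))) \<le> sqrt (h \<tau>0 / E)"
    proof (rule max_modulus_cball[OF holG])
      show "exp (-2 * pi * y) < 1" using y by simp
      show "norm (exp (2 * pi * \<i> * \<tau>0)) \<le> exp (-2 * pi * y)" unfolding norm_q using y by (simp add: y0_def)
      fix q :: complex assume q: "norm q = exp (-2 * pi * y)"
      then have q0: "q \<noteq> 0" by auto
      \<comment> \<open>Any logarithm serves here: different branches only translate
        \<open>\<tau>\<close> by an integer.\<close>
      define \<tau> where "\<tau> = Ln q / (2 * pi * \<i>)"
      have "2 * pi * \<i> * \<tau> = Ln q" by (simp add: \<tau>_def)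
      then have eq: "exp (2 * pi * \<i> * \<tau>) = q" using q0 by simp
      have "exp (- 2 * pi * Im \<tau>) = exp (-2 * pi * y)" unfolding norm_q[of \<tau>, symmetric] eq q ..
      then have Im: "Im \<tau> = y" by simp
      then have "E * norm (G q)^2 \<le> h \<tau>0" using mx[of \<tau>] hG[of \<tau>] y eq by (simp add: E_def)
      then have "norm (G q)^2 \<le> h \<tau>0 / E" using E by (simp add: field_simps)
      then show "norm (G q) \<le> sqrt (h \<tau>0 / E)" by (rule real_le_rsqrt)
    qed
    then have "norm (G (exp (2 * pi * \<i> * \<tau>0)))^2 \<le> sqrt (h \<tau>0 / E)^2" by (intro power_mono) auto
    also have "\<dots> = h \<tau>0 / E" using E assms by simp
    finally have "E * norm (G (exp (2 * pi * \<i> * \<tau>0)))^2 \<le> E0 * norm (G (exp (2 * pi * \<i> * \<tau>0)))^2"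
      using hG[OF y0(1)] E by (simp add: field_simps E0_def y0_def)
    moreover have "norm (G (exp (2 * pi * \<i> * \<tau>0)))^2 > 0" using hG[OF y0(1)] y0(2) by auto
    ultimately show ?thesis by (simp only: mult_le_cancel_right_pos E_def E0_def)
  qed
  have y0p: "y0 > 0" using assms by (simp add: y0_def)
  have "4 * pi * r - k / y0 \<le> 0"
  proof (rule ccontr)
    assume "\<not> ?thesis"
    then have d: "4 * pi * r - k / y0 > 0" by simp
    have der: "((\<lambda>y. 4 * pi * r * y - real k * ln y) has_real_derivative (4 * pi * r - k / y0)) (at y0)"
      using y0p by (auto intro!: derivative_eq_intros)
    obtain d where d: "d > 0" "\<forall>h>0. h < d \<longrightarrow> 4 * pi * r * (y0 - h) - real k * ln (y0 - h) < 4 * pi * r * y0 - real k * ln y0"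
      using DERIV_pos_inc_left[OF der d] by blast
    define y where "y = y0 - min (d/2) (y0/2)"
    have y: "0 < y" "y < y0" using d y0p by (auto simp: y_def min_def)
    have lt: "4 * pi * r * y - real k * ln y < 4 * pi * r * y0 - real k * ln y0"
      using d y0p unfolding y_def by (auto simp: min_def)
    have e: "exp (- 4 * pi * r * y) * y^k = exp (- (4 * pi * r * y - real k * ln y))" if "y > 0" for y
      using that by (simp add: exp_diff exp_minus exp_of_nat_mult field_simps)
    show False using mono[OF y] lt unfolding e[OF y(1)] e[OF y0p] by simp
  qed
  then show ?thesis using y0p by (simp add: field_simps y0_def)
qed

section \<open>Zeros forced at the elliptic points\<close>

text \<open>The map \<open>\<tau> \<mapsto> -1 / (\<tau> + 1)\<close> fixes \<open>p\<close> and has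
  derivative \<open>1 / (p + 1)^2\<close> there. Evaluating the transformation law at
  \<open>p\<close> gives the first equation; differentiating it at a zero gives the second, and the
  derivative of the map raises the exponent by 2.\<close>

lemma deriv_at_rho_transform:
  assumes p: "p = Complex (-1/2) (sqrt 3 / 2)"
  shows "F p = (p + 1)^k * F p" "F p = 0 \<Longrightarrow> deriv F p = (p + 1)^(k+2) * deriv F p"
proof -
  have Imp: "Im p > 0" by (simp add: p)
  have p1: "p + 1 \<noteq> 0" using Imp by (auto simp: complex_eq_iff)
  have fixp: "-1/(p+1) = p"
  proof -
    have "p * (p + 1) = -1" by (simp add: p complex_eq_iff field_simps)
    then show ?thesis using p1 by (simp add: field_simps)
  qed
  have eq: "F (-1/(\<tau>+1)) = (\<tau>+1)^k * F \<tau>" if "\<tau> \<in> uhp" for \<tau>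
    using F_S[of "\<tau>+1"] F_plus1[of \<tau>] that by (simp add: uhp_def)
  show "F p = (p + 1)^k * F p" using eq[of p] fixp Imp by (simp add: uhp_def)
  assume F0: "F p = 0"
  have dF: "(F has_field_derivative deriv F p) (at p)"
    using holomorphic_derivI[OF F_holomorphic open_uhp] Imp by (simp add: uhp_def)
  have "((\<lambda>\<tau>. F (-1/(\<tau>+1))) has_field_derivative deriv F p * (1/(p+1)^2)) (at p)"
  proof (rule DERIV_chain2[where f = F])
    show "(F has_field_derivative deriv F p) (at (-1/(p+1)))" using dF fixp by simp
    show "((\<lambda>\<tau>. -1/(\<tau>+1)) has_field_derivative 1/(p+1)^2) (at p)"
      using p1 by (auto intro!: derivative_eq_intros simp: power2_eq_square)
  qed
  moreover have "((\<lambda>\<tau>. (\<tau>+1)^k * F \<tau>) has_field_derivative (p+1)^k * deriv F p) (at p)"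
    using dF F0 by (auto intro!: derivative_eq_intros)
  then have "((\<lambda>\<tau>. F (-1/(\<tau>+1))) has_field_derivative (p+1)^k * deriv F p) (at p)"
    by (rule has_field_derivative_transform_within_open[OF _ open_uhp])
      (use eq Imp in \<open>auto simp: uhp_def\<close>)
  ultimately have "deriv F p * (1/(p+1)^2) = (p+1)^k * deriv F p" by (rule DERIV_unique)
  then show "deriv F p = (p + 1)^(k+2) * deriv F p" using p1 by (simp add: power_add divide_eq_eq mult_ac power2_eq_square)
qed

text \<open>\<open>p + 1\<close> is the primitive sixth root of unity
  \<open>exp (pi * \<i> / 3)\<close>, so these powers are the two primitive cube roots of unity
  \<open>p\<close> and \<open>-1 - p\<close>.\<close>

lemma rho_plus1_powers:
  fixes p :: complex
  assumes p: "p = Complex (-1/2) (sqrt 3 / 2)"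
    and n: "n mod 6 = 2 \<or> n mod 6 = 4"
  shows "(p + 1)^n \<noteq> 1"
proof -
  have sq: "(p+1)^2 = p" by (simp add: p complex_eq_iff power2_eq_square field_simps)
  have sq2: "(p+1)^4 = -1 - p"
    using sq by (simp add: p complex_eq_iff power4_eq_xxxx field_simps)
  have six: "(p+1)^6 = 1"
  proof -
    have "(p+1)^6 = (p+1)^2 * (p+1)^4" by (simp flip: power_add)
    also have "\<dots> = 1" unfolding sq sq2 by (simp add: p complex_eq_iff field_simps)
    finally show ?thesis .
  qed
  have "(p+1)^n = (p+1)^(6 * (n div 6) + n mod 6)" by simp
  also have "\<dots> = (p+1)^(n mod 6)" unfolding power_add power_mult six by simp
  finally have "(p+1)^n = p \<or> (p+1)^n = -1 - p" using n sq sq2 by auto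
  then show ?thesis by (auto simp: p complex_eq_iff)
qed

text \<open>For \<open>k mod 6 = 4\<close> the value at \<open>p\<close> must vanish; for
  \<open>k mod 6 = 2\<close> so must the derivative, which behaves like weight \<open>k + 2\<close>.
  This explains \<open>e\<close>. The absolute value of \<open>Re \<tau>0\<close> appears because a
  point on the right is first translated by -1, which amounts to comparing it with the zero at
  \<open>p + 1\<close>.\<close>

lemma h_maximum_far_from_rho:
  assumes ke: "e = 2 \<and> k mod 6 = 2 \<or> e = 1 \<and> k mod 6 = 4"
    and t0: "Im \<tau>0 > 0" "h \<tau>0 > 0" "\<bar>Re \<tau>0\<bar> \<le> 1/2"
    and mx: "\<And>\<tau>. Im \<tau> > 0 \<Longrightarrow> h \<tau> \<le> h \<tau>0"
  shows "e * ((1/2 - \<bar>Re \<tau>0\<bar>)^2 + (Im \<tau>0 + sqrt 3 / 2)^2) \<le>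
    (k + e) * ((1/2 - \<bar>Re \<tau>0\<bar>)^2 + (Im \<tau>0 - sqrt 3 / 2)^2)"
proof -
  define p where "p = Complex (-1/2) (sqrt 3 / 2)"
  have Imp: "Im p > 0" by (simp add: p_def)
  have F0: "F p = 0"
    using deriv_at_rho_transform(1)[OF p_def] rho_plus1_powers[OF p_def, of k] ke by auto
  obtain g1 where g1: "g1 holomorphic_on uhp" "\<And>z. F z = (z - p) * g1 z" "g1 p = deriv F p"
    using holomorphic_factor_zero[OF F_holomorphic open_uhp F0] by blast
  obtain g where g: "g holomorphic_on uhp" "\<And>z. F z = (z - p)^e * g z"
  proof (cases "e = 1")
    case True then show ?thesis using that[of g1] g1 by simp
  next
    case False
    then have e: "e = 2" "k mod 6 = 2" using ke by auto
    then have "(k+2) mod 6 = 4" by presburger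
    then have "deriv F p = 0"
      using deriv_at_rho_transform(2)[OF p_def F0] rho_plus1_powers[OF p_def, of "k+2"] by auto
    then have "g1 p = 0" using g1 by simp
    then obtain g2 where "g2 holomorphic_on uhp" "\<And>z. g1 z = (z - p) * g2 z"
      using holomorphic_factor_zero[OF g1(1) open_uhp] by blast
    then show ?thesis using that[of g2] g1 e by (simp add: power2_eq_square mult.assoc)
  qed
  have e1: "e \<ge> 1" using ke by auto
  have far: "real e * norm (\<tau> - cnj p)^2 \<le> real (k + e) * norm (\<tau> - p)^2" if "Im \<tau> > 0" "h \<tau> = h \<tau>0" for \<tau>
  proof (rule maximum_far_from_zero[OF g(1) Imp that(1) e1, where M = "h \<tau>0"])
    show "norm ((\<tau> - p)^e * g \<tau>)^2 * Im \<tau>^k \<le> h \<tau>0" if "Im \<tau> > 0" for \<tau>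
      using mx[OF that] by (simp add: h_def g(2))
    show "norm ((\<tau> - p)^e * g \<tau>)^2 * Im \<tau>^k = h \<tau>0" using that(2) by (simp add: h_def flip: g(2))
  qed (use t0 in auto)
  show ?thesis
  proof (cases "Re \<tau>0 \<le> 0")
    case True
    then show ?thesis using far[of \<tau>0] t0 unfolding cmod_power2 by (simp add: p_def add.commute[of _ "1/2"])
  next
    case False
    have "h (\<tau>0 - 1) = h \<tau>0" using h_plus1[of "\<tau>0 - 1"] by simp
    moreover have "(Re \<tau>0 - 1/2)^2 = (1/2 - Re \<tau>0)^2" by (simp add: power2_commute)
    ultimately show ?thesis using far[of "\<tau>0 - 1"] t0 False unfolding cmod_power2 by (simp add: p_def)
  qed
qed

text \<open>The inversion fixes \<open>\<i>\<close>, and \<open>\<i>^k = -1\<close> turns its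
  functional equation into \<open>F \<i> = - F \<i>\<close>.\<close>

lemma h_maximum_far_from_i:
  assumes ke: "k mod 4 = 2" and t0: "Im \<tau>0 > 0" "h \<tau>0 > 0"
    and mx: "\<And>\<tau>. Im \<tau> > 0 \<Longrightarrow> h \<tau> \<le> h \<tau>0"
  shows "Re \<tau>0^2 + (Im \<tau>0 + 1)^2 \<le> (k + 1) * (Re \<tau>0^2 + (Im \<tau>0 - 1)^2)"
proof -
  have "\<i>^k = \<i>^(4 * (k div 4) + k mod 4)" by simp
  also have "\<dots> = -1" unfolding power_add power_mult ke by simp
  finally have "\<i>^k = -1" .
  then have F0: "F \<i> = 0" using F_S[of \<i>] by simp
  obtain g where g: "g holomorphic_on uhp" "\<And>z. F z = (z - \<i>) * g z"
    using holomorphic_factor_zero[OF F_holomorphic open_uhp F0] by blast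
  have "real 1 * norm (\<tau>0 - cnj \<i>)^2 \<le> real (k + 1) * norm (\<tau>0 - \<i>)^2"
  proof (rule maximum_far_from_zero[OF g(1) _ t0(1), where M = "h \<tau>0"])
    show "norm ((\<tau> - \<i>)^1 * g \<tau>)^2 * Im \<tau>^k \<le> h \<tau>0" if "Im \<tau> > 0" for \<tau>
      using mx[OF that] by (simp add: h_def g(2))
    show "norm ((\<tau>0 - \<i>)^1 * g \<tau>0)^2 * Im \<tau>0^k = h \<tau>0" by (simp add: h_def g(2))
  qed (use t0 in auto)
  then show ?thesis unfolding cmod_power2 by simp
qed

text \<open>Once the coefficients below \<open>r\<close> are zero, \<open>F\<close> is
  \<open>q^r\<close> times a power series that vanishes on the punctured disc, since every nonzero q
  there comes from some \<open>\<tau>\<close>. By continuity its constant term \<open>a r\<close>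
  vanishes too.\<close>

lemma F_zero_imp_coeffs_zero:
  assumes "\<And>\<tau>. Im \<tau> > 0 \<Longrightarrow> F \<tau> = 0"
  shows "a m = 0"
proof (induction m rule: less_induct)
  case (less r)
  define G where "G q = (\<Sum>m. a (m + r) * q^m)" for q
  have G0: "G q = 0" if q: "q \<noteq> 0" "norm q < 1" for q
  proof -
    define \<tau> where "\<tau> = Ln q / (2 * pi * \<i>)"
    have "2 * pi * \<i> * \<tau> = Ln q" by (simp add: \<tau>_def)
    then have eq: "exp (2 * pi * \<i> * \<tau>) = q" using q by simp
    have "exp (- 2 * pi * Im \<tau>) < 1" unfolding norm_q[of \<tau>, symmetric] eq by (rule q)
    then have Im: "Im \<tau> > 0" by (simp add: zero_less_mult_iff)
    have "q^r * G q = 0" using F_shift[OF Im less] assms[OF Im] unfolding eq G_def by simp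
    then show ?thesis using q by simp
  qed
  have "isCont G 0"
    using holomorphic_on_imp_continuous_on[OF hol_shift[of r]] unfolding G_def[symmetric, abs_def]
    by (simp add: continuous_on_eq_continuous_at)
  then have "(G \<longlongrightarrow> G 0) (at 0)" by (simp add: isCont_def)
  moreover have "(G \<longlongrightarrow> 0) (at 0)"
    by (rule tendsto_eventually) (use G0 in \<open>auto simp: eventually_at intro!: exI[of _ 1]\<close>)
  ultimately have "G 0 = 0" using tendsto_unique by (metis trivial_limit_at)
  then show ?case by (simp add: G_def powser_zero)
qed

text \<open>The pairs \<open>r = 1\<close>, \<open>k = 12\<close> and \<open>r = 2\<close>,
  \<open>k = 24\<close> have to be absent: the discriminant form and its square are nonzero.\<close>

theorem coeffs_vanish:
  assumes z: "\<And>m. m < r \<Longrightarrow> a m = 0"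
    and cases: "r = 1 \<and> k \<le> 10 \<or> r = 1 \<and> k = 14 \<or> r = 2 \<and> k \<le> 20 \<or> r = 2 \<and> k = 22 \<or> r = 2 \<and> k = 26"
  shows "a m = 0"
proof (rule F_zero_imp_coeffs_zero, rule ccontr)
  fix \<tau>1 assume "Im \<tau>1 > 0" "F \<tau>1 \<noteq> 0"
  moreover have "r \<ge> 1" using cases by auto
  ultimately obtain \<tau>0 where t: "\<bar>Re \<tau>0\<bar> \<le> 1/2" "norm \<tau>0 \<ge> 1" "Im \<tau>0 > 0" "h \<tau>0 > 0"
    and mx: "\<And>\<tau>. Im \<tau> > 0 \<Longrightarrow> h \<tau> \<le> h \<tau>0"
    using maximum_exists[of r \<tau>1] z by blast
  define x y c where "x = \<bar>Re \<tau>0\<bar>" and "y = Im \<tau>0" and "c = sqrt 3 / 2"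
  have c2: "c^2 = 3/4" by (simp add: c_def power_divide)
  \<comment> \<open>Rational bounds 0.866 and 0.867 for \<open>sqrt 3 / 2\<close>; together with
    \<open>pi > 3\<close> they are sharp enough for every case.\<close>
  have c: "c \<ge> 433/500" "c \<le> 867/1000" unfolding c_def
    using real_le_rsqrt[of "433/250" 3] real_le_lsqrt[of "867/500" 3] by (auto simp: power2_eq_square)
  have xy: "0 \<le> x" "x \<le> 1/2" "y > 0" using t by (auto simp: x_def y_def)
  have n: "x^2 + y^2 \<ge> 1"
    using t(2) by (simp add: cmod_def x_def y_def)
  have x2: "x^2 \<le> 1/4" using power_mono[OF xy(2,1), of 2] by (simp add: power2_eq_square)
  have "y^2 \<ge> c^2" using n x2 c2 by simp
  then have yc: "y \<ge> c" using xy(3) by (rule power2_le_imp_le[OF _ less_imp_le])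
  have "4 * pi * r * y \<le> k" unfolding y_def by (rule maximum_height[OF z t(3,4) mx])
  moreover have "4 * 3 * (r * y) \<le> 4 * pi * (r * y)" using pi_gt3 xy by (intro mult_right_mono) auto
  ultimately have ht: "12 * r * y \<le> k" by (simp add: mult_ac)
  have rho: "e * ((1/2 - x)^2 + (y + c)^2) \<le> (k + e) * ((1/2 - x)^2 + (y - c)^2)"
    if "e = 2 \<and> k mod 6 = 2 \<or> e = 1 \<and> k mod 6 = 4" for e
    unfolding x_def y_def c_def by (rule h_maximum_far_from_rho[OF that t(3,4,1) mx])
  consider "r = 1" "k \<le> 10" | "r = 1" "k = 14" | "r = 2" "k \<le> 20" | "r = 2" "k = 22" | "r = 2" "k = 26"
    using cases by blast
  then show False
  proof cases
    case 1
    \<comment> \<open>The height bound fails at once, since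
      \<open>12 * r * 433/500 > 10 * r\<close>.\<close>
    then show ?thesis using ht yc c by simp
  next
    case 3
    then show ?thesis using ht yc c by simp
  next
    case 2
    then have y1: "y \<le> 7/6" using ht by simp
    have "2 * ((1/2 - x)^2 + (y + c)^2) \<le> 16 * ((1/2 - x)^2 + (y - c)^2)" using rho[of 2] 2 by simp
    then have "0 \<le> 14 * (1/2 - x)^2 + 14 * y^2 - 36 * (c * y) + 14 * c^2" by (simp add: power2_eq_square algebra_simps)
    moreover have "(1/2 - x)^2 \<le> (1/2)^2" using xy by (intro power_mono) auto
    \<comment> \<open>The inequality at the elliptic point is a convex quadratic in
      \<open>y\<close>, so it is refuted on the interval from \<open>c\<close> to 7/6 by its
      endpoints. Replacing \<open>y^2\<close> by its chord makes the refutation linear; the other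
      cases do the same with their own height bounds.\<close>
    moreover have "y^2 \<le> c * y + 7/6 * y - 7/6 * c"
      using mult_nonneg_nonneg[of "y - c" "7/6 - y"] yc y1 by (simp add: power2_eq_square algebra_simps add_divide_distrib diff_divide_distrib)
    moreover have "c * y \<ge> 433/500 * y" using c xy by (intro mult_right_mono) auto
    ultimately show ?thesis using c2 c yc y1 by (simp only: power2_eq_square[of "1/2::real"])
  next
    case 4
    then have y1: "y \<le> 11/12" using ht by simp
    have "((1/2 - x)^2 + (y + c)^2) \<le> 23 * ((1/2 - x)^2 + (y - c)^2)" using rho[of 1] 4 by simp
    then have *: "0 \<le> 22 * (1/2 - x)^2 + 22 * y^2 - 48 * (c * y) + 22 * c^2" by (simp add: power2_eq_square algebra_simps)
    \<comment> \<open>A low point outside the unit circle has to lie near the vertical edge: the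
      height bound confines it to the corner at \<open>exp (2 * pi * \<i> / 3)\<close> or its mirror
      image.\<close>
    have "y^2 \<le> (11/12)^2" using xy y1 by (intro power_mono) auto
    then have "x^2 \<ge> (39/100)^2" using n by (simp add: power2_eq_square)
    then have "x \<ge> 39/100" using xy(1) by (rule power2_le_imp_le)
    then have "(1/2 - x)^2 \<le> (11/100)^2" using xy by (intro power_mono) auto
    moreover have "y^2 \<le> c * y + 11/12 * y - 11/12 * c"
      using mult_nonneg_nonneg[of "y - c" "11/12 - y"] yc y1 by (simp add: power2_eq_square algebra_simps add_divide_distrib diff_divide_distrib)
    moreover have "c * y \<ge> 433/500 * y" using c xy by (intro mult_right_mono) auto
    ultimately show ?thesis using * c2 c yc y1 by (simp only: power2_eq_square[of "47/100::real"] power2_eq_square[of "11/100::real"] power2_eq_square[of "3/100::real"])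
  next
    case 5
    then have y1: "y \<le> 13/12" using ht by simp
    \<comment> \<open>The zero at the corner does not suffice near the imaginary axis: at
      \<open>\<tau> = \<i>\<close> its inequality reads \<open>0 <= 52 - 30 * sqrt 3\<close>, which
      is narrowly true. The zero at \<open>\<i>\<close> covers small \<open>x\<close>; the threshold
      3/100 lies in the range where both arguments work.\<close>
    show ?thesis
    proof (cases "x \<ge> 3/100")
      case True
      have "2 * ((1/2 - x)^2 + (y + c)^2) \<le> 28 * ((1/2 - x)^2 + (y - c)^2)" using rho[of 2] 5 by simp
      then have *: "0 \<le> 26 * (1/2 - x)^2 + 26 * y^2 - 60 * (c * y) + 26 * c^2" by (simp add: power2_eq_square algebra_simps)
      have "(1/2 - x)^2 \<le> (47/100)^2" using xy True by (intro power_mono) auto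
      moreover have "y^2 \<le> c * y + 13/12 * y - 13/12 * c"
      using mult_nonneg_nonneg[of "y - c" "13/12 - y"] yc y1 by (simp add: power2_eq_square algebra_simps add_divide_distrib diff_divide_distrib)
      moreover have "c * y \<ge> c * c" using c yc by (intro mult_left_mono) auto
      moreover have "c * y \<ge> 433/500 * y" using c xy by (intro mult_right_mono) auto
      ultimately show ?thesis using * c2 c yc y1 by (simp only: power2_eq_square[of "47/100::real"] power2_eq_square[of "11/100::real"] power2_eq_square[of "3/100::real"])
    next
      case False
      have "x^2 + (y + 1)^2 \<le> 27 * (x^2 + (y - 1)^2)"
        using h_maximum_far_from_i[OF _ t(3,4) mx] 5 by (simp add: x_def y_def)
      then have *: "0 \<le> 26 * x^2 + 26 * y^2 - 56 * y + 26" by (simp add: power2_eq_square algebra_simps)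
      have "x^2 \<le> (3/100)^2" using False xy by (intro power_mono) auto
      moreover have "y^2 \<le> c * y + 13/12 * y - 13/12 * c"
      using mult_nonneg_nonneg[of "y - c" "13/12 - y"] yc y1 by (simp add: power2_eq_square algebra_simps add_divide_distrib diff_divide_distrib)
      moreover have "c * y \<le> 867/1000 * y" using c xy by (intro mult_right_mono) auto
      ultimately show ?thesis using * c2 c yc y1 by (simp only: power2_eq_square[of "47/100::real"] power2_eq_square[of "11/100::real"] power2_eq_square[of "3/100::real"])
    qed
  qed
qed

end

section \<open>A concentrating trigonometric kernel\<close>

lemma integrable_indicator_bounded:
  fixes f :: "'a::euclidean_space \<Rightarrow> 'b::{banach, second_countable_topology}"
  assumes [measurable]: "D \<in> sets borel" "f \<in> borel_measurable borel"
    and fin: "emeasure lborel D < \<infinity>" and bd: "\<And>u. u \<in> D \<Longrightarrow> norm (f u) \<le> c"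
  shows "integrable lborel (\<lambda>u. indicator D u *\<^sub>R f u)"
proof (rule Bochner_Integration.integrable_bound)
  show "integrable lborel (\<lambda>u. indicator D u *\<^sub>R c)"
    using fin by (intro integrable_real_indicator integrable_scaleR_left) auto
qed (use bd in \<open>auto split: split_indicator intro!: AE_I2 intro: order_trans[OF _ abs_ge_self]\<close>)

text \<open>Laplace's method: away from 0 compactness gives \<open>\<kappa> <= q < 1\<close>, while
  \<open>\<kappa> >= q'\<close> on a ball for some \<open>q' > q\<close>, so the tail relative to
  the total mass is of order \<open>(q/q')^N\<close>. There are two sets because \<open>D\<close>
  will be a half-open cell, whereas the bound \<open>q\<close> needs a compact set.\<close>

lemma peak_kernel_limit:
  fixes F :: "'a::euclidean_space \<Rightarrow> complex" and \<kappa> :: "'a \<Rightarrow> real"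
  assumes D: "D \<in> sets borel" "D \<subseteq> Dc" "compact Dc" "e0 > 0" "ball 0 e0 \<subseteq> D"
    and F: "F \<in> borel_measurable borel" "\<And>u. u \<in> D \<Longrightarrow> norm (F u) \<le> C" "isCont F 0"
    and k: "continuous_on UNIV \<kappa>" "\<And>u. 0 \<le> \<kappa> u" "\<And>u. \<kappa> u \<le> 1" "\<kappa> 0 = 1"
      "\<And>u. u \<in> Dc \<Longrightarrow> u \<noteq> 0 \<Longrightarrow> \<kappa> u < 1"
  shows "\<And>N. (\<integral>u. indicator D u *\<^sub>R \<kappa> u^N \<partial>lborel) > 0"
    and "(\<lambda>N. (\<integral>u. indicator D u *\<^sub>R (\<kappa> u^N *\<^sub>R F u) \<partial>lborel) / complex_of_real (\<integral>u. indicator D u *\<^sub>R \<kappa> u^N \<partial>lborel)) \<longlonglongrightarrow> F 0"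
proof -
  note [measurable] = D(1) F(1)
  have [measurable]: "\<kappa> \<in> borel_measurable borel" by (rule borel_measurable_continuous_onI[OF k(1)])
  define J where "J N = (\<integral>u. indicator D u *\<^sub>R \<kappa> u^N \<partial>lborel)" for N
  have fin: "emeasure lborel D < \<infinity>"
    using emeasure_mono[OF D(2), of lborel] emeasure_compact_finite[OF D(3)] D(3)
    by (auto simp: compact_imp_closed intro: le_less_trans)
  have intD: "integrable lborel (\<lambda>u. indicator D u *\<^sub>R c)" for c :: real
    using fin by (intro integrable_real_indicator integrable_scaleR_left) auto
  have C0: "C \<ge> 0" using F(2)[of 0] D(4,5) norm_ge_zero order_trans by (metis centre_in_ball subsetD)
  have k1: "\<bar>\<kappa> u\<bar>^N \<le> 1" for u N using k(2,3)[of u] by (simp add: power_le_one)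
  have iJ: "integrable lborel (\<lambda>u. indicator D u *\<^sub>R \<kappa> u^N)" for N
    by (rule integrable_indicator_bounded[OF D(1) _ fin, where c = 1]) (use k1 in \<open>auto simp: power_abs\<close>)
  have lower: "J N \<ge> q^N * measure lborel (ball (0::'a) e)"
    if "q \<ge> 0" "e > 0" "ball 0 e \<subseteq> D" "\<And>u. u \<in> ball 0 e \<Longrightarrow> q \<le> \<kappa> u" for q e N
  proof -
    have "q^N * measure lborel (ball (0::'a) e) = (\<integral>u. indicator (ball (0::'a) e) u *\<^sub>R q^N \<partial>lborel)"
      using emeasure_lborel_ball_finite[of "0::'a" e] by (simp add: mult.commute)
    also have "\<dots> \<le> J N" unfolding J_def
    proof (rule integral_mono[OF _ iJ])
      show "integrable lborel (\<lambda>u. indicator (ball (0::'a) e) u *\<^sub>R q^N)"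
        using emeasure_lborel_ball_finite[of "0::'a" e] by (intro integrable_real_indicator integrable_scaleR_left) auto
      show "indicator (ball (0::'a) e) u *\<^sub>R q^N \<le> indicator D u *\<^sub>R \<kappa> u^N" for u
        using that k(2)[of u] by (auto split: split_indicator intro!: power_mono)
    qed
    finally show ?thesis .
  qed
  have nbhd: "\<exists>e>0. ball 0 e \<subseteq> D \<and> (\<forall>u\<in>ball 0 e. q \<le> \<kappa> u)" if "q < 1" for q
  proof -
    have "isCont \<kappa> 0" using k(1) by (simp add: continuous_on_eq_continuous_at)
    then have "(\<kappa> \<longlongrightarrow> \<kappa> 0) (nhds 0)" by (simp add: isCont_def tendsto_at_iff_tendsto_nhds)
    then have "\<forall>\<^sub>F u in nhds 0. q < \<kappa> u"
      by (rule order_tendstoD(1)) (use that k(4) in simp)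
    then obtain e where "e > 0" "\<And>u. dist u 0 < e \<Longrightarrow> q < \<kappa> u" unfolding eventually_nhds_metric by auto
    then show ?thesis using D(4,5) by (intro exI[of _ "min e e0"]) (force simp: dist_commute)
  qed
  have ballpos: "measure lborel (ball (0::'a) e) > 0" if "e > 0" for e
    using that content_ball_pos[of e "0::'a"] by simp
  show Jpos: "J N > 0" for N
  proof -
    obtain e where "e > 0" "ball 0 e \<subseteq> D" "\<forall>u\<in>ball 0 e. 1/2 \<le> \<kappa> u" using nbhd[of "1/2"] by auto
    then have "J N \<ge> (1/2)^N * measure lborel (ball (0::'a) e)" by (intro lower) auto
    moreover have "(1/2)^N * measure lborel (ball (0::'a) e) > 0" using ballpos \<open>e > 0\<close> by simp
    ultimately show ?thesis by linarith
  qed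
  define A where "A N = (\<integral>u. indicator D u *\<^sub>R (\<kappa> u^N *\<^sub>R F u) \<partial>lborel)" for N
  have iA: "integrable lborel (\<lambda>u. indicator D u *\<^sub>R (\<kappa> u^N *\<^sub>R F u))" for N
  proof (rule integrable_indicator_bounded[OF D(1) _ fin, where c = C])
    fix u assume "u \<in> D"
    then show "norm (\<kappa> u^N *\<^sub>R F u) \<le> C" using F(2)[of u] k1[of u N] C0
      by (simp add: power_abs mult_le_one mult_mono[of "\<bar>\<kappa> u\<bar>^N" 1 "norm (F u)" C, simplified])
  qed measurable
  have AJ: "norm (A N - J N *\<^sub>R F 0) \<le> \<epsilon> * J N + 2 * C * q^N * measure lborel D"
    if "\<delta> > 0" "\<And>u. norm u < \<delta> \<Longrightarrow> norm (F u - F 0) \<le> \<epsilon>" "q \<ge> 0" "\<And>u. u \<in> D \<Longrightarrow> norm u \<ge> \<delta> \<Longrightarrow> \<kappa> u \<le> q" "\<epsilon> \<ge> 0" for \<delta> \<epsilon> q N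
  proof -
    have "A N - J N *\<^sub>R F 0 = (\<integral>u. indicator D u *\<^sub>R (\<kappa> u^N *\<^sub>R F u) - (indicator D u *\<^sub>R \<kappa> u^N) *\<^sub>R F 0 \<partial>lborel)"
      unfolding A_def J_def using iA iJ by (subst Bochner_Integration.integral_diff) auto
    also have "norm \<dots> \<le> (\<integral>u. \<epsilon> * (indicator D u *\<^sub>R \<kappa> u^N) + indicator D u *\<^sub>R (2 * C * q^N) \<partial>lborel)"
    proof (rule Bochner_Integration.integral_norm_bound_integral)
      show "integrable lborel (\<lambda>u. indicator D u *\<^sub>R (\<kappa> u^N *\<^sub>R F u) - (indicator D u *\<^sub>R \<kappa> u^N) *\<^sub>R F 0)"
        using iA iJ by auto
      show "integrable lborel (\<lambda>u. \<epsilon> * (indicator D u *\<^sub>R \<kappa> u^N) + indicator D u *\<^sub>R (2 * C * q^N))"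
        using intD iJ by (intro Bochner_Integration.integrable_add integrable_mult_right) auto
      fix u
      show "norm (indicator D u *\<^sub>R (\<kappa> u^N *\<^sub>R F u) - (indicator D u *\<^sub>R \<kappa> u^N) *\<^sub>R F 0) \<le>
        \<epsilon> * (indicator D u *\<^sub>R \<kappa> u^N) + indicator D u *\<^sub>R (2 * C * q^N)"
      proof (cases "u \<in> D")
        case True
        have "norm (\<kappa> u^N *\<^sub>R (F u - F 0)) \<le> \<epsilon> * \<kappa> u^N + 2 * C * q^N"
        proof (cases "norm u < \<delta>")
          case True
          have "\<kappa> u^N * norm (F u - F 0) \<le> \<kappa> u^N * \<epsilon>" using that(2)[OF True] k(2) by (intro mult_left_mono) auto
          moreover have "2 * C * q^N \<ge> 0" using C0 that(3) by simp
          ultimately show ?thesis using k(2)[of u] by (simp add: mult_ac)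
        next
          case False
          have "norm (F u - F 0) \<le> norm (F u) + norm (F 0)" by (rule norm_triangle_ineq4)
          also have "\<dots> \<le> 2 * C" using F(2)[OF \<open>u \<in> D\<close>] F(2)[of 0] D(4,5) by (simp add: subset_iff)
          finally have "\<kappa> u^N * norm (F u - F 0) \<le> q^N * (2 * C)"
            using that(4)[OF \<open>u \<in> D\<close>] False k(2) C0 that(3) by (intro mult_mono power_mono) auto
          moreover have "\<epsilon> * \<kappa> u^N \<ge> 0" using that(5) k(2) by simp
          ultimately show ?thesis using k(2)[of u] by (simp add: mult_ac)
        qed
        then show ?thesis using True by (simp add: scaleR_diff_right)
      qed auto
    qed
    also have "\<dots> = \<epsilon> * J N + 2 * C * q^N * measure lborel D"
      unfolding J_def using intD[of "2 * C * q^N"] iJ fin by (subst Bochner_Integration.integral_add) (auto simp: mult_ac)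
    finally show ?thesis .
  qed
  have "(\<lambda>N. A N / complex_of_real (J N)) \<longlonglongrightarrow> F 0"
  proof (rule LIMSEQ_I)
    fix r :: real assume "r > 0"
    define \<epsilon> where "\<epsilon> = r / 2"
    have e: "\<epsilon> > 0" using \<open>r > 0\<close> by (simp add: \<epsilon>_def)
    obtain \<delta> where d: "\<delta> > 0" "\<And>u. norm u < \<delta> \<Longrightarrow> norm (F u - F 0) < \<epsilon>"
      using F(3) e unfolding continuous_at_eps_delta by (metis dist_norm diff_zero)
    obtain q where q: "q \<ge> 0" "q < 1" "\<And>u. u \<in> D \<Longrightarrow> norm u \<ge> \<delta> \<Longrightarrow> \<kappa> u \<le> q"
    proof (cases "Dc - ball 0 \<delta> = {}")
      case True
      then show ?thesis using that[of 0] D(2) by (force simp: not_less)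
    next
      case False
      have "compact (Dc - ball 0 \<delta>)" using D(3) by (intro compact_diff) auto
      then obtain u0 where u0: "u0 \<in> Dc - ball 0 \<delta>" "\<And>u. u \<in> Dc - ball 0 \<delta> \<Longrightarrow> \<kappa> u \<le> \<kappa> u0"
        using continuous_attains_sup[OF _ False continuous_on_subset[OF k(1)]] by blast
      then have "\<kappa> u0 < 1" using k(5)[of u0] d(1) by (cases "u0 = 0") auto
      moreover have "\<kappa> u \<le> \<kappa> u0" if "u \<in> D" "norm u \<ge> \<delta>" for u
        by (rule u0(2)) (use that D(2) in auto)
      ultimately show ?thesis using that[of "\<kappa> u0"] k(2) by blast
    qed
    \<comment> \<open>Any number strictly between \<open>q\<close> and 1 would do; the midpoint is
      taken.\<close>
    define q' where "q' = (1 + q) / 2"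
    have q': "q < q'" "q' < 1" "q' > 0" using q by (auto simp: q'_def)
    obtain e where e': "e > 0" "ball 0 e \<subseteq> D" "\<forall>u\<in>ball 0 e. q' \<le> \<kappa> u" using nbhd[of q'] q' by auto
    define V where "V = measure lborel (ball (0::'a) e)"
    have V: "V > 0" using ballpos e' by (simp add: V_def)
    have "(\<lambda>N. 2 * C * measure lborel D / V * (q/q')^N) \<longlonglongrightarrow> 2 * C * measure lborel D / V * 0"
      using q q' by (intro tendsto_intros LIMSEQ_power_zero) auto
    then have "\<forall>\<^sub>F N in sequentially. 2 * C * measure lborel D / V * (q/q')^N < \<epsilon>"
      by (rule order_tendstoD(2)) (use e in simp)
    then obtain N0 where N0: "\<And>N. N \<ge> N0 \<Longrightarrow> 2 * C * measure lborel D / V * (q/q')^N < \<epsilon>"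
      unfolding eventually_sequentially by blast
    show "\<exists>N0. \<forall>N\<ge>N0. norm (A N / complex_of_real (J N) - F 0) < r"
    proof (intro exI allI impI)
      fix N assume "N \<ge> N0"
      have J: "J N \<ge> q'^N * V" unfolding V_def by (rule lower) (use e' q' in auto)
      have "A N / complex_of_real (J N) - F 0 = (A N - J N *\<^sub>R F 0) / complex_of_real (J N)"
        using Jpos[of N] by (simp add: field_simps scaleR_conv_of_real)
      then have "norm (A N / complex_of_real (J N) - F 0) = norm (A N - J N *\<^sub>R F 0) / J N"
        using Jpos[of N] by (simp add: norm_divide)
      also have "\<dots> \<le> (\<epsilon> * J N + 2 * C * q^N * measure lborel D) / J N"
        using AJ[of \<delta> \<epsilon> q N] d q e Jpos[of N] by (intro divide_right_mono) (auto intro: less_imp_le)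
      also have "\<dots> = \<epsilon> + 2 * C * q^N * measure lborel D / J N" using Jpos[of N] by (simp add: field_simps)
      also have "2 * C * q^N * measure lborel D / J N \<le> 2 * C * q^N * measure lborel D / (q'^N * V)"
        using J q' V q C0 by (intro divide_left_mono) (auto intro!: mult_pos_pos Jpos)
      also have "\<dots> = 2 * C * measure lborel D / V * (q/q')^N" by (simp add: power_divide field_simps)
      also have "\<dots> < \<epsilon>" using N0 \<open>N \<ge> N0\<close> by blast
      finally show "norm (A N / complex_of_real (J N) - F 0) < r" by (simp add: \<epsilon>_def)
    qed
  qed
  then show "(\<lambda>N. (\<integral>u. indicator D u *\<^sub>R (\<kappa> u^N *\<^sub>R F u) \<partial>lborel) / complex_of_real (\<integral>u. indicator D u *\<^sub>R \<kappa> u^N \<partial>lborel)) \<longlonglongrightarrow> F 0"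
    by (simp add: A_def J_def)
qed

section \<open>Fourier coefficients of even powers of the cosine\<close>

text \<open>The Fourier coefficient of \<open>cos^(2N)\<close> at frequency \<open>k\<close>,
  divided by the one at frequency 0. The shift by \<open>N\<close> puts the central binomial at
  \<open>k = 0\<close>. Being between 0 and 1 and tending to 1, these ratios act as summation
  weights under dominated convergence.\<close>

definition binom_ratio :: "nat \<Rightarrow> int \<Rightarrow> real" where
  "binom_ratio N k = (if \<bar>k\<bar> \<le> int N then real ((2*N) choose nat (int N + k)) / real ((2*N) choose N) else 0)"

lemma binom_ratio_bounds: "0 \<le> binom_ratio N k" "binom_ratio N k \<le> 1"
proof -
  have "(2*N) choose nat (int N + k) \<le> (2*N) choose N"
    using binomial_maximum'[of N] by simp
  then show "0 \<le> binom_ratio N k" "binom_ratio N k \<le> 1" by (auto simp: binom_ratio_def divide_le_eq_1)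
qed

lemma binom_ratio_uminus: "binom_ratio N (-k) = binom_ratio N k"
proof (cases "\<bar>k\<bar> \<le> int N")
  case True
  then have "2*N - nat (int N + k) = nat (int N - k)" "nat (int N + k) \<le> 2*N" by auto
  then show ?thesis using binomial_symmetric[of "nat (int N + k)" "2*N"] by (simp add: binom_ratio_def)
qed (simp add: binom_ratio_def)

text \<open>Passing from \<open>j\<close> to \<open>j + 1\<close> multiplies the ratio by
  \<open>(N - j) / (N + j + 1)\<close>, which tends to 1.\<close>

lemma binom_ratio_tendsto_nat: "(\<lambda>N. binom_ratio N (int j)) \<longlonglongrightarrow> 1"
proof (induction j)
  case 0
  have "binom_ratio N 0 = 1" for N by (simp add: binom_ratio_def)
  then show ?case by simp
next
  case (Suc j)
  have rec: "binom_ratio N (int (Suc j)) = binom_ratio N (int j) * ((real N - real j) / (real N + real j + 1))" if "N \<ge> Suc j" for N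
  proof -
    have "nat (int N + int (Suc j)) = Suc (N + j)" "nat (int N + int j) = N + j" by auto
    moreover have "real (Suc (N+j)) * real ((2*N) choose Suc (N+j)) = real (2*N - (N+j)) * real ((2*N) choose (N+j))"
      using binomial_absorb_comp[of "2*N" "N+j"] binomial_absorption[of "N+j" "2*N"] by (metis of_nat_mult)
    moreover have "real (2*N - (N+j)) = real N - real j" using that by (simp add: of_nat_diff)
    ultimately have "real ((2*N) choose Suc (N+j)) = real ((2*N) choose (N+j)) * ((real N - real j) / (real N + real j + 1))"
      by (simp add: nonzero_eq_divide_eq mult_ac add_ac)
    then show ?thesis using that \<open>nat (int N + int (Suc j)) = Suc (N + j)\<close> \<open>nat (int N + int j) = N + j\<close>
      by (simp only: binom_ratio_def) simp
  qed
  have "(\<lambda>N. binom_ratio N (int j) * ((real N - real j) / (real N + real j + 1))) \<longlonglongrightarrow> 1 * 1"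
    by (intro tendsto_mult Suc.IH) real_asymp
  moreover have "\<forall>\<^sub>F N in sequentially. binom_ratio N (int (Suc j)) = binom_ratio N (int j) * ((real N - real j) / (real N + real j + 1))"
    unfolding eventually_sequentially using rec by blast
  ultimately show ?case by (simp add: tendsto_cong)
qed

lemma binom_ratio_tendsto: "(\<lambda>N. binom_ratio N k) \<longlonglongrightarrow> 1"
  using binom_ratio_tendsto_nat[of "nat k"] binom_ratio_tendsto_nat[of "nat (-k)"] binom_ratio_uminus[of _ k] by (cases "k \<ge> 0") auto

lemma cos_power_eq_binom_ratio:
  "complex_of_real (cos x ^ (2*N)) =
    (\<Sum>k\<in>{-int N..int N}. complex_of_real (real ((2*N) choose N) / 4^N * binom_ratio N k) * exp (2 * \<i> * of_int k * x))"
proof -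
  have "complex_of_real (cos x ^ (2*N)) = ((exp (\<i> * x) + exp (- (\<i> * x))) / 2)^(2*N)"
    by (simp add: cos_of_real[symmetric] cos_exp_eq)
  also have "\<dots> = (\<Sum>j\<le>2*N. of_nat ((2*N) choose j) * exp (\<i> * x)^j * exp (- (\<i> * x))^(2*N-j)) / 4^N"
    unfolding power_divide binomial_ring[of _ _ "2*N"] by (simp add: power_mult)
  also have "(\<Sum>j\<le>2*N. of_nat ((2*N) choose j) * exp (\<i> * x)^j * exp (- (\<i> * x))^(2*N-j)) =
      (\<Sum>k\<in>{-int N..int N}. complex_of_real (real ((2*N) choose N) * binom_ratio N k) * exp (2 * \<i> * of_int k * x))"
  proof (rule sum.reindex_bij_witness[where i = "\<lambda>k. nat (int N + k)" and j = "\<lambda>j. int j - int N"])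
    fix j assume j: "j \<in> {..2*N}"
    have "exp (\<i> * x)^j * exp (- (\<i> * x))^(2*N-j) = exp (of_nat j * (\<i> * x) + of_nat (2*N-j) * (- (\<i> * x)))"
      by (simp only: exp_add exp_of_nat_mult)
    also have "of_nat j * (\<i> * x) + of_nat (2*N-j) * (- (\<i> * x)) = 2 * \<i> * of_int (int j - int N) * x"
      using j by (simp add: of_nat_diff algebra_simps)
    finally show "complex_of_real (real ((2*N) choose N) * binom_ratio N (int j - int N)) * exp (2 * \<i> * of_int (int j - int N) * x) =
      of_nat ((2*N) choose j) * exp (\<i> * x)^j * exp (- (\<i> * x))^(2*N-j)"
      using j by (simp add: binom_ratio_def mult.assoc)
  qed auto
  finally show ?thesis by (simp add: sum_divide_distrib)
qed

lemma summable_exp_int_square: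
  fixes c :: real
  assumes "c > 0"
  shows "Infinite_Set_Sum.abs_summable_on (\<lambda>k::int. exp (- c * (of_int k)^2)) UNIV"
proof -
  have nat: "Infinite_Set_Sum.abs_summable_on (\<lambda>n::nat. exp (- c * (real n)^2)) UNIV"
  proof (rule abs_summable_on_comparison_test)
    have "summable (\<lambda>n. norm (exp (-c)^n))" using assms by (simp add: summable_geometric)
    then show "Infinite_Set_Sum.abs_summable_on (\<lambda>n. exp (-c)^n) UNIV" by (simp add: abs_summable_on_nat_iff')
    fix n :: nat
    have "real n \<le> (real n)^2" by (cases n) (auto simp: power2_eq_square)
    then show "norm (exp (- c * (real n)^2)) \<le> norm (exp (-c)^n)"
      using assms by (simp add: exp_of_nat_mult[symmetric] mult.commute)
  qed
  have "Infinite_Set_Sum.abs_summable_on (\<lambda>k::int. exp (- c * (of_int k)^2)) (int ` UNIV)"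
    using nat by (subst abs_summable_on_reindex_iff[symmetric]) auto
  moreover have "Infinite_Set_Sum.abs_summable_on (\<lambda>k::int. exp (- c * (of_int k)^2)) ((\<lambda>n. - int n) ` UNIV)"
    using nat by (subst abs_summable_on_reindex_iff[symmetric]) (auto simp: inj_def)
  moreover have "UNIV = int ` UNIV \<union> (\<lambda>n. - int n) ` UNIV"
  proof (intro set_eqI iffI)
    fix k :: int
    have "k = int (nat k) \<or> k = - int (nat (-k))" by auto
    then show "k \<in> int ` UNIV \<union> (\<lambda>n. - int n) ` UNIV" by blast
  qed auto
  ultimately show ?thesis by (metis abs_summable_on_union)
qed

section \<open>Poisson summation\<close>

text \<open>Takes the place of the Schwartz class: lattice sums of such functions converge locally
  uniformly, multiplication by a bounded continuous kernel stays in the class, and a polynomial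
  times a Gaussian belongs to it.\<close>

definition gauss_bounded :: "(real ^ 'n::finite \<Rightarrow> complex) \<Rightarrow> bool" where
  "gauss_bounded g \<longleftrightarrow> continuous_on UNIV g \<and> (\<exists>C \<epsilon>. \<epsilon> > 0 \<and> (\<forall>u. norm (g u) \<le> C * exp (- \<epsilon> * norm u^2)))"

section \<open>A lattice, its dual and the periodic kernel\<close>

locale dual_bases =
  fixes B Bd :: "'n::finite \<Rightarrow> real ^ 'n"
  assumes biorth: "\<And>i j. Bd i \<bullet> B j = (if i = j then 1 else 0)"
    and expand: "\<And>u. (\<Sum>i\<in>UNIV. (Bd i \<bullet> u) *\<^sub>R B i) = u"
begin

definition lat :: "('n \<Rightarrow> int) \<Rightarrow> real ^ 'n" where
  "lat m = (\<Sum>i\<in>UNIV. of_int (m i) *\<^sub>R B i)"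

definition dlat :: "('n \<Rightarrow> int) \<Rightarrow> real ^ 'n" where
  "dlat k = (\<Sum>i\<in>UNIV. of_int (k i) *\<^sub>R Bd i)"

text \<open>Half-open, so that the lattice translates tile the space exactly; centred, so that the
  peak of the kernel at 0 is an interior point.\<close>

definition cell :: "(real ^ 'n) set" where
  "cell = {u. \<forall>i. - 1/2 \<le> Bd i \<bullet> u \<and> Bd i \<bullet> u < 1/2}"

text \<open>The square removes the sign that \<open>cos (pi * x)\<close> picks up under
  \<open>x \<mapsto> x + 1\<close> and so makes the product periodic under the lattice.\<close>

definition ker :: "real ^ 'n \<Rightarrow> real" where
  "ker u = (\<Prod>i\<in>UNIV. cos (pi * (Bd i \<bullet> u))^2)"

lemma Bd_lat: "Bd i \<bullet> lat m = of_int (m i)"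
  by (simp add: lat_def inner_sum_right biorth sum.delta' if_distrib[of "\<lambda>x. _ * x"] cong: if_cong)

lemma B_dlat: "B i \<bullet> dlat m = of_int (m i)"
  by (simp add: dlat_def inner_sum_right biorth inner_commute[of "B _"] sum.delta if_distrib[of "\<lambda>x. _ * x"] cong: if_cong)

lemma expand_dual: "(\<Sum>i\<in>UNIV. (B i \<bullet> u) *\<^sub>R Bd i) = u"
proof -
  have "v \<bullet> (\<Sum>i\<in>UNIV. (B i \<bullet> u) *\<^sub>R Bd i) = v \<bullet> u" for v
  proof -
    have "v \<bullet> u = (\<Sum>i\<in>UNIV. (Bd i \<bullet> v) *\<^sub>R B i) \<bullet> u" by (simp only: expand)
    also have "\<dots> = v \<bullet> (\<Sum>i\<in>UNIV. (B i \<bullet> u) *\<^sub>R Bd i)"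
      by (simp add: inner_sum_right inner_sum_left inner_commute mult.commute)
    finally show ?thesis by simp
  qed
  then show ?thesis using vector_eq_ldot by blast
qed

text \<open>The coordinates of a lattice vector are its inner products with the dual basis, so
  Cauchy-Schwarz bounds them by its norm. The summand 1 in \<open>s\<close> only ensures
  positivity.\<close>

lemma lat_norm_bound:
  obtains c where "c > 0" "\<And>m. c * (\<Sum>i\<in>UNIV. (of_int (m i))^2) \<le> norm (lat m)^2"
proof -
  define s where "s = 1 + (\<Sum>i\<in>UNIV. norm (Bd i)^2)"
  have s: "s > 0" unfolding s_def by (intro add_pos_nonneg sum_nonneg) auto
  have "(1/s) * (\<Sum>i\<in>UNIV. (of_int (m i))^2) \<le> norm (lat m)^2" for m
  proof -
    have "(\<Sum>i\<in>UNIV. (of_int (m i))^2) \<le> (\<Sum>i\<in>UNIV. norm (Bd i)^2 * norm (lat m)^2)"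
    proof (rule sum_mono)
      fix i
      have "\<bar>Bd i \<bullet> lat m\<bar>^2 \<le> (norm (Bd i) * norm (lat m))^2"
        by (intro power_mono Cauchy_Schwarz_ineq2) auto
      then show "(of_int (m i))^2 \<le> norm (Bd i)^2 * norm (lat m)^2"
        by (simp add: Bd_lat power_mult_distrib)
    qed
    also have "\<dots> \<le> s * norm (lat m)^2" by (simp add: s_def sum_distrib_right[symmetric] distrib_right)
    finally show ?thesis using s by (simp add: field_simps)
  qed
  then show thesis using that[of "1/s"] s by auto
qed

lemma summable_gauss_lat:
  assumes "\<epsilon> > 0"
  shows "integrable (count_space UNIV) (\<lambda>m. exp (- \<epsilon> * norm (lat m)^2))"
proof -
  obtain c where c: "c > 0" "\<And>m. c * (\<Sum>i\<in>UNIV. (of_int (m i))^2) \<le> norm (lat m)^2"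
    using lat_norm_bound by blast
  have "Infinite_Set_Sum.abs_summable_on (\<lambda>m. \<Prod>i\<in>(UNIV::'n set). exp (- (\<epsilon> * c) * (of_int (m i))^2)) (PiE UNIV (\<lambda>_. (UNIV :: int set)))"
    by (rule abs_summable_on_prod_PiE) (use summable_exp_int_square assms c in auto)
  then have i: "integrable (count_space UNIV) (\<lambda>m::'n \<Rightarrow> int. \<Prod>i\<in>UNIV. exp (- (\<epsilon> * c) * (of_int (m i))^2))"
    by (simp add: abs_summable_on_def)
  show ?thesis
  proof (rule Bochner_Integration.integrable_bound[OF i])
    show "AE m in count_space UNIV. norm (exp (- \<epsilon> * norm (lat m)^2)) \<le> norm (\<Prod>i\<in>UNIV. exp (- (\<epsilon> * c) * (of_int (m i))^2))"
    proof (rule AE_I2)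
      fix m :: "'n \<Rightarrow> int"
      have "(\<Prod>i\<in>UNIV. exp (- (\<epsilon> * c) * (of_int (m i))^2)) = exp (- (\<epsilon> * (c * (\<Sum>i\<in>UNIV. (of_int (m i))^2))))"
        by (simp add: exp_sum[symmetric] sum_distrib_left sum_negf mult.assoc)
      moreover have "\<epsilon> * (c * (\<Sum>i\<in>UNIV. (of_int (m i))^2)) \<le> \<epsilon> * norm (lat m)^2"
        using c(2) assms by (intro mult_left_mono) auto
      ultimately show "norm (exp (- \<epsilon> * norm (lat m)^2)) \<le> norm (\<Prod>i\<in>UNIV. exp (- (\<epsilon> * c) * (of_int (m i))^2))" by simp
    qed
  qed auto
qed

lemma cell_borel [measurable]: "cell \<in> sets borel"
  unfolding cell_def by measurable

lemma cell_in_compact: "\<exists>R. cell \<subseteq> cball 0 R \<inter> {u. \<forall>i. \<bar>Bd i \<bullet> u\<bar> \<le> 1/2}"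
proof -
  have "norm u \<le> (\<Sum>i\<in>UNIV. norm (B i))" if "u \<in> cell" for u
  proof -
    have "norm u = norm (\<Sum>i\<in>UNIV. (Bd i \<bullet> u) *\<^sub>R B i)" by (simp only: expand)
    also have "\<dots> \<le> (\<Sum>i\<in>UNIV. \<bar>Bd i \<bullet> u\<bar> * norm (B i))" by (rule order_trans[OF norm_sum]) simp
    also have "\<dots> \<le> (\<Sum>i\<in>UNIV. 1 * norm (B i))"
    proof (intro sum_mono mult_right_mono)
      fix i
      have "- 1/2 \<le> Bd i \<bullet> u" "Bd i \<bullet> u < 1/2" using that by (auto simp: cell_def)
      then show "\<bar>Bd i \<bullet> u\<bar> \<le> 1" by linarith
    qed auto
    finally show ?thesis by simp
  qed
  moreover have "\<bar>Bd i \<bullet> u\<bar> \<le> 1/2" if "u \<in> cell" for u i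
  proof -
    have "- 1/2 \<le> Bd i \<bullet> u" "Bd i \<bullet> u < 1/2" using that by (auto simp: cell_def)
    then show ?thesis by linarith
  qed
  ultimately show ?thesis by (intro exI[of _ "\<Sum>i\<in>UNIV. norm (B i)"]) auto
qed

lemma cell_translate: "u - lat m \<in> cell \<longleftrightarrow> m = (\<lambda>i. \<lfloor>Bd i \<bullet> u + 1/2\<rfloor>)"
proof
  assume a: "u - lat m \<in> cell"
  show "m = (\<lambda>i. \<lfloor>Bd i \<bullet> u + 1/2\<rfloor>)"
  proof
    fix i
    have "- 1/2 \<le> Bd i \<bullet> u - of_int (m i)" "Bd i \<bullet> u - of_int (m i) < 1/2"
      using a by (auto simp: cell_def inner_diff_right Bd_lat)
    then have "of_int (m i) \<le> Bd i \<bullet> u + 1/2" "Bd i \<bullet> u + 1/2 < of_int (m i) + 1" by linarith+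
    then show "m i = \<lfloor>Bd i \<bullet> u + 1/2\<rfloor>" by (rule floor_unique[symmetric])
  qed
next
  assume m: "m = (\<lambda>i. \<lfloor>Bd i \<bullet> u + 1/2\<rfloor>)"
  show "u - lat m \<in> cell"
    unfolding cell_def mem_Collect_eq inner_diff_right Bd_lat
  proof
    fix i show "- 1/2 \<le> Bd i \<bullet> u - of_int (m i) \<and> Bd i \<bullet> u - of_int (m i) < 1/2"
      using floor_correct[of "Bd i \<bullet> u + 1/2"] unfolding m by linarith
  qed
qed

lemma ker_lat: "ker (u + lat m) = ker u"
proof -
  have "cos (pi * (Bd i \<bullet> (u + lat m)))^2 = cos (pi * (Bd i \<bullet> u))^2" for i
  proof -
    have "cos (pi * (Bd i \<bullet> (u + lat m))) = cos (pi * (Bd i \<bullet> u)) * cos (pi * of_int (m i))"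
      by (simp add: inner_add_right Bd_lat distrib_left cos_add sin_times_pi_eq_0 mult.commute[of pi])
    moreover have "cos (pi * of_int (m i))^2 = 1"
      using cos_int_times_real[of "m i" pi] by (cases "even (m i)") (auto simp: cos_npi_int mult.commute)
    ultimately show ?thesis by (simp add: power_mult_distrib)
  qed
  then show ?thesis by (simp add: ker_def)
qed

lemma ker_bounds: "0 \<le> ker u" "ker u \<le> 1" "ker 0 = 1"
  by (auto simp: ker_def intro!: prod_nonneg prod_le_1 simp: abs_square_le_1)

lemma ker_less_1:
  assumes "\<And>i. \<bar>Bd i \<bullet> u\<bar> \<le> 1/2" "u \<noteq> 0"
  shows "ker u < 1"
proof -
  obtain j where j: "Bd j \<bullet> u \<noteq> 0"
  proof (rule ccontr)
    assume "\<not> thesis"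
    then have "\<And>i. Bd i \<bullet> u = 0" using that by blast
    then have "u = 0" using expand[of u] by simp
    then show False using assms by simp
  qed
  have "\<bar>cos (pi * (Bd j \<bullet> u))\<bar> < 1"
  proof -
    have "cos (pi * \<bar>Bd j \<bullet> u\<bar>) < cos 0"
      by (rule cos_monotone_0_pi) (use j assms(1)[of j] pi_gt_zero in \<open>auto simp: mult_le_cancel_left2\<close>)
    moreover have "cos (pi * \<bar>Bd j \<bullet> u\<bar>) \<ge> 0"
      by (rule cos_ge_zero) (use assms(1)[of j] pi_gt_zero in \<open>auto simp: field_simps intro: order_trans[of _ 0]\<close>)
    moreover have "cos (pi * \<bar>Bd j \<bullet> u\<bar>) = cos (pi * (Bd j \<bullet> u))" by (simp add: abs_if)
    ultimately show ?thesis by simp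
  qed
  then have lt: "cos (pi * (Bd j \<bullet> u))^2 < 1" by (simp add: abs_square_less_1)
  have "ker u = cos (pi * (Bd j \<bullet> u))^2 * (\<Prod>i\<in>UNIV-{j}. cos (pi * (Bd i \<bullet> u))^2)"
    unfolding ker_def by (rule prod.remove) auto
  also have "\<dots> \<le> cos (pi * (Bd j \<bullet> u))^2 * 1"
    by (intro mult_left_mono prod_le_1) (auto simp: abs_square_le_1)
  finally show ?thesis using lt by simp
qed

lemma continuous_ker: "continuous_on UNIV ker"
  unfolding ker_def by (intro continuous_intros)

text \<open>Multiplying out one cosine expansion per coordinate yields characters indexed by the
  dual lattice. The factor in front is the constant Fourier coefficient, that is, the coefficient at
  \<open>k = 0\<close>.\<close>

lemma ker_power_eq:
  "complex_of_real (ker u ^ N) = complex_of_real ((real ((2*N) choose N) / 4^N)^CARD('n)) *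
     (\<Sum>k\<in>PiE UNIV (\<lambda>_. {-int N..int N}). complex_of_real (\<Prod>i\<in>UNIV. binom_ratio N (k i)) * exp (2 * pi * \<i> * (dlat k \<bullet> u)))"
proof -
  let ?W = "real ((2*N) choose N) / 4^N"
  have "complex_of_real (ker u ^ N) = (\<Prod>i\<in>UNIV. complex_of_real (cos (pi * (Bd i \<bullet> u))^(2*N)))"
    by (simp add: ker_def prod_power_distrib[symmetric] power_mult)
  also have "\<dots> = (\<Prod>i\<in>UNIV. \<Sum>k\<in>{-int N..int N}. complex_of_real (?W * binom_ratio N k) * exp (2 * \<i> * of_int k * (pi * (Bd i \<bullet> u))))"
    by (simp only: cos_power_eq_binom_ratio of_real_mult)
  also have "\<dots> = (\<Sum>k\<in>PiE UNIV (\<lambda>_. {-int N..int N}). \<Prod>i\<in>UNIV. complex_of_real (?W * binom_ratio N (k i)) * exp (2 * \<i> * of_int (k i) * (pi * (Bd i \<bullet> u))))"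
    by (subst prod_sum_PiE) auto
  also have "\<dots> = (\<Sum>k\<in>PiE UNIV (\<lambda>_. {-int N..int N}). complex_of_real (?W^CARD('n)) * (complex_of_real (\<Prod>i\<in>UNIV. binom_ratio N (k i)) * exp (2 * pi * \<i> * (dlat k \<bullet> u))))"
  proof (rule sum.cong[OF refl])
    fix k :: "'n \<Rightarrow> int"
    have "(\<Prod>i\<in>UNIV. exp (2 * \<i> * of_int (k i) * (pi * (Bd i \<bullet> u)))) = exp (\<Sum>i\<in>UNIV. 2 * \<i> * of_int (k i) * (pi * (Bd i \<bullet> u)))"
      by (simp add: exp_sum)
    also have "(\<Sum>i\<in>UNIV. 2 * \<i> * of_int (k i) * (pi * (Bd i \<bullet> u))) = 2 * pi * \<i> * (dlat k \<bullet> u)"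
      by (simp add: dlat_def inner_sum_left sum_distrib_left mult_ac)
    finally have e: "(\<Prod>i\<in>UNIV. exp (2 * \<i> * of_int (k i) * (pi * (Bd i \<bullet> u)))) = exp (2 * pi * \<i> * (dlat k \<bullet> u))" .
    have w: "(\<Prod>i\<in>UNIV. complex_of_real (?W * binom_ratio N (k i))) = complex_of_real (?W^CARD('n)) * complex_of_real (\<Prod>i\<in>UNIV. binom_ratio N (k i))"
      unfolding of_real_mult prod.distrib by (simp add: power_divide)
    show "(\<Prod>i\<in>UNIV. complex_of_real (?W * binom_ratio N (k i)) * exp (2 * \<i> * of_int (k i) * (pi * (Bd i \<bullet> u)))) =
      complex_of_real (?W^CARD('n)) * (complex_of_real (\<Prod>i\<in>UNIV. binom_ratio N (k i)) * exp (2 * pi * \<i> * (dlat k \<bullet> u)))"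
      unfolding prod.distrib[of _ "\<lambda>i. exp (2 * \<i> * of_int (k i) * (pi * (Bd i \<bullet> u)))"] e w by (simp add: mult.assoc)
  qed
  finally show ?thesis by (simp only: sum_distrib_left)
qed

text \<open>A summable majorant, uniform on bounded sets, for all later uses of dominated
  convergence. It rests on \<open>norm l^2 <= 2 * norm (u + l)^2 + 2 * norm u^2\<close> and costs
  half of the exponent.\<close>

lemma gauss_bounded_translates:
  assumes "gauss_bounded g"
  shows "\<exists>C \<epsilon>. \<epsilon> > 0 \<and> C \<ge> 0 \<and> (\<forall>u m. norm u \<le> R \<longrightarrow> norm (g (u + lat m)) \<le> C * exp (- \<epsilon> * norm (lat m)^2))"
proof -
  obtain C \<epsilon> where e: "\<epsilon> > 0" and b: "\<And>u. norm (g u) \<le> C * exp (- \<epsilon> * norm u^2)"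
    using assms by (auto simp: gauss_bounded_def)
  have C: "C \<ge> 0" using order_trans[OF norm_ge_zero b[of 0]] by simp
  have "norm (g (u + lat m)) \<le> (C * exp (\<epsilon> * R^2)) * exp (- (\<epsilon>/2) * norm (lat m)^2)" if "norm u \<le> R" for u m
  proof -
    have "norm (lat m) \<le> norm (u + lat m) + norm u"
      using norm_triangle_ineq4[of "u + lat m" u] by simp
    then have "norm (lat m)^2 \<le> (norm (u + lat m) + norm u)^2" by (intro power_mono) auto
    also have "\<dots> \<le> 2 * norm (u + lat m)^2 + 2 * norm u^2"
      using zero_le_power2[of "norm (u + lat m) - norm u"] by (simp add: power2_eq_square algebra_simps)
    also have "norm u^2 \<le> R^2" using that by (intro power_mono) auto
    finally have "\<epsilon> * norm (lat m)^2 \<le> \<epsilon> * (2 * norm (u + lat m)^2 + 2 * R^2)" using e by (intro mult_left_mono) auto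
    then have "- \<epsilon> * norm (u + lat m)^2 \<le> \<epsilon> * R^2 + - (\<epsilon>/2) * norm (lat m)^2" by (simp add: algebra_simps)
    then have "C * exp (- \<epsilon> * norm (u + lat m)^2) \<le> C * exp (\<epsilon> * R^2 + - (\<epsilon>/2) * norm (lat m)^2)"
      using C by (intro mult_left_mono) auto
    then show ?thesis using order_trans[OF b[of "u + lat m"]] by (simp only: exp_add mult.assoc)
  qed
  then show ?thesis using e C by (intro exI[of _ "C * exp (\<epsilon> * R^2)"] exI[of _ "\<epsilon>/2"]) auto
qed

lemma integrable_gauss_lat: "\<epsilon> > 0 \<Longrightarrow> integrable (count_space UNIV) (\<lambda>m. C * exp (- \<epsilon> * norm (lat m)^2))" for C :: real
  by (intro integrable_mult_right summable_gauss_lat)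

lemma gauss_bounded_summable:
  assumes "gauss_bounded g"
  shows "integrable (count_space UNIV) (\<lambda>m. g (u + lat m))"
proof -
  obtain C \<epsilon> where e: "\<epsilon> > 0" "C \<ge> 0" "\<And>u' m. norm u' \<le> norm u \<Longrightarrow> norm (g (u' + lat m)) \<le> C * exp (- \<epsilon> * norm (lat m)^2)"
    using gauss_bounded_translates[OF assms, of "norm u"] by blast
  show ?thesis
    by (rule Bochner_Integration.integrable_bound[OF integrable_gauss_lat[OF e(1), of C]]) (use e in auto)
qed

section \<open>Periodization and unfolding\<close>

definition periodize :: "(real ^ 'n \<Rightarrow> complex) \<Rightarrow> real ^ 'n \<Rightarrow> complex" where
  "periodize g u = (\<integral>m. g (u + lat m) \<partial>count_space UNIV)"

lemma periodize_bounded: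
  assumes "gauss_bounded g"
  shows "\<exists>C. \<forall>u. norm u \<le> R \<longrightarrow> norm (periodize g u) \<le> C"
proof -
  obtain C \<epsilon> where e: "\<epsilon> > 0" "C \<ge> 0" "\<And>u m. norm u \<le> R \<Longrightarrow> norm (g (u + lat m)) \<le> C * exp (- \<epsilon> * norm (lat m)^2)"
    using gauss_bounded_translates[OF assms, of R] by blast
  have "norm (periodize g u) \<le> (\<integral>m. C * exp (- \<epsilon> * norm (lat m)^2) \<partial>count_space UNIV)" if "norm u \<le> R" for u
  proof -
    have "norm (periodize g u) \<le> (\<integral>m. norm (g (u + lat m)) \<partial>count_space UNIV)"
      unfolding periodize_def by (rule integral_norm_bound)
    also have "\<dots> \<le> (\<integral>m. C * exp (- \<epsilon> * norm (lat m)^2) \<partial>count_space UNIV)"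
      by (rule integral_mono[OF integrable_norm[OF gauss_bounded_summable[OF assms]] integrable_gauss_lat[OF e(1)]]) (use e that in auto)
    finally show ?thesis .
  qed
  then show ?thesis by blast
qed

lemma periodize_continuous:
  assumes "gauss_bounded g"
  shows "continuous_on UNIV (periodize g)"
proof -
  have "continuous_on (ball 0 R) (periodize g)" for R
    unfolding continuous_on_sequentially comp_def
  proof (intro allI ballI impI, elim conjE)
    fix x :: "nat \<Rightarrow> real ^ 'n" and a
    assume a: "a \<in> ball 0 R" "\<forall>n. x n \<in> ball 0 R" "x \<longlonglongrightarrow> a"
    obtain C \<epsilon> where e: "\<epsilon> > 0" "C \<ge> 0" "\<And>u m. norm u \<le> R \<Longrightarrow> norm (g (u + lat m)) \<le> C * exp (- \<epsilon> * norm (lat m)^2)"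
      using gauss_bounded_translates[OF assms, of R] by blast
    have cont: "isCont g u" for u using assms by (simp add: gauss_bounded_def continuous_on_eq_continuous_at)
    show "(\<lambda>n. periodize g (x n)) \<longlonglongrightarrow> periodize g a"
      unfolding periodize_def
    proof (rule integral_dominated_convergence[OF _ _ integrable_gauss_lat[OF e(1), of C]])
      show "AE m in count_space UNIV. (\<lambda>n. g (x n + lat m)) \<longlonglongrightarrow> g (a + lat m)"
        by (intro AE_I2 isCont_tendsto_compose[OF cont] tendsto_intros a(3))
      show "AE m in count_space UNIV. norm (g (x n + lat m)) \<le> C * exp (- \<epsilon> * norm (lat m)^2)" for n
        using a(2) by (intro AE_I2 e(3)) (auto intro: less_imp_le)
    qed auto
  qed
  then have "isCont (periodize g) a" for a
    using continuous_on_eq_continuous_at[of "ball (0::real^'n) (norm a + 1)" "periodize g"] by auto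
  then show ?thesis by (simp add: continuous_on_eq_continuous_at)
qed

lemma cell_finite: "emeasure lborel cell < \<infinity>"
proof -
  obtain R where "cell \<subseteq> cball 0 R" using cell_in_compact by auto
  then show ?thesis using emeasure_mono[of cell "cball 0 R" lborel] emeasure_lborel_cball_finite[of 0 R]
    by (auto intro: le_less_trans)
qed

lemma lborel_translate:
  fixes f :: "real ^ 'n \<Rightarrow> 'b::{banach, second_countable_topology}"
  assumes [measurable]: "f \<in> borel_measurable borel"
  shows "integrable lborel (\<lambda>u. f (c + u)) \<longleftrightarrow> integrable lborel f" "(\<integral>u. f (c + u) \<partial>lborel) = (\<integral>u. f u \<partial>lborel)"
proof -
  have "integrable (distr lborel borel ((+) c)) f \<longleftrightarrow> integrable lborel (\<lambda>u. f (c + u))"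
    by (rule integrable_distr_eq) auto
  then show "integrable lborel (\<lambda>u. f (c + u)) \<longleftrightarrow> integrable lborel f" by (simp add: lborel_distr_plus)
  have "integral\<^sup>L (distr lborel borel ((+) c)) f = (\<integral>u. f (c + u) \<partial>lborel)"
    by (rule integral_distr) auto
  then show "(\<integral>u. f (c + u) \<partial>lborel) = (\<integral>u. f u \<partial>lborel)" by (simp add: lborel_distr_plus)
qed

text \<open>\<open>h1 m\<close> is \<open>g\<close> restricted to the translate of the cell by
  \<open>lat m\<close>; by the tiling, exactly one \<open>m\<close> contributes at each point.
  \<open>h2 m\<close> is the same piece moved back to the cell, and Fubini exchanges sum and
  integral on both sides.\<close>

lemma unfolding_integral:
  assumes g: "gauss_bounded g"
  shows "(\<integral>u. g u \<partial>lborel) = (\<integral>u. indicator cell u *\<^sub>R periodize g u \<partial>lborel)"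
proof -
  have [measurable]: "g \<in> borel_measurable borel"
    using g by (intro borel_measurable_continuous_onI) (auto simp: gauss_bounded_def)
  obtain R where R: "cell \<subseteq> cball 0 R" using cell_in_compact by auto
  obtain C \<epsilon> where e: "\<epsilon> > 0" "C \<ge> 0" "\<And>u m. norm u \<le> R \<Longrightarrow> norm (g (u + lat m)) \<le> C * exp (- \<epsilon> * norm (lat m)^2)"
    using gauss_bounded_translates[OF assms, of R] by blast
  have sf: "sigma_finite_measure (count_space (UNIV :: ('n \<Rightarrow> int) set))"
    by (intro sigma_finite_measure_count_space_countable) auto
  interpret P: pair_sigma_finite "count_space (UNIV :: ('n \<Rightarrow> int) set)" "lborel :: (real ^ 'n) measure"
    using sf sigma_finite_lborel by (rule pair_sigma_finite.intro)
  define h1 where "h1 m u = indicator cell (- lat m + u) *\<^sub>R g u" for m u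
  define h2 where "h2 m u = indicator cell u *\<^sub>R g (u + lat m)" for m u
  have [measurable]: "h1 m \<in> borel_measurable borel" "h2 m \<in> borel_measurable borel" for m
    unfolding h1_def h2_def by measurable
  have h12: "h2 m = (\<lambda>u. h1 m (lat m + u))" for m by (auto simp: h1_def h2_def add.commute)
  have i2: "integrable lborel (h2 m)" for m
    unfolding h2_def by (rule integrable_indicator_bounded[OF cell_borel _ cell_finite, where c = "C * exp (- \<epsilon> * norm (lat m)^2)"])
      (use e R in auto)
  have i1: "integrable lborel (h1 m)" for m
    using i2[of m] unfolding h12 by (subst (asm) lborel_translate) auto
  have eq: "(\<integral>u. h1 m u \<partial>lborel) = (\<integral>u. h2 m u \<partial>lborel)" "(\<integral>u. norm (h1 m u) \<partial>lborel) = (\<integral>u. norm (h2 m u) \<partial>lborel)" for m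
    unfolding h12 by (subst lborel_translate[of _ "lat m"]; simp)+
  have n2: "integrable (count_space UNIV) (\<lambda>m. \<integral>u. norm (h2 m u) \<partial>lborel)"
  proof (rule Bochner_Integration.integrable_bound[OF integrable_gauss_lat[OF e(1), of "measure lborel cell * C"]])
    show "AE m in count_space UNIV. norm (\<integral>u. norm (h2 m u) \<partial>lborel) \<le> norm (measure lborel cell * C * exp (- \<epsilon> * norm (lat m)^2))"
    proof (rule AE_I2)
      fix m
      have "(\<integral>u. norm (h2 m u) \<partial>lborel) \<le> (\<integral>u. indicator cell u *\<^sub>R (C * exp (- \<epsilon> * norm (lat m)^2)) \<partial>lborel)"
      proof (rule integral_mono)
        show "integrable lborel (\<lambda>u. indicator cell u *\<^sub>R (C * exp (- \<epsilon> * norm (lat m)^2)))"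
          by (rule integrable_indicator_bounded[OF cell_borel _ cell_finite]) auto
        show "norm (h2 m u) \<le> indicator cell u *\<^sub>R (C * exp (- \<epsilon> * norm (lat m)^2))" for u
          using e(3)[of u m] R by (auto simp: h2_def split: split_indicator)
      qed (use i2 in auto)
      also have "\<dots> = measure lborel cell * C * exp (- \<epsilon> * norm (lat m)^2)" using cell_finite by simp
      finally show "norm (\<integral>u. norm (h2 m u) \<partial>lborel) \<le> norm (measure lborel cell * C * exp (- \<epsilon> * norm (lat m)^2))"
        using e(2) by simp
    qed
  qed auto
  have I2: "integrable (count_space UNIV \<Otimes>\<^sub>M lborel) (case_prod h2)"
    by (rule P.Fubini_integrable) (use n2 i2 in \<open>auto intro!: measurable_pair_measure_countable1\<close>)
  have I1: "integrable (count_space UNIV \<Otimes>\<^sub>M lborel) (case_prod h1)"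
    by (rule P.Fubini_integrable) (use n2 i1 in \<open>auto intro!: measurable_pair_measure_countable1 simp: eq\<close>)
  have "(\<integral>m. h1 m u \<partial>count_space UNIV) = g u" for u
  proof -
    define m0 where "m0 = (\<lambda>i. \<lfloor>Bd i \<bullet> u + 1/2\<rfloor>)"
    have "h1 m u = indicator {m0} m *\<^sub>R g u" for m
      using cell_translate[of u m] by (auto simp: h1_def m0_def split: split_indicator)
    then show ?thesis by simp
  qed
  then have "(\<integral>u. g u \<partial>lborel) = (\<integral>u. (\<integral>m. h1 m u \<partial>count_space UNIV) \<partial>lborel)" by simp
  also have "\<dots> = (\<integral>m. (\<integral>u. h1 m u \<partial>lborel) \<partial>count_space UNIV)" by (rule P.Fubini_integral[OF I1])
  also have "\<dots> = (\<integral>u. (\<integral>m. h2 m u \<partial>count_space UNIV) \<partial>lborel)" unfolding eq by (rule P.Fubini_integral[OF I2, symmetric])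
  also have "\<dots> = (\<integral>u. indicator cell u *\<^sub>R periodize g u \<partial>lborel)" by (simp add: h2_def periodize_def)
  finally show ?thesis .
qed

section \<open>Two evaluations of the kernel integral\<close>

definition cellmass :: "nat \<Rightarrow> real" where
  "cellmass N = (\<integral>u. indicator cell u *\<^sub>R ker u^N \<partial>lborel)"

lemma cell_contains_ball: "\<exists>e>0. ball 0 e \<subseteq> cell"
proof -
  define U where "U = (\<Inter>i. {u. Bd i \<bullet> u < 1/2} \<inter> {u. Bd i \<bullet> u > - 1/2})"
  have "open U" unfolding U_def by (intro open_INT ballI open_Int open_halfspace_lt open_halfspace_gt) simp
  moreover have "0 \<in> U" by (simp add: U_def)
  ultimately obtain e where "e > 0" "ball 0 e \<subseteq> U" using open_contains_ball by blast
  moreover have "U \<subseteq> cell" by (auto simp: U_def cell_def intro: less_imp_le)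
  ultimately show ?thesis by blast
qed

text \<open>The kernel is periodic, so it passes through the periodization; unfolding leaves an
  integral over one cell, which concentrates at 0.\<close>

lemma kernel_limit_lat:
  assumes g: "gauss_bounded g"
  shows "cellmass N > 0"
    and "(\<lambda>N. (\<integral>u. ker u^N *\<^sub>R g u \<partial>lborel) / complex_of_real (cellmass N)) \<longlonglongrightarrow> periodize g 0"
proof -
  obtain R where R: "cell \<subseteq> cball 0 R \<inter> {u. \<forall>i. \<bar>Bd i \<bullet> u\<bar> \<le> 1/2}" using cell_in_compact by blast
  define Dc where "Dc = cball 0 R \<inter> {u. \<forall>i. \<bar>Bd i \<bullet> u\<bar> \<le> 1/2}"
  have "closed {u. \<forall>i. \<bar>Bd i \<bullet> u\<bar> \<le> 1/2}"
    by (intro closed_Collect_all closed_Collect_le continuous_intros)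
  then have Dc: "compact Dc" unfolding Dc_def by (intro compact_Int_closed) auto
  obtain e where e0: "e > 0" "ball 0 e \<subseteq> cell" using cell_contains_ball by blast
  have cont: "continuous_on UNIV (periodize g)" by (rule periodize_continuous[OF g])
  obtain C where C: "\<And>u. norm u \<le> R \<Longrightarrow> norm (periodize g u) \<le> C" using periodize_bounded[OF g] by blast
  note pk = peak_kernel_limit[OF cell_borel _ Dc e0 borel_measurable_continuous_onI[OF cont], of C ker]
  have c1: "cell \<subseteq> Dc" using R by (simp add: Dc_def)
  have c2: "norm (periodize g u) \<le> C" if "u \<in> cell" for u using C R that by auto
  have c3: "isCont (periodize g) 0" using cont by (simp add: continuous_on_eq_continuous_at)
  have c4: "ker u < 1" if "u \<in> Dc" "u \<noteq> 0" for u using ker_less_1[of u] that by (simp add: Dc_def)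
  show "cellmass N > 0" unfolding cellmass_def
    by (rule pk(1)[OF c1 c2 c3 continuous_ker ker_bounds c4])
  have "(\<integral>u. ker u^N *\<^sub>R g u \<partial>lborel) = (\<integral>u. indicator cell u *\<^sub>R (ker u^N *\<^sub>R periodize g u) \<partial>lborel)" for N
  proof -
    have k: "\<bar>ker u ^ N\<bar> \<le> 1" for u using ker_bounds(1,2)[of u] by (simp add: power_le_one)
    have "gauss_bounded (\<lambda>u. ker u^N *\<^sub>R g u)"
    proof -
      obtain C \<epsilon> where e: "\<epsilon> > 0" and b: "\<And>u. norm (g u) \<le> C * exp (- \<epsilon> * norm u^2)"
        using g by (auto simp: gauss_bounded_def)
      have "norm (ker u^N *\<^sub>R g u) \<le> C * exp (- \<epsilon> * norm u^2)" for u
        using mult_right_mono[OF k[of u], of "norm (g u)"] b[of u] by simp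
      moreover have "continuous_on UNIV (\<lambda>u. ker u^N *\<^sub>R g u)"
        using g continuous_ker by (auto simp: gauss_bounded_def intro!: continuous_intros)
      ultimately show ?thesis using e unfolding gauss_bounded_def by blast
    qed
    from unfolding_integral[OF this] show ?thesis
      by (simp add: periodize_def ker_lat)
  qed
  then show "(\<lambda>N. (\<integral>u. ker u^N *\<^sub>R g u \<partial>lborel) / complex_of_real (cellmass N)) \<longlonglongrightarrow> periodize g 0"
    unfolding cellmass_def by (simp only:) (rule pk(2)[OF c1 c2 c3 continuous_ker ker_bounds c4])
qed

definition fourier :: "(real ^ 'n \<Rightarrow> complex) \<Rightarrow> real ^ 'n \<Rightarrow> complex" where
  "fourier g y = (\<integral>u. g u * exp (2 * pi * \<i> * (y \<bullet> u)) \<partial>lborel)"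

text \<open>The same integral, with the kernel expanded into characters: each character produces a
  value of the Fourier transform, weighted by a product of ratios that increases the range of
  frequencies with \<open>N\<close> and tends to 1 at every fixed frequency.\<close>

lemma kernel_limit_dlat:
  assumes g: "integrable lborel g" and s: "integrable (count_space UNIV) (\<lambda>k. fourier g (dlat k))"
  shows "(\<lambda>N. (\<integral>u. ker u^N *\<^sub>R g u \<partial>lborel) / complex_of_real ((real ((2*N) choose N) / 4^N)^CARD('n)))
    \<longlonglongrightarrow> (\<integral>k. fourier g (dlat k) \<partial>count_space UNIV)"
proof -
  define W where "W N = (real ((2*N) choose N) / 4^N)^CARD('n)" for N
  have W: "W N > 0" for N by (simp add: W_def)
  have int: "integrable lborel (\<lambda>u. g u * exp (2 * pi * \<i> * (y \<bullet> u)))" for y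
    by (rule Bochner_Integration.integrable_bound[OF g]) (use g in \<open>auto simp: norm_mult\<close>)
  have eq: "(\<integral>u. ker u^N *\<^sub>R g u \<partial>lborel) / complex_of_real (W N) =
      (\<integral>k. complex_of_real (\<Prod>i\<in>UNIV. binom_ratio N (k i)) * fourier g (dlat k) \<partial>count_space UNIV)" for N
  proof -
    let ?S = "PiE (UNIV::'n set) (\<lambda>_. {-int N..int N})"
    have fin: "finite ?S" by (intro finite_PiE) auto
    have "ker u^N *\<^sub>R g u = complex_of_real (W N) * (\<Sum>k\<in>?S. complex_of_real (\<Prod>i\<in>UNIV. binom_ratio N (k i)) * (g u * exp (2 * pi * \<i> * (dlat k \<bullet> u))))" for u
      unfolding scaleR_conv_of_real ker_power_eq W_def[symmetric]
      by (simp add: sum_distrib_left sum_distrib_right mult_ac)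
    then have "(\<integral>u. ker u^N *\<^sub>R g u \<partial>lborel) = complex_of_real (W N) * (\<Sum>k\<in>?S. complex_of_real (\<Prod>i\<in>UNIV. binom_ratio N (k i)) * fourier g (dlat k))"
      using int by (simp add: fourier_def Bochner_Integration.integral_sum)
    also have "(\<Sum>k\<in>?S. complex_of_real (\<Prod>i\<in>UNIV. binom_ratio N (k i)) * fourier g (dlat k)) = (\<integral>k. complex_of_real (\<Prod>i\<in>UNIV. binom_ratio N (k i)) * fourier g (dlat k) \<partial>count_space UNIV)"
    proof -
      let ?f = "\<lambda>k. complex_of_real (\<Prod>i\<in>UNIV. binom_ratio N (k i)) * fourier g (dlat k)"
      \<comment> \<open>The ratios vanish outside this box, so the finite sum is a sum over all
        \<open>k\<close>; dominated convergence then works on one fixed measure space.\<close>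
      have sub: "{k. ?f k \<noteq> 0} \<subseteq> ?S"
      proof
        fix k assume "k \<in> {k. ?f k \<noteq> 0}"
        then have "binom_ratio N (k i) \<noteq> 0" for i by auto
        then have "\<bar>k i\<bar> \<le> int N" for i by (meson binom_ratio_def)
        then show "k \<in> ?S" by (auto simp: abs_le_iff minus_le_iff)
      qed
      have "(\<integral>k. ?f k \<partial>count_space UNIV) = (\<Sum>k | k \<in> UNIV \<and> ?f k \<noteq> 0. ?f k)"
        by (rule lebesgue_integral_count_space_finite_support) (use sub fin in \<open>auto intro: finite_subset\<close>)
      also have "\<dots> = (\<Sum>k\<in>?S. ?f k)" by (rule sum.mono_neutral_left[OF fin]) (use sub in auto)
      finally show ?thesis by simp
    qed
    finally show ?thesis using W[of N] by simp
  qed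
  have "(\<lambda>N. \<integral>k. complex_of_real (\<Prod>i\<in>UNIV. binom_ratio N (k i)) * fourier g (dlat k) \<partial>count_space UNIV) \<longlonglongrightarrow> (\<integral>k. fourier g (dlat k) \<partial>count_space UNIV)"
  proof (rule integral_dominated_convergence[OF _ _ integrable_norm[OF s]])
    show "AE k in count_space UNIV. (\<lambda>N. complex_of_real (\<Prod>i\<in>UNIV. binom_ratio N (k i)) * fourier g (dlat k)) \<longlonglongrightarrow> fourier g (dlat k)"
    proof (rule AE_I2)
      fix k :: "'n \<Rightarrow> int"
      have "(\<lambda>N. complex_of_real (\<Prod>i\<in>UNIV. binom_ratio N (k i)) * fourier g (dlat k)) \<longlonglongrightarrow> complex_of_real (\<Prod>i\<in>(UNIV::'n set). 1) * fourier g (dlat k)"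
        by (intro tendsto_intros binom_ratio_tendsto)
      then show "(\<lambda>N. complex_of_real (\<Prod>i\<in>UNIV. binom_ratio N (k i)) * fourier g (dlat k)) \<longlonglongrightarrow> fourier g (dlat k)" by simp
    qed
    show "AE k in count_space UNIV. norm (complex_of_real (\<Prod>i\<in>UNIV. binom_ratio N (k i)) * fourier g (dlat k)) \<le> norm (fourier g (dlat k))" for N
    proof (rule AE_I2)
      fix k :: "'n \<Rightarrow> int"
      have "\<bar>\<Prod>i\<in>UNIV. binom_ratio N (k i)\<bar> \<le> 1" using binom_ratio_bounds by (simp add: abs_prod prod_le_1)
      then show "norm (complex_of_real (\<Prod>i\<in>UNIV. binom_ratio N (k i)) * fourier g (dlat k)) \<le> norm (fourier g (dlat k))"
        by (simp only: norm_mult norm_of_real) (rule mult_left_le_one_le, auto)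
    qed
  qed auto
  then show ?thesis unfolding eq[symmetric] W_def .
qed

text \<open>Poisson summation up to the covolume, which is eliminated by comparison with
  a reference function \<open>g0\<close>.\<close>

theorem poisson_ratio:
  assumes g: "gauss_bounded g" "integrable lborel g" "integrable (count_space UNIV) (\<lambda>k. fourier g (dlat k))"
    and g0: "gauss_bounded g0" "integrable lborel g0" "integrable (count_space UNIV) (\<lambda>k. fourier g0 (dlat k))"
  shows "periodize g 0 * (\<integral>k. fourier g0 (dlat k) \<partial>count_space UNIV) = periodize g0 0 * (\<integral>k. fourier g (dlat k) \<partial>count_space UNIV)"
proof -
  define W where "W N = complex_of_real ((real ((2*N) choose N) / 4^N)^CARD('n))" for N
  define J where "J N = complex_of_real (cellmass N)" for N
  define I where "I g N = (\<integral>u. ker u^N *\<^sub>R g u \<partial>lborel)" for g :: "real ^ 'n \<Rightarrow> complex" and N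
  note l1 = kernel_limit_lat(2)[OF g(1), folded I_def J_def]
  note l2 = kernel_limit_dlat[OF g(2,3), folded I_def W_def]
  note m1 = kernel_limit_lat(2)[OF g0(1), folded I_def J_def]
  note m2 = kernel_limit_dlat[OF g0(2,3), folded I_def W_def]
  \<comment> \<open>Crossing the two test functions makes both products equal to
    \<open>I g N * I g0 N / (J N * W N)\<close>, so \<open>J\<close> and \<open>W\<close> never have
    to be compared.\<close>
  have "(\<lambda>N. (I g N / J N) * (I g0 N / W N)) \<longlonglongrightarrow> periodize g 0 * (\<integral>k. fourier g0 (dlat k) \<partial>count_space UNIV)"
    by (intro tendsto_mult l1 m2)
  moreover have "(\<lambda>N. (I g0 N / J N) * (I g N / W N)) \<longlonglongrightarrow> periodize g0 0 * (\<integral>k. fourier g (dlat k) \<partial>count_space UNIV)"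
    by (intro tendsto_mult m1 l2)
  then have "(\<lambda>N. (I g N / J N) * (I g0 N / W N)) \<longlonglongrightarrow> periodize g0 0 * (\<integral>k. fourier g (dlat k) \<partial>count_space UNIV)"
    by (simp add: mult.commute)
  ultimately show ?thesis by (rule LIMSEQ_unique)
qed

end

section \<open>Fourier transform of harmonic polynomials times Gaussians\<close>

text \<open>The single term of degree \<open>d\<close> in the exponential series bounds
  \<open>s^(2*d)\<close>, and \<open>s^d <= 1 + s^(2*d)\<close> bounds the power itself.\<close>

lemma power_le_exp_square:
  fixes c s :: real
  assumes "c > 0" "s \<ge> 0"
  shows "s^d \<le> (1 + fact d / c^d) * exp (c * s^2)"
proof -
  have "(c * s^2)^d / fact d \<le> exp (c * s^2)"
  proof -
    have "(\<Sum>n\<in>{d}. (c * s^2)^n /\<^sub>R fact n) \<le> (\<Sum>n. (c * s^2)^n /\<^sub>R fact n)"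
      by (rule sum_le_suminf) (use assms summable_exp_generic[of "c * s^2"] in auto)
    then show ?thesis by (simp add: exp_def divide_inverse mult.commute)
  qed
  then have "s^(2*d) \<le> fact d / c^d * exp (c * s^2)"
    using assms unfolding power_mult by (simp add: power_mult_distrib field_simps)
  moreover have "s^d \<le> 1 + s^(2*d)"
  proof -
    have "s^(2*d) = s^d * s^d" by (simp add: mult_2 power_add)
    then show ?thesis using zero_le_power2[of "s^d - 1/2"] by (simp add: power2_eq_square algebra_simps)
  qed
  moreover have "1 \<le> exp (c * s^2)" using assms by simp
  ultimately show ?thesis unfolding distrib_right by linarith
qed

text \<open>\<open>lborel\<close> on vectors is the image of a product measure indexed by
  \<open>Basis\<close>; the reindexing by \<open>axis\<close> turns this into a product over the
  coordinates.\<close>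

lemma lborel_vec_prod:
  fixes g :: "'n::finite \<Rightarrow> real \<Rightarrow> complex"
  assumes g: "\<And>i. integrable lborel (g i)"
  shows "integrable lborel (\<lambda>u::real^'n. \<Prod>i\<in>UNIV. g i (u $ i))"
    and "(\<integral>u. (\<Prod>i\<in>UNIV. g i (u $ i)) \<partial>(lborel :: (real^'n) measure)) = (\<Prod>i\<in>UNIV. \<integral>x. g i x \<partial>lborel)"
proof -
  interpret product_sigma_finite "\<lambda>_::real^'n. lborel :: real measure" by standard
  define ax where "ax i = (axis i 1 :: real^'n)" for i
  have inj: "inj ax" by (auto simp: inj_def ax_def axis_eq_axis)
  have Basis: "(Basis :: (real^'n) set) = range ax" by (auto simp: Basis_vec_def ax_def)
  define G where "G b = g (inv ax b)" for b
  have G: "G (ax i) = g i" for i using inj by (simp add: G_def)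
  have comp: "(\<Sum>b\<in>Basis. f b *\<^sub>R b) $ i = f (ax i)" for f :: "real^'n \<Rightarrow> real" and i
    unfolding Basis sum.reindex[OF inj] by (simp add: ax_def axis_def if_distrib[of "\<lambda>x. _ * x"] sum.delta cong: if_cong)
  have [measurable]: "g i \<in> borel_measurable borel" for i using g[of i] by auto
  have meas: "(\<lambda>u::real^'n. \<Prod>i\<in>UNIV. g i (u $ i)) \<in> borel_measurable borel" by measurable
  have pr: "(\<Prod>i\<in>UNIV. g i ((\<Sum>b\<in>Basis. f b *\<^sub>R b) $ i)) = (\<Prod>b\<in>Basis. G b (f b))" for f :: "real^'n \<Rightarrow> real"
    unfolding comp unfolding Basis prod.reindex[OF inj] by (simp add: G)
  have iG: "integrable lborel (G b)" for b unfolding G_def by (rule g)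
  have m2: "(\<lambda>f. \<Sum>b\<in>Basis. f b *\<^sub>R b) \<in> (\<Pi>\<^sub>M b\<in>(Basis::(real^'n) set). (lborel :: real measure)) \<rightarrow>\<^sub>M borel"
    by measurable
  show "integrable lborel (\<lambda>u::real^'n. \<Prod>i\<in>UNIV. g i (u $ i))"
    unfolding lborel_eq[where 'a = "real^'n"] integrable_distr_eq[OF m2 meas] pr
    by (rule product_integrable_prod) (use iG in auto)
  show "(\<integral>u. (\<Prod>i\<in>UNIV. g i (u $ i)) \<partial>(lborel :: (real^'n) measure)) = (\<Prod>i\<in>UNIV. \<integral>x. g i x \<partial>lborel)"
    unfolding lborel_eq[where 'a = "real^'n"] integral_distr[OF m2 meas] pr
    by (subst product_integral_prod) (use iG in \<open>auto simp: Basis prod.reindex[OF inj] G\<close>)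
qed

section \<open>Fourier transforms of monomials times Gaussians\<close>

definition gauss_moment :: "real \<Rightarrow> real \<Rightarrow> nat \<Rightarrow> complex" where
  "gauss_moment t y a = (\<integral>x. of_real (x^a * exp (- pi * t * x^2)) * exp (2 * pi * \<i> * of_real (y * x)) \<partial>lborel)"

lemma integrable_gauss_moment:
  fixes t y :: real
  assumes "t > 0"
  shows "integrable lborel (\<lambda>x. complex_of_real (x^a * exp (- pi * t * x^2)) * exp (2 * pi * \<i> * of_real (y * x)))"
proof -
  define c where "c = sqrt (2 * pi * t)"
  have c: "c > 0" "c^2 = 2 * pi * t" using assms by (auto simp: c_def)
  have "integrable lborel (\<lambda>x. std_normal_density (0 + c * x) * (0 + c * x)^a)"
    using c by (subst lborel_integrable_real_affine_iff[where f = "\<lambda>x. std_normal_density x * x^a"])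
      (auto intro: integrable_std_normal_moment)
  then have "integrable lborel (\<lambda>x. (sqrt (2 * pi) / c^a) * (std_normal_density (0 + c * x) * (0 + c * x)^a))"
    by (rule integrable_mult_right)
  also have "(\<lambda>x. (sqrt (2 * pi) / c^a) * (std_normal_density (0 + c * x) * (0 + c * x)^a)) = (\<lambda>x. x^a * exp (- pi * t * x^2))"
    using c by (auto simp: std_normal_density_def power_mult_distrib)
  finally show ?thesis
    by (rule Bochner_Integration.integrable_bound) (auto simp: norm_mult norm_power abs_mult power_abs)
qed

text \<open>Scaling by \<open>sqrt (2 * pi * t)\<close> turns the Gaussian into the standard normal
  density, so the integral is a value of its characteristic function.\<close>

lemma gauss_moment_0:
  assumes "t > 0"
  shows "gauss_moment t y 0 = of_real (exp (- pi * y^2 / t) / sqrt t)"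
proof -
  define c where "c = sqrt (2 * pi * t)"
  have c: "c > 0" "c^2 = 2 * pi * t" using assms by (auto simp: c_def)
  define s where "s = 2 * pi * y / c"
  have "complex_of_real (exp (- (s^2) / 2)) = (\<integral>x. iexp (s * x) \<partial>std_normal_distribution)"
    using fun_cong[OF char_std_normal_distribution, of s] by (simp add: char_def)
  also have "\<dots> = (\<integral>x. std_normal_density x *\<^sub>R iexp (s * x) \<partial>lborel)"
    by (subst integral_density) auto
  also have "\<dots> = \<bar>c\<bar> *\<^sub>R (\<integral>x. std_normal_density (0 + c * x) *\<^sub>R iexp (s * (0 + c * x)) \<partial>lborel)"
    using c by (intro lborel_integral_real_affine) auto
  also have "(\<lambda>x. std_normal_density (0 + c * x) *\<^sub>R iexp (s * (0 + c * x))) =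
    (\<lambda>x. complex_of_real (1 / sqrt (2*pi)) * (of_real (x^0 * exp (- pi * t * x^2)) * exp (2 * pi * \<i> * of_real (y * x))))"
  proof
    fix x
    have e1: "s * (c * x) = 2 * pi * (y * x)" using c by (simp add: s_def)
    have e2: "std_normal_density (c * x) = 1 / sqrt (2*pi) * exp (- pi * t * x^2)"
      using c by (simp add: std_normal_density_def power_mult_distrib)
    show "std_normal_density (0 + c * x) *\<^sub>R iexp (s * (0 + c * x)) =
      complex_of_real (1 / sqrt (2*pi)) * (of_real (x^0 * exp (- pi * t * x^2)) * exp (2 * pi * \<i> * of_real (y * x)))"
      unfolding add_0 e1 e2 by (simp add: scaleR_conv_of_real mult_ac)
  qed
  finally have "complex_of_real (exp (- (s^2) / 2)) = complex_of_real (c / sqrt (2*pi)) * gauss_moment t y 0"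
    using c unfolding gauss_moment_def by (simp add: scaleR_conv_of_real)
  moreover have "c / sqrt (2*pi) = sqrt t" by (simp add: c_def real_sqrt_mult)
  moreover have "s^2 / 2 = pi * y^2 / t" using c assms by (simp add: s_def power_divide power_mult_distrib power2_eq_square[of pi] field_simps)
  ultimately have "complex_of_real (exp (- (pi * y\<^sup>2 / t))) = complex_of_real (sqrt t) * gauss_moment t y 0"
    by simp
  then have "gauss_moment t y 0 = complex_of_real (exp (- (pi * y\<^sup>2 / t))) / complex_of_real (sqrt t)"
    using assms by (simp add: nonzero_eq_divide_eq mult.commute)
  then show ?thesis by simp
qed

text \<open>Integration by parts: the derivative of \<open>x^a\<close> times the Gaussian and the
  character integrates to 0. At \<open>a = 0\<close> the truncated index \<open>a - 1\<close>
  carries the coefficient 0.\<close>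

lemma gauss_moment_Suc:
  assumes t: "t > 0"
  shows "gauss_moment t y (Suc a) = (\<i> * y / t) * gauss_moment t y a + of_real (real a / (2 * pi * t)) * gauss_moment t y (a - 1)"
proof -
  define E where "E x = exp (complex_of_real (- pi * t * x^2) + 2 * pi * \<i> * of_real (y * x))" for x :: real
  define F where "F x = complex_of_real (x^a) * E x" for x :: real
  define f where "f x = (of_nat a * complex_of_real (x^(a-1))) * E x + complex_of_real (x^a) * ((2 * pi * \<i> * y - 2 * pi * t * x) * E x)" for x :: real
  have eq: "complex_of_real (x^b * exp (- pi * t * x^2)) * exp (2 * pi * \<i> * of_real (y * x)) = complex_of_real (x^b) * E x" for b x
    unfolding E_def exp_add exp_of_real by simp
  have int: "integrable lborel (\<lambda>x. complex_of_real (x^b) * E x)" for b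
    using integrable_gauss_moment[OF t, of b y] unfolding eq .
  have gm: "gauss_moment t y b = (\<integral>x. complex_of_real (x^b) * E x \<partial>lborel)" for b
    unfolding gauss_moment_def eq ..
  have f_eq: "f x = of_nat a * (complex_of_real (x^(a-1)) * E x) + (2 * pi * \<i> * y) * (complex_of_real (x^a) * E x)
     - (2 * pi * t) * (complex_of_real (x^(Suc a)) * E x)" for x
    by (simp add: f_def algebra_simps)
  have intf: "integrable lborel f"
    unfolding f_eq[abs_def] by (intro Bochner_Integration.integrable_diff Bochner_Integration.integrable_add integrable_mult_right int)
  have dE: "(E has_vector_derivative (2 * pi * \<i> * y - 2 * pi * t * x) * E x) (at x)" for x
  proof -
    have "((\<lambda>z. exp (- pi * t * z^2 + 2 * pi * \<i> * (y * z))) has_field_derivative (2 * pi * \<i> * y - 2 * pi * t * x) * E x) (at (complex_of_real x))"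
      by (auto intro!: derivative_eq_intros simp: E_def algebra_simps)
    from has_vector_derivative_real_field[OF this] show ?thesis by (simp add: E_def[abs_def])
  qed
  have dF: "(F has_vector_derivative f x) (at x)" for x
  proof -
    have "((\<lambda>z. z^a) has_field_derivative of_nat a * complex_of_real (x^(a-1))) (at (complex_of_real x))"
      by (auto intro!: derivative_eq_intros)
    from has_vector_derivative_real_field[OF this]
    have "((\<lambda>x. complex_of_real (x^a)) has_vector_derivative of_nat a * complex_of_real (x^(a-1))) (at x)" by simp
    from has_vector_derivative_mult[OF this dE] show ?thesis
      by (simp add: F_def[abs_def] f_def add.commute)
  qed
  have cf: "isCont f x" for x
    unfolding f_def E_def by (intro continuous_intros)
  have bd: "norm (F x) \<le> (1 + fact a / (pi * t / 2)^a) * exp (- (pi * t / 2) * x^2)" for x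
  proof -
    have "norm (F x) = \<bar>x\<bar>^a * exp (- pi * t * x^2)" by (simp add: F_def E_def norm_mult norm_power norm_exp_eq_Re power_abs)
    also have "\<dots> \<le> (1 + fact a / (pi * t / 2)^a) * exp ((pi * t / 2) * \<bar>x\<bar>^2) * exp (- pi * t * x^2)"
      using t by (intro mult_right_mono power_le_exp_square) auto
    also have "\<dots> = (1 + fact a / (pi * t / 2)^a) * exp (- (pi * t / 2) * x^2)"
      by (simp add: mult.assoc exp_add[symmetric])
    finally show ?thesis .
  qed
  have lim: "(F \<longlongrightarrow> 0) at_top" "(F \<longlongrightarrow> 0) at_bot"
  proof -
    define K where "K = 1 + fact a / (pi * t / 2)^a"
    define d where "d = pi * t / 2"
    have d: "d > 0" using t by (simp add: d_def)
    have "((\<lambda>x. K * exp (- d * x^2)) \<longlongrightarrow> 0) at_top" "((\<lambda>x. K * exp (- d * x^2)) \<longlongrightarrow> 0) at_bot"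
      using d by real_asymp+
    then show "(F \<longlongrightarrow> 0) at_top" "(F \<longlongrightarrow> 0) at_bot"
      using bd[folded K_def, folded d_def] by (auto elim!: Lim_null_comparison[rotated] intro!: always_eventually)
  qed
  have "(LBINT x=-\<infinity>..\<infinity>. f x) = 0 - 0"
    by (rule interval_integral_FTC_integrable[where F = F])
      (use dF cf lim intf in \<open>auto simp: ereal_tendsto_simps set_integrable_def\<close>)
  then have "(\<integral>x. f x \<partial>lborel) = 0" by (simp add: interval_lebesgue_integral_def set_lebesgue_integral_def)
  then have "of_nat a * gauss_moment t y (a-1) + (2 * pi * \<i> * y) * gauss_moment t y a - (2 * pi * t) * gauss_moment t y (Suc a) = 0"
    unfolding f_eq gm using int by (simp del: power_Suc)
  then show ?thesis using t by (simp add: field_simps)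
qed

text \<open>\<open>hermite v s a\<close> is the expectation of \<open>(v + Z)\<^sup>a\<close> for a centred Gaussian \<open>Z\<close> of variance \<open>s\<close>.\<close>

fun hermite :: "complex \<Rightarrow> complex \<Rightarrow> nat \<Rightarrow> complex" where
  "hermite v s 0 = 1"
| "hermite v s (Suc 0) = v"
| "hermite v s (Suc (Suc a)) = v * hermite v s (Suc a) + s * of_nat (Suc a) * hermite v s a"

lemma hermite_at_0: "hermite v 0 a = v^a"
  by (induction v "0::complex" a rule: hermite.induct) auto

text \<open>Both sides satisfy the same three-term recurrence: the Fourier transform acts as a
  complex mean \<open>\<i> * y / t\<close> and the variance \<open>1 / (2 * pi * t)\<close>.\<close>

lemma gauss_moment_eq_hermite:
  assumes "t > 0"
  shows "gauss_moment t y a = gauss_moment t y 0 * hermite (\<i> * y / t) (1 / (2 * pi * t)) a"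
proof (induction a rule: induct_nat_012)
  case 1
  show ?case using gauss_moment_Suc[OF assms, of y 0] by simp
next
  case (ge2 a)
  show ?case using gauss_moment_Suc[OF assms, of y "Suc a"] ge2 by (simp add: algebra_simps)
qed simp

text \<open>The heat equation: the derivative in the variance is half the second derivative in the
  mean \<open>v\<close>, and the latter lowers the index by 2. For \<open>a < 2\<close> the
  coefficient vanishes, so the truncated index does no harm.\<close>

lemma hermite_deriv:
  "((\<lambda>s. hermite v s a) has_field_derivative (of_nat a * of_nat (a - 1) / 2) * hermite v s (a - 2)) (at s)"
proof (induction v s a rule: hermite.induct)
  case (3 v s a)
  have "((\<lambda>s. hermite v s (Suc (Suc a))) has_field_derivative
      v * ((of_nat (Suc a) * of_nat (Suc a - 1) / 2) * hermite v s (Suc a - 2)) +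
      (of_nat (Suc a) * hermite v s a + s * of_nat (Suc a) * ((of_nat a * of_nat (a - 1) / 2) * hermite v s (a - 2)))) (at s)"
    unfolding hermite.simps by (rule derivative_eq_intros 3 refl | simp add: mult_ac)+
  also have "v * ((of_nat (Suc a) * of_nat (Suc a - 1) / 2) * hermite v s (Suc a - 2)) +
      (of_nat (Suc a) * hermite v s a + s * of_nat (Suc a) * ((of_nat a * of_nat (a - 1) / 2) * hermite v s (a - 2))) =
      (of_nat (Suc (Suc a)) * of_nat (Suc (Suc a) - 1) / 2) * hermite v s (Suc (Suc a) - 2)"
  proof -
    consider "a = 0" | "a = 1" | b where "a = Suc (Suc b)" by (metis One_nat_def not0_implies_Suc)
    then show ?thesis by cases (auto simp: field_simps)
  qed
  finally show ?case .
qed auto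

definition monom_fn :: "('n::finite \<Rightarrow> nat) \<Rightarrow> real ^ 'n \<Rightarrow> real" where
  "monom_fn \<beta> u = (\<Prod>i\<in>UNIV. (u $ i) ^ \<beta> i)"

lemma norm_sq_vec: "norm (u :: real ^ 'n::finite)^2 = (\<Sum>i\<in>UNIV. (u $ i)^2)"
  unfolding power2_norm_eq_inner by (simp add: inner_vec_def power2_eq_square)

lemma monom_fourier:
  fixes y :: "real ^ 'n::finite"
  assumes t: "t > 0"
  shows "integrable lborel (\<lambda>u. of_real (monom_fn \<beta> u * exp (- pi * t * norm u^2)) * exp (2 * pi * \<i> * (y \<bullet> u)))"
    and "(\<integral>u. of_real (monom_fn \<beta> u * exp (- pi * t * norm u^2)) * exp (2 * pi * \<i> * (y \<bullet> u)) \<partial>lborel) =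
      of_real (exp (- pi * norm y^2 / t) / sqrt t ^ CARD('n)) * (\<Prod>i\<in>UNIV. hermite (\<i> * y $ i / t) (1 / (2 * pi * t)) (\<beta> i))"
proof -
  have eq: "of_real (monom_fn \<beta> u * exp (- pi * t * norm u^2)) * exp (2 * pi * \<i> * (y \<bullet> u)) =
     (\<Prod>i\<in>UNIV. of_real ((u $ i)^\<beta> i * exp (- pi * t * (u $ i)^2)) * exp (2 * pi * \<i> * of_real (y $ i * u $ i)))" for u :: "real ^ 'n"
  proof -
    have "exp (- pi * t * norm u^2) = (\<Prod>i\<in>UNIV. exp (- pi * t * (u $ i)^2))"
      unfolding norm_sq_vec by (simp add: exp_sum[symmetric] sum_distrib_left)
    moreover have "exp (2 * pi * \<i> * (y \<bullet> u)) = (\<Prod>i\<in>UNIV. exp (2 * pi * \<i> * of_real (y $ i * u $ i)))"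
      by (simp add: exp_sum[symmetric] sum_distrib_left inner_vec_def)
    ultimately show ?thesis by (simp add: monom_fn_def prod.distrib)
  qed
  have i: "integrable lborel (\<lambda>x. complex_of_real (x^\<beta> i * exp (- pi * t * x^2)) * exp (2 * pi * \<i> * of_real (y $ i * x)))" for i
    by (rule integrable_gauss_moment[OF t])
  show "integrable lborel (\<lambda>u. of_real (monom_fn \<beta> u * exp (- pi * t * norm u^2)) * exp (2 * pi * \<i> * (y \<bullet> u)))"
    unfolding eq by (rule lborel_vec_prod(1)[OF i])
  have "(\<integral>u. of_real (monom_fn \<beta> u * exp (- pi * t * norm u^2)) * exp (2 * pi * \<i> * (y \<bullet> u)) \<partial>lborel) = (\<Prod>i\<in>UNIV. gauss_moment t (y $ i) (\<beta> i))"
    unfolding eq gauss_moment_def by (rule lborel_vec_prod(2)[OF i])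
  also have "\<dots> = (\<Prod>i\<in>UNIV. gauss_moment t (y $ i) 0 * hermite (\<i> * y $ i / t) (1 / (2 * pi * t)) (\<beta> i))"
    by (intro prod.cong refl gauss_moment_eq_hermite t)
  also have "\<dots> = (\<Prod>i\<in>UNIV. gauss_moment t (y $ i) 0) * (\<Prod>i\<in>UNIV. hermite (\<i> * y $ i / t) (1 / (2 * pi * t)) (\<beta> i))"
    by (rule prod.distrib)
  also have "(\<Prod>i\<in>UNIV. gauss_moment t (y $ i) 0) = of_real (exp (- pi * norm y^2 / t) / sqrt t ^ CARD('n))"
  proof -
    have "exp (- pi * norm y^2 / t) = (\<Prod>i\<in>UNIV. exp (- pi * (y $ i)^2 / t))"
      unfolding norm_sq_vec by (simp add: exp_sum[symmetric] sum_distrib_left sum_divide_distrib sum_negf)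
    then show ?thesis by (simp add: gauss_moment_0[OF t] prod_dividef)
  qed
  finally show "(\<integral>u. of_real (monom_fn \<beta> u * exp (- pi * t * norm u^2)) * exp (2 * pi * \<i> * (y \<bullet> u)) \<partial>lborel) =
      of_real (exp (- pi * norm y^2 / t) / sqrt t ^ CARD('n)) * (\<Prod>i\<in>UNIV. hermite (\<i> * y $ i / t) (1 / (2 * pi * t)) (\<beta> i))" .
qed

section \<open>Harmonic polynomials under the heat flow\<close>

definition multi_idx :: "nat \<Rightarrow> ('n::finite \<Rightarrow> nat) set" where
  "multi_idx d = {\<alpha>. sum \<alpha> UNIV = d}"

locale harmonic_poly =
  fixes d :: nat and P :: "real ^ 'n::finite \<Rightarrow> real" and c :: "('n \<Rightarrow> nat) \<Rightarrow> real"
  assumes P_eq: "\<And>x. P x = (\<Sum>\<alpha>\<in>multi_idx d. c \<alpha> * monom_fn \<alpha> x)"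
    and harm: "harmonic P"
begin

text \<open>Rewrites harmonicity as a linear relation between monomials, to which the Fourier
  transform applies term by term. Where \<open>\<alpha> i - 2\<close> truncates, the coefficient is
  0.\<close>

lemma laplacian_zero:
  "(\<Sum>\<alpha>\<in>multi_idx d. c \<alpha> * (\<Sum>i\<in>UNIV. real (\<alpha> i) * real (\<alpha> i - 1) * monom_fn (\<alpha>(i := \<alpha> i - 2)) x)) = 0"
proof -
  have D: "deriv (deriv (\<lambda>t. P (x + t *\<^sub>R axis i 1))) 0 =
    (\<Sum>\<alpha>\<in>multi_idx d. c \<alpha> * (real (\<alpha> i) * real (\<alpha> i - 1) * monom_fn (\<alpha>(i := \<alpha> i - 2)) x))" for i
  proof -
    define R where "R \<alpha> = (\<Prod>j\<in>UNIV-{i}. (x $ j)^\<alpha> j)" for \<alpha> :: "'n \<Rightarrow> nat"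
    have mono: "monom_fn \<alpha> (x + t *\<^sub>R axis i 1) = (x $ i + t)^\<alpha> i * R \<alpha>" for \<alpha> t
    proof -
      have "monom_fn \<alpha> (x + t *\<^sub>R axis i 1) = ((x + t *\<^sub>R axis i 1) $ i)^\<alpha> i * (\<Prod>j\<in>UNIV-{i}. ((x + t *\<^sub>R axis i 1) $ j)^\<alpha> j)"
        unfolding monom_fn_def by (rule prod.remove) auto
      also have "(\<Prod>j\<in>UNIV-{i}. ((x + t *\<^sub>R axis i 1) $ j)^\<alpha> j) = R \<alpha>"
        unfolding R_def by (rule prod.cong) (auto simp: axis_def)
      finally show ?thesis by (simp add: axis_def)
    qed
    have "((\<lambda>t. P (x + t *\<^sub>R axis i 1)) has_real_derivative (\<Sum>\<alpha>\<in>multi_idx d. c \<alpha> * (real (\<alpha> i) * (x $ i + t)^(\<alpha> i - 1) * R \<alpha>))) (at t)" for t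
      unfolding P_eq mono by (auto intro!: derivative_eq_intros simp: mult_ac)
    then have d1: "deriv (\<lambda>t. P (x + t *\<^sub>R axis i 1)) = (\<lambda>t. \<Sum>\<alpha>\<in>multi_idx d. c \<alpha> * (real (\<alpha> i) * (x $ i + t)^(\<alpha> i - 1) * R \<alpha>))"
      using DERIV_imp_deriv by blast
    have "((\<lambda>t. \<Sum>\<alpha>\<in>multi_idx d. c \<alpha> * (real (\<alpha> i) * (x $ i + t)^(\<alpha> i - 1) * R \<alpha>)) has_real_derivative
      (\<Sum>\<alpha>\<in>multi_idx d. c \<alpha> * (real (\<alpha> i) * real (\<alpha> i - 1) * ((x $ i)^(\<alpha> i - 2) * R \<alpha>)))) (at 0)"
      by (auto intro!: derivative_eq_intros simp: mult_ac numeral_2_eq_2)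
    moreover have "(x $ i)^(\<alpha> i - 2) * R \<alpha> = monom_fn (\<alpha>(i := \<alpha> i - 2)) x" for \<alpha>
    proof -
      have "monom_fn (\<alpha>(i := \<alpha> i - 2)) x = (x $ i)^((\<alpha>(i := \<alpha> i - 2)) i) * (\<Prod>j\<in>UNIV-{i}. (x $ j)^((\<alpha>(i := \<alpha> i - 2)) j))"
        unfolding monom_fn_def by (rule prod.remove) auto
      also have "(\<Prod>j\<in>UNIV-{i}. (x $ j)^((\<alpha>(i := \<alpha> i - 2)) j)) = R \<alpha>"
        unfolding R_def by (rule prod.cong) auto
      finally show ?thesis by (simp only: fun_upd_same)
    qed
    ultimately show ?thesis unfolding d1 by (simp add: DERIV_imp_deriv)
  qed
  have "0 = (\<Sum>i\<in>UNIV. \<Sum>\<alpha>\<in>multi_idx d. c \<alpha> * (real (\<alpha> i) * real (\<alpha> i - 1) * monom_fn (\<alpha>(i := \<alpha> i - 2)) x))"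
    using harm[unfolded harmonic_def, rule_format, of x] unfolding D by (rule sym)
  also have "\<dots> = (\<Sum>\<alpha>\<in>multi_idx d. c \<alpha> * (\<Sum>i\<in>UNIV. real (\<alpha> i) * real (\<alpha> i - 1) * monom_fn (\<alpha>(i := \<alpha> i - 2)) x))"
    by (subst sum.swap) (simp add: sum_distrib_left)
  finally show ?thesis by simp
qed

text \<open>Integrating the vanishing Laplacian against Gaussians shows that replacing each
  monomial by a product of Hermite polynomials also gives zero.\<close>

lemma laplacian_hermite_zero:
  fixes w :: "'n \<Rightarrow> real"
  assumes s: "s > 0"
  shows "(\<Sum>\<alpha>\<in>multi_idx d. of_real (c \<alpha>) * (\<Sum>i\<in>UNIV. of_nat (\<alpha> i) * of_nat (\<alpha> i - 1) *
    (\<Prod>j\<in>UNIV. hermite (\<i> * of_real (w j)) (of_real s) ((\<alpha>(i := \<alpha> i - 2)) j)))) = 0"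
proof -
  \<comment> \<open>Solves \<open>s = 1 / (2 * pi * t)\<close> and \<open>w = y / t\<close>, so that
    the parameters in \<open>monom_fourier\<close> become the prescribed ones.\<close>
  define t where "t = 1 / (2 * pi * s)"
  define y where "y = (\<chi> j. t * w j)"
  have t: "t > 0" using s by (simp add: t_def)
  have st: "complex_of_real s = 1 / (2 * pi * t)" using s by (simp add: t_def)
  have wy: "\<i> * of_real (w j) = \<i> * (y $ j) / t" for j using t by (simp add: y_def)
  define C where "C = complex_of_real (exp (- pi * norm y^2 / t) / sqrt t ^ CARD('n))"
  have C: "C \<noteq> 0" using t by (simp add: C_def)
  define G where "G \<beta> u = complex_of_real (monom_fn \<beta> u * exp (- pi * t * norm u^2)) * exp (2 * pi * \<i> * (y \<bullet> u))" for \<beta> and u :: "real ^ 'n"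
  have int: "integrable lborel (G \<beta>)" for \<beta> unfolding G_def by (rule monom_fourier(1)[OF t])
  have G: "integral\<^sup>L lborel (G \<beta>) = C * (\<Prod>j\<in>UNIV. hermite (\<i> * of_real (w j)) (of_real s) (\<beta> j))" for \<beta>
    unfolding G_def C_def wy st by (rule monom_fourier(2)[OF t])
  have "0 = (\<Sum>\<alpha>\<in>multi_idx d. of_real (c \<alpha>) * (\<Sum>i\<in>UNIV. of_nat (\<alpha> i) * of_nat (\<alpha> i - 1) * G (\<alpha>(i := \<alpha> i - 2)) u))" for u
  proof -
    have "(\<Sum>\<alpha>\<in>multi_idx d. of_real (c \<alpha>) * (\<Sum>i\<in>UNIV. of_nat (\<alpha> i) * of_nat (\<alpha> i - 1) * G (\<alpha>(i := \<alpha> i - 2)) u)) =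
      complex_of_real (\<Sum>\<alpha>\<in>multi_idx d. c \<alpha> * (\<Sum>i\<in>UNIV. real (\<alpha> i) * real (\<alpha> i - 1) * monom_fn (\<alpha>(i := \<alpha> i - 2)) u)) *
      (exp (- pi * t * norm u^2) * exp (2 * pi * \<i> * (y \<bullet> u)))"
      by (simp add: G_def sum_distrib_right sum_distrib_left mult_ac)
    then show ?thesis unfolding laplacian_zero by simp
  qed
  then have "0 = (\<integral>u. (\<Sum>\<alpha>\<in>multi_idx d. of_real (c \<alpha>) * (\<Sum>i\<in>UNIV. of_nat (\<alpha> i) * of_nat (\<alpha> i - 1) * G (\<alpha>(i := \<alpha> i - 2)) u)) \<partial>lborel)"
    by simp
  also have "\<dots> = (\<Sum>\<alpha>\<in>multi_idx d. of_real (c \<alpha>) * (\<Sum>i\<in>UNIV. of_nat (\<alpha> i) * of_nat (\<alpha> i - 1) * integral\<^sup>L lborel (G (\<alpha>(i := \<alpha> i - 2)))))"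
    using int by (simp add: Bochner_Integration.integral_sum)
  also have "\<dots> = C * (\<Sum>\<alpha>\<in>multi_idx d. of_real (c \<alpha>) * (\<Sum>i\<in>UNIV. of_nat (\<alpha> i) * of_nat (\<alpha> i - 1) *
    (\<Prod>j\<in>UNIV. hermite (\<i> * of_real (w j)) (of_real s) ((\<alpha>(i := \<alpha> i - 2)) j))))"
    unfolding G by (simp add: sum_distrib_left mult_ac)
  finally show ?thesis using C by simp
qed

text \<open>By the heat equation, the derivative in \<open>s\<close> of the left side is half the
  Hermite substitution of the Laplacian, hence zero. So the left side keeps its value at
  \<open>s = 0\<close>, where Hermite polynomials are powers.\<close>

lemma hermite_subst:
  fixes w :: "'n \<Rightarrow> real"
  assumes s: "s \<ge> 0"
  shows "(\<Sum>\<alpha>\<in>multi_idx d. of_real (c \<alpha>) * (\<Prod>j\<in>UNIV. hermite (\<i> * of_real (w j)) (of_real s) (\<alpha> j))) =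
    (\<Sum>\<alpha>\<in>multi_idx d. of_real (c \<alpha>) * (\<Prod>j\<in>UNIV. (\<i> * of_real (w j))^\<alpha> j))"
proof -
  define R where "R z = (\<Sum>\<alpha>\<in>multi_idx d. of_real (c \<alpha>) * (\<Prod>j\<in>UNIV. hermite (\<i> * of_real (w j)) z (\<alpha> j)))" for z
  define R' where "R' z = (\<Sum>\<alpha>\<in>multi_idx d. of_real (c \<alpha>) * (\<Sum>i\<in>UNIV. (of_nat (\<alpha> i) * of_nat (\<alpha> i - 1) / 2 * hermite (\<i> * of_real (w i)) z (\<alpha> i - 2)) *
     (\<Prod>j\<in>UNIV-{i}. hermite (\<i> * of_real (w j)) z (\<alpha> j))))" for z
  have dR: "(R has_field_derivative R' z) (at z)" for z
    unfolding R_def R'_def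
    by (intro DERIV_sum DERIV_cmult has_field_derivative_prod hermite_deriv)
  have R'0: "R' (of_real x) = 0" if "x > 0" for x :: real
  proof -
    have "(of_nat (\<alpha> i) * of_nat (\<alpha> i - 1) / 2 * hermite (\<i> * of_real (w i)) z (\<alpha> i - 2)) * (\<Prod>j\<in>UNIV-{i}. hermite (\<i> * of_real (w j)) z (\<alpha> j)) =
      (of_nat (\<alpha> i) * of_nat (\<alpha> i - 1) * (\<Prod>j\<in>UNIV. hermite (\<i> * of_real (w j)) z ((\<alpha>(i := \<alpha> i - 2)) j))) / 2" for \<alpha> i z
    proof -
      have "(\<Prod>j\<in>UNIV. hermite (\<i> * of_real (w j)) z ((\<alpha>(i := \<alpha> i - 2)) j)) = hermite (\<i> * of_real (w i)) z ((\<alpha>(i := \<alpha> i - 2)) i) *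
        (\<Prod>j\<in>UNIV-{i}. hermite (\<i> * of_real (w j)) z ((\<alpha>(i := \<alpha> i - 2)) j))"
        by (rule prod.remove) auto
      also have "(\<Prod>j\<in>UNIV-{i}. hermite (\<i> * of_real (w j)) z ((\<alpha>(i := \<alpha> i - 2)) j)) = (\<Prod>j\<in>UNIV-{i}. hermite (\<i> * of_real (w j)) z (\<alpha> j))"
        by (rule prod.cong) auto
      finally show ?thesis by simp
    qed
    then have "R' (of_real x) = (\<Sum>\<alpha>\<in>multi_idx d. of_real (c \<alpha>) * (\<Sum>i\<in>UNIV. of_nat (\<alpha> i) * of_nat (\<alpha> i - 1) *
      (\<Prod>j\<in>UNIV. hermite (\<i> * of_real (w j)) (of_real x) ((\<alpha>(i := \<alpha> i - 2)) j)))) / 2"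
      unfolding R'_def by (simp only: sum_divide_distrib[symmetric] times_divide_eq_right)
    then show ?thesis unfolding laplacian_hermite_zero[OF that] by simp
  qed
  have dR2: "((\<lambda>x. R (of_real x)) has_vector_derivative R' (of_real x)) (at x)" for x :: real
    by (rule has_vector_derivative_real_field[OF dR])
  \<comment> \<open>The derivative is known to vanish only for positive variance; the endpoint 0 is
    reached by continuity.\<close>
  have "R (of_real s) = R 0"
  proof (rule has_derivative_zero_unique_strong_interval[where f = "\<lambda>x. R (of_real x)" and k = "{0}" and a = 0 and b = s and x = s])
    show "continuous_on {0..s} (\<lambda>x. R (of_real x))"
      using dR2 by (intro continuous_at_imp_continuous_on) (auto intro: has_vector_derivative_continuous)
    show "((\<lambda>x. R (of_real x)) has_derivative (\<lambda>h. 0)) (at x within {0..s})" if "x \<in> {0..s} - {0}" for x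
      using dR2[of x] R'0[of x] that by (auto simp: has_vector_derivative_def intro: has_derivative_at_withinI)
  qed (use s in auto)
  then show ?thesis by (simp add: R_def hermite_at_0)
qed

text \<open>The Hecke-Bochner formula: after the Hermite polynomials have been replaced by powers,
  homogeneity pulls out the factor \<open>(\<i> / t)^d\<close>.\<close>

lemma harmonic_fourier:
  fixes y :: "real ^ 'n"
  assumes t: "t > 0"
  shows "integrable lborel (\<lambda>u. of_real (P u * exp (- pi * t * norm u^2)) * exp (2 * pi * \<i> * (y \<bullet> u)))"
    and "(\<integral>u. of_real (P u * exp (- pi * t * norm u^2)) * exp (2 * pi * \<i> * (y \<bullet> u)) \<partial>lborel) =
      (\<i> / t)^d / of_real (sqrt t ^ CARD('n)) * of_real (P y * exp (- pi * norm y^2 / t))"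
proof -
  define G where "G \<beta> u = complex_of_real (monom_fn \<beta> u * exp (- pi * t * norm u^2)) * exp (2 * pi * \<i> * (y \<bullet> u))" for \<beta> and u :: "real ^ 'n"
  define C where "C = complex_of_real (exp (- pi * norm y^2 / t) / sqrt t ^ CARD('n))"
  have int: "integrable lborel (G \<beta>)" for \<beta> unfolding G_def by (rule monom_fourier(1)[OF t])
  have eq: "of_real (P u * exp (- pi * t * norm u^2)) * exp (2 * pi * \<i> * (y \<bullet> u)) = (\<Sum>\<alpha>\<in>multi_idx d. of_real (c \<alpha>) * G \<alpha> u)" for u
    by (simp add: P_eq G_def sum_distrib_left sum_distrib_right mult_ac)
  show "integrable lborel (\<lambda>u. of_real (P u * exp (- pi * t * norm u^2)) * exp (2 * pi * \<i> * (y \<bullet> u)))"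
    unfolding eq using int by auto
  define w where "w j = y $ j / t" for j
  define s where "s = 1 / (2 * pi * t)"
  have "(\<integral>u. of_real (P u * exp (- pi * t * norm u^2)) * exp (2 * pi * \<i> * (y \<bullet> u)) \<partial>lborel) = (\<Sum>\<alpha>\<in>multi_idx d. of_real (c \<alpha>) * integral\<^sup>L lborel (G \<alpha>))"
    unfolding eq using int by (simp add: Bochner_Integration.integral_sum)
  also have "\<dots> = (\<Sum>\<alpha>\<in>multi_idx d. of_real (c \<alpha>) * (C * (\<Prod>j\<in>UNIV. hermite (\<i> * of_real (w j)) (of_real s) (\<alpha> j))))"
    unfolding G_def monom_fourier(2)[OF t] C_def by (simp add: w_def s_def)
  also have "\<dots> = C * (\<Sum>\<alpha>\<in>multi_idx d. of_real (c \<alpha>) * (\<Prod>j\<in>UNIV. hermite (\<i> * of_real (w j)) (of_real s) (\<alpha> j)))"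
    by (simp add: sum_distrib_left mult_ac)
  also have "(\<Sum>\<alpha>\<in>multi_idx d. of_real (c \<alpha>) * (\<Prod>j\<in>UNIV. hermite (\<i> * of_real (w j)) (of_real s) (\<alpha> j))) =
     (\<Sum>\<alpha>\<in>multi_idx d. of_real (c \<alpha>) * (\<Prod>j\<in>UNIV. (\<i> * of_real (w j))^\<alpha> j))"
    by (rule hermite_subst) (use t in \<open>simp add: s_def\<close>)
  also have "\<dots> = (\<Sum>\<alpha>\<in>multi_idx d. (\<i> / t)^d * of_real (c \<alpha> * monom_fn \<alpha> y))"
  proof (rule sum.cong[OF refl])
    fix \<alpha> :: "'n \<Rightarrow> nat" assume a: "\<alpha> \<in> multi_idx d"
    have "(\<Prod>j\<in>UNIV. (\<i> * of_real (w j))^\<alpha> j) = (\<Prod>j\<in>UNIV. (\<i> / t)^\<alpha> j * of_real ((y $ j)^\<alpha> j))"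
      by (rule prod.cong) (auto simp: w_def power_mult_distrib power_divide)
    also have "\<dots> = (\<i> / t)^(sum \<alpha> UNIV) * of_real (monom_fn \<alpha> y)"
      by (simp add: prod.distrib power_sum monom_fn_def)
    also have "sum \<alpha> UNIV = d" using a by (simp add: multi_idx_def)
    finally show "of_real (c \<alpha>) * (\<Prod>j\<in>UNIV. (\<i> * of_real (w j))^\<alpha> j) = (\<i> / t)^d * of_real (c \<alpha> * monom_fn \<alpha> y)" by simp
  qed
  also have "\<dots> = (\<i> / t)^d * of_real (P y)" by (simp add: P_eq sum_distrib_left)
  finally show "(\<integral>u. of_real (P u * exp (- pi * t * norm u^2)) * exp (2 * pi * \<i> * (y \<bullet> u)) \<partial>lborel) =
      (\<i> / t)^d / of_real (sqrt t ^ CARD('n)) * of_real (P y * exp (- pi * norm y^2 / t))"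
    by (simp add: C_def mult_ac)
qed

end

section \<open>Theta series\<close>

text \<open>Groups an absolutely convergent sum over the lattice by norm; this turns theta values
  into power series whose coefficients are sums over shells.\<close>

lemma fiber_sums:
  fixes f :: "'a \<Rightarrow> complex" and e :: "'a \<Rightarrow> nat"
  assumes f: "integrable (count_space L) f" and fin: "\<And>m. finite {x \<in> L. e x = m}"
  shows "(\<lambda>m. \<Sum>x\<in>{x \<in> L. e x = m}. f x) sums (\<integral>x. f x \<partial>count_space L)"
proof -
  have abs: "Infinite_Set_Sum.abs_summable_on f L" using f by (simp add: abs_summable_on_def)
  then have "Infinite_Sum.abs_summable_on f L" by (simp add: abs_summable_equivalent)
  then have s: "f summable_on L" by (rule abs_summable_summable)
  have int: "(\<integral>x. f x \<partial>count_space L) = infsum f L"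
    using infsetsum_infsum[OF abs] by (simp add: infsetsum_def)
  define B where "B m = {x \<in> L. e x = m}" for m
  have bij: "bij_betw snd (Sigma UNIV B) L"
    by (rule bij_betwI[where g = "\<lambda>x. (e x, x)"]) (auto simp: B_def)
  have sS: "(\<lambda>(m, x). f x) summable_on (Sigma UNIV B)"
    using s summable_on_reindex_bij_betw[OF bij, of f] by (simp add: case_prod_unfold)
  have "((\<lambda>m. infsum f (B m)) has_sum infsum (\<lambda>m. infsum f (B m)) UNIV) UNIV"
    using summable_on_Sigma_banach[OF sS] by (rule has_sum_infsum)
  also have "infsum (\<lambda>m. infsum f (B m)) UNIV = infsum (\<lambda>(m, x). f x) (Sigma UNIV B)"
    by (rule infsum_Sigma'_banach[OF sS])
  also have "\<dots> = infsum f L"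
    using infsum_reindex_bij_betw[OF bij, of f] by (simp add: case_prod_unfold)
  also have "(\<lambda>m. infsum f (B m)) = (\<lambda>m. \<Sum>x\<in>B m. f x)"
    using fin by (simp add: B_def)
  finally show ?thesis unfolding int B_def by (rule has_sum_imp_sums)
qed

section \<open>Lattices presented by dual bases\<close>

lemma lattice_dual_bases:
  assumes "is_lattice (L :: (real ^ 'n::finite) set)"
  obtains B Bd where "dual_bases B Bd" "L = range (dual_bases.lat B)"
proof -
  obtain B :: "'n \<Rightarrow> real ^ 'n" where B: "inj B" "independent (range B)"
    "L = {(\<Sum>i\<in>UNIV. of_int (z i) *\<^sub>R B i) | z :: 'n \<Rightarrow> int. True}"
    using assms unfolding is_lattice_def by blast
  \<comment> \<open>\<open>f\<close> is the coordinate map of the basis \<open>B\<close>; its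
    adjoint sends the standard basis to the dual basis.\<close>
  obtain f where f: "linear f" "\<And>x. x \<in> range B \<Longrightarrow> f x = (axis (inv B x) 1 :: real ^ 'n)"
    using linear_independent_extend[OF B(2), of "\<lambda>x. axis (inv B x) 1"] by blast
  have fB: "f (B i) = axis i 1" for i using f(2)[of "B i"] B(1) by simp
  define Bd where "Bd i = adjoint f (axis i 1)" for i
  have Bd: "Bd i \<bullet> u = f u $ i" for i u
    unfolding Bd_def adjoint_clauses(2)[OF f(1)] by (simp add: inner_axis')
  have span: "span (range B) = UNIV"
  proof (rule ccontr)
    assume "span (range B) \<noteq> UNIV"
    then have "dim (range B) < DIM(real ^ 'n)" by (metis dim_eq_full dim_subset_UNIV le_neq_implies_less)
    moreover have "dim (range B) = card (range B)" using B(2) by (rule dim_eq_card_independent)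
    moreover have "card (range B) = CARD('n)" using B(1) by (rule card_image)
    ultimately show False by simp
  qed
  have ex: "(\<Sum>i\<in>UNIV. (Bd i \<bullet> u) *\<^sub>R B i) = u" for u
  proof -
    have "u \<in> span (range B)" using span by simp
    then show ?thesis
    proof (induction rule: span_induct_alt)
      case base
      then show ?case by simp
    next
      case (step c x y)
      then obtain j where j: "x = B j" by auto
      have "(\<Sum>i\<in>UNIV. (Bd i \<bullet> (c *\<^sub>R x + y)) *\<^sub>R B i) = c *\<^sub>R (\<Sum>i\<in>UNIV. (Bd i \<bullet> x) *\<^sub>R B i) + (\<Sum>i\<in>UNIV. (Bd i \<bullet> y) *\<^sub>R B i)"
        by (simp add: inner_add_right scaleR_add_left sum.distrib scaleR_sum_right)
      also have "(\<Sum>i\<in>UNIV. (Bd i \<bullet> x) *\<^sub>R B i) = (\<Sum>i\<in>UNIV. if i = j then B i else 0)"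
        unfolding j Bd fB by (rule sum.cong) (auto simp: axis_def)
      finally show ?case using step j by simp
    qed
  qed
  have db: "dual_bases B Bd"
    by standard (auto simp: Bd fB axis_def ex[unfolded Bd])
  moreover have "L = range (dual_bases.lat B)"
    unfolding B(3) using dual_bases.lat_def[OF db] by (auto simp: image_def)
  ultimately show thesis using that by blast
qed

context dual_bases
begin

lemma inj_lat: "inj lat"
  by (rule injI, rule ext) (metis Bd_lat of_int_eq_iff)

lemma inj_dlat: "inj dlat"
  by (rule injI, rule ext) (metis B_dlat of_int_eq_iff)

lemma dual_range_lat: "dual_lattice (range lat) = range dlat"
proof (intro equalityI subsetI)
  fix y assume y: "y \<in> dual_lattice (range lat)"
  have "B i \<bullet> y \<in> \<int>" for i
  proof -
    have "lat (\<lambda>j. if j = i then 1 else 0) = B i"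
      by (simp add: lat_def if_distrib[of "\<lambda>z. real_of_int z *\<^sub>R _"] sum.delta cong: if_cong)
    moreover have "lat (\<lambda>j. if j = i then 1 else 0) \<bullet> y \<in> \<int>" using y by (simp add: dual_lattice_def)
    ultimately show ?thesis by simp
  qed
  then obtain k where k: "\<And>i. B i \<bullet> y = of_int (k i)" unfolding Ints_def by (auto simp: image_iff) metis
  have "y = dlat k" using expand_dual[of y] by (simp add: k dlat_def)
  then show "y \<in> range dlat" by simp
next
  fix y assume "y \<in> range dlat"
  then obtain k where "y = dlat k" by auto
  then have "lat m \<bullet> y \<in> \<int>" for m
    unfolding lat_def inner_sum_left inner_scaleR_left by (auto simp: B_dlat intro!: Ints_mult Ints_sum)
  then show "y \<in> dual_lattice (range lat)" by (auto simp: dual_lattice_def)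
qed

lemma finite_lat_norm: "finite {x \<in> range lat. norm x^2 \<le> r}"
proof -
  obtain c where c: "c > 0" "\<And>m. c * (\<Sum>i\<in>UNIV. (of_int (m i))^2) \<le> norm (lat m)^2"
    using lat_norm_bound by blast
  define N where "N = \<lceil>r / c\<rceil>"
  have "{x \<in> range lat. norm x^2 \<le> r} \<subseteq> lat ` (PiE UNIV (\<lambda>_. {-N..N}))"
  proof
    fix x assume "x \<in> {x \<in> range lat. norm x^2 \<le> r}"
    then obtain m where m: "x = lat m" "norm (lat m)^2 \<le> r" by auto
    have "\<bar>m i\<bar> \<le> N" for i
    proof -
      have "(of_int (m i))^2 \<le> (\<Sum>i\<in>UNIV. (real_of_int (m i))^2)"
        by (rule member_le_sum) auto
      also have "\<dots> \<le> r / c" using c(2)[of m] m(2) c(1) by (simp add: field_simps)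
      also have "\<dots> \<le> of_int N" by (simp add: N_def)
      finally have "(m i)^2 \<le> N" by (metis of_int_le_iff of_int_power)
      moreover have "\<bar>m i\<bar> * 1 \<le> \<bar>m i\<bar> * \<bar>m i\<bar>"
        by (cases "m i = 0", simp, rule mult_left_mono) auto
      ultimately show ?thesis by (simp add: power2_eq_square)
    qed
    then have "m \<in> PiE UNIV (\<lambda>_. {-N..N})" by (auto simp: abs_le_iff minus_le_iff)
    then show "x \<in> lat ` (PiE UNIV (\<lambda>_. {-N..N}))" using m by blast
  qed
  then show ?thesis by (rule finite_subset) (auto intro!: finite_imageI finite_PiE)
qed

end

context harmonic_poly
begin

lemma P_bound: "\<exists>C. \<forall>u. \<bar>P u\<bar> \<le> C * norm u^d"
proof -
  have "\<bar>P u\<bar> \<le> (\<Sum>\<alpha>\<in>multi_idx d. \<bar>c \<alpha>\<bar>) * norm u^d" for u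
  proof -
    have "\<bar>P u\<bar> \<le> (\<Sum>\<alpha>\<in>multi_idx d. \<bar>c \<alpha> * monom_fn \<alpha> u\<bar>)" unfolding P_eq by (rule sum_abs)
    also have "\<dots> \<le> (\<Sum>\<alpha>\<in>multi_idx d. \<bar>c \<alpha>\<bar> * norm u^d)"
    proof (rule sum_mono)
      fix \<alpha> :: "'n \<Rightarrow> nat" assume a: "\<alpha> \<in> multi_idx d"
      have "\<bar>monom_fn \<alpha> u\<bar> = (\<Prod>i\<in>UNIV. \<bar>u $ i\<bar>^\<alpha> i)" by (simp add: monom_fn_def abs_prod power_abs)
      also have "\<dots> \<le> (\<Prod>i\<in>UNIV. norm u^\<alpha> i)" by (intro prod_mono) (auto intro!: power_mono component_le_norm_cart)
      also have "\<dots> = norm u^d" using a by (simp add: power_sum[symmetric] multi_idx_def)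
      finally show "\<bar>c \<alpha> * monom_fn \<alpha> u\<bar> \<le> \<bar>c \<alpha>\<bar> * norm u^d" by (simp add: abs_mult mult_left_mono)
    qed
    finally show ?thesis by (simp add: sum_distrib_right)
  qed
  then show ?thesis by blast
qed

lemma P_continuous: "continuous_on UNIV P"
  unfolding P_eq[abs_def] monom_fn_def by (intro continuous_intros)

text \<open>Half of the Gaussian decay is spent on absorbing the polynomial growth.\<close>

lemma P_gauss_bounded:
  assumes t: "t > 0"
  shows "gauss_bounded (\<lambda>u. z * of_real (P u * exp (- pi * t * norm u^2)))"
proof -
  obtain C where C: "\<And>u. \<bar>P u\<bar> \<le> C * norm u^d" using P_bound by blast
  define K where "K = 1 + fact d / (pi * t / 2)^d"
  have C': "\<bar>P u\<bar> \<le> \<bar>C\<bar> * norm u^d" for u by (rule order_trans[OF C mult_right_mono]) auto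
  have "norm (z * of_real (P u * exp (- pi * t * norm u^2))) \<le> (norm z * \<bar>C\<bar> * K) * exp (- (pi * t / 2) * norm u^2)" for u
  proof -
    have "norm u^d \<le> K * exp ((pi * t / 2) * norm u^2)"
      unfolding K_def using t by (intro power_le_exp_square) auto
    then have "\<bar>P u\<bar> \<le> \<bar>C\<bar> * (K * exp ((pi * t / 2) * norm u^2))"
      using C'[of u] by (meson abs_ge_zero mult_left_mono order_trans)
    then have "\<bar>P u\<bar> * exp (- pi * t * norm u^2) \<le> \<bar>C\<bar> * (K * exp ((pi * t / 2) * norm u^2)) * exp (- pi * t * norm u^2)"
      by (rule mult_right_mono) simp
    also have "\<dots> = \<bar>C\<bar> * K * exp (- (pi * t / 2) * norm u^2)"
      by (simp add: mult.assoc exp_add[symmetric])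
    finally have "norm z * (\<bar>P u\<bar> * exp (- pi * t * norm u^2)) \<le> norm z * (\<bar>C\<bar> * K * exp (- (pi * t / 2) * norm u^2))"
      by (rule mult_left_mono) simp
    then show ?thesis by (simp add: norm_mult abs_mult mult.assoc)
  qed
  moreover have "continuous_on UNIV (\<lambda>u. z * of_real (P u * exp (- pi * t * norm u^2)))"
    using P_continuous by (intro continuous_intros)
  moreover have "pi * t / 2 > 0" using t by simp
  ultimately show ?thesis unfolding gauss_bounded_def by blast
qed

end

section \<open>Theta series with harmonic coefficients on the imaginary axis\<close>

text \<open>Makes the pure Gaussian available as the reference function of the Poisson
  comparison.\<close>

lemma harmonic_poly_one: "harmonic_poly 0 (\<lambda>_ :: real ^ 'n::finite. 1) (\<lambda>_. 1)"
proof
  have "multi_idx 0 = {\<lambda>_::'n. 0 :: nat}" by (auto simp: multi_idx_def)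
  then show "1 = (\<Sum>\<alpha>\<in>multi_idx 0. 1 * monom_fn \<alpha> x)" for x :: "real ^ 'n" by (simp add: monom_fn_def)
  show "harmonic (\<lambda>_ :: real ^ 'n. 1)" by (simp add: harmonic_def)
qed

text \<open>The theta series at \<open>\<tau> = \<i> * t\<close>; there the exponentials are real
  Gaussians, to which the Fourier computation applies.\<close>

definition theta :: "(real ^ 'n::finite) set \<Rightarrow> (real ^ 'n \<Rightarrow> real) \<Rightarrow> real \<Rightarrow> complex" where
  "theta L P t = (\<integral>x. of_real (P x * exp (- pi * t * norm x^2)) \<partial>count_space L)"

lemma theta_summable:
  fixes L :: "(real ^ 'n::finite) set"
  assumes L: "is_lattice L" and P: "harmonic_poly d P c" and t: "t > 0"
  shows "integrable (count_space L) (\<lambda>x. complex_of_real (P x * exp (- pi * t * norm x^2)))"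
proof -
  interpret P: harmonic_poly d P c by fact
  obtain B Bd where B: "dual_bases B Bd" "L = range (dual_bases.lat B)" by (rule lattice_dual_bases[OF L])
  interpret dual_bases B Bd by fact
  have bij: "bij_betw lat UNIV L" using inj_lat B(2) by (simp add: bij_betw_def)
  show ?thesis
    using gauss_bounded_summable[OF P.P_gauss_bounded[OF t, of 1], of 0]
      integrable_bij_count_space[OF bij, of "\<lambda>x. complex_of_real (P x * exp (- pi * t * norm x^2))"] by simp
qed

text \<open>Selfduality lets \<open>lat\<close> and \<open>dlat\<close> enumerate the same set, so
  Poisson summation relates the theta series to itself. The reference Gaussian at
  \<open>t = 1\<close> is its own Fourier transform, hence its two sums agree and cancel once they
  are known to be nonzero.\<close>

lemma theta_inversion:
  fixes L :: "(real ^ 'n::finite) set"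
  assumes L: "selfdual_lattice L" and P: "harmonic_poly d P c" and t: "t > 0"
  shows "theta L P t = (\<i> / t)^d / of_real (sqrt t ^ CARD('n)) * theta L P (1/t)"
proof -
  have lat: "is_lattice L" "dual_lattice L = L" using L by (auto simp: selfdual_lattice_def)
  interpret P: harmonic_poly d P c by fact
  interpret one: harmonic_poly 0 "\<lambda>_ :: real ^ 'n. 1" "\<lambda>_. 1" by (rule harmonic_poly_one)
  obtain B Bd where B: "dual_bases B Bd" "L = range (dual_bases.lat B)" by (rule lattice_dual_bases[OF lat(1)])
  interpret dual_bases B Bd by fact
  have bij: "bij_betw lat UNIV L" "bij_betw dlat UNIV L"
    using inj_lat inj_dlat B(2) dual_range_lat lat(2) by (auto simp: bij_betw_def)
  define g where "g u = complex_of_real (P u * exp (- pi * t * norm u^2))" for u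
  define g0 where "g0 u = complex_of_real (1 * exp (- pi * 1 * norm u^2))" for u :: "real ^ 'n"
  define C where "C = (\<i> / t)^d / of_real (sqrt t ^ CARD('n))"
  have ftg: "fourier g y = C * of_real (P y * exp (- pi * (1/t) * norm y^2))" for y
    unfolding fourier_def g_def C_def using P.harmonic_fourier(2)[OF t, of y] by simp
  have ftg0: "fourier g0 y = g0 y" for y
    unfolding fourier_def g0_def using one.harmonic_fourier(2)[of 1 y] by simp
  have sum_g: "periodize g 0 = theta L P t"
    using integral_bij_count_space[OF bij(1), of g] by (simp add: periodize_def theta_def g_def[abs_def])
  have sum_g0: "periodize g0 0 = theta L (\<lambda>_. 1) 1"
    using integral_bij_count_space[OF bij(1), of g0] by (simp add: periodize_def theta_def g0_def[abs_def])
  have sum_ftg: "(\<integral>k. fourier g (dlat k) \<partial>count_space UNIV) = C * theta L P (1/t)"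
    unfolding ftg integral_bij_count_space[OF bij(2), of "\<lambda>y. C * of_real (P y * exp (- pi * (1/t) * norm y^2))"]
    by (simp add: theta_def)
  have sum_ftg0: "(\<integral>k. fourier g0 (dlat k) \<partial>count_space UNIV) = theta L (\<lambda>_. 1) 1"
    unfolding ftg0 integral_bij_count_space[OF bij(2)] by (simp add: theta_def g0_def[abs_def])
  have "theta L P t * theta L (\<lambda>_. 1) 1 = theta L (\<lambda>_. 1) 1 * (C * theta L P (1/t))"
  proof -
    have gb: "gauss_bounded g" "gauss_bounded g0"
      using P.P_gauss_bounded[OF t, of 1] one.P_gauss_bounded[of 1 1] by (auto simp: g_def[abs_def] g0_def[abs_def])
    have int: "integrable lborel g" "integrable lborel g0"
      using P.harmonic_fourier(1)[OF t, of 0] one.harmonic_fourier(1)[of 1 0] by (auto simp: g_def[abs_def] g0_def[abs_def])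
    have s: "integrable (count_space UNIV) (\<lambda>k. fourier g (dlat k))"
      unfolding ftg integrable_bij_count_space[OF bij(2), of "\<lambda>y. C * of_real (P y * exp (- pi * (1/t) * norm y^2))"]
      by (intro integrable_mult_right theta_summable[OF lat(1) P]) (use t in simp)
    have s0: "integrable (count_space UNIV) (\<lambda>k. fourier g0 (dlat k))"
      unfolding ftg0 integrable_bij_count_space[OF bij(2)] unfolding g0_def
      by (rule theta_summable[OF lat(1) harmonic_poly_one]) simp
    show ?thesis
      using poisson_ratio[OF gb(1) int(1) s gb(2) int(2) s0] unfolding sum_g sum_g0 sum_ftg sum_ftg0 .
  qed
  \<comment> \<open>All terms are positive and the origin alone contributes 1.\<close>
  moreover have "theta L (\<lambda>_. 1) 1 \<noteq> 0"
  proof -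
    have "0 \<in> L" using B(2) by (auto simp: lat_def intro!: image_eqI[of _ _ "\<lambda>_. 0"])
    have "theta L (\<lambda>_. 1) 1 = of_real (\<integral>x. exp (- pi * norm x^2) \<partial>count_space L)"
      unfolding theta_def by simp
    moreover have i: "integrable (count_space L) (\<lambda>x. exp (- pi * norm x^2))"
      using theta_summable[OF lat(1) harmonic_poly_one, of 1] by (simp flip: complex_of_real_integrable_eq)
    have "(\<integral>x. indicator {0} x *\<^sub>R (1::real) \<partial>count_space L) \<le> (\<integral>x. exp (- pi * norm x^2) \<partial>count_space L)"
      by (rule integral_mono[OF _ i]) (use \<open>0 \<in> L\<close> in \<open>auto split: split_indicator\<close>)
    moreover have "(\<integral>x. indicator {0} x *\<^sub>R (1::real) \<partial>count_space L) = 1" using \<open>0 \<in> L\<close> by simp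
    ultimately show ?thesis by simp
  qed
  ultimately have "theta L P t = C * theta L P (1/t)" by (simp add: mult.commute)
  then show ?thesis by (simp only: C_def)
qed

section \<open>The q-expansion of a theta series and its modularity\<close>

definition theta_coeff :: "(real ^ 'n::finite) set \<Rightarrow> (real ^ 'n \<Rightarrow> real) \<Rightarrow> nat \<Rightarrow> complex" where
  "theta_coeff L P m = of_real (\<Sum>x\<in>shell L (2 * real m). P x)"

lemma finite_shell:
  assumes "is_lattice (L :: (real ^ 'n::finite) set)"
  shows "finite (shell L r)"
proof -
  obtain B Bd where B: "dual_bases B Bd" "L = range (dual_bases.lat B)" by (rule lattice_dual_bases[OF assms])
  interpret dual_bases B Bd by fact
  show ?thesis
    by (rule finite_subset[OF _ finite_lat_norm[of r]]) (auto simp: shell_def B(2) power2_norm_eq_inner)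
qed

lemma even_lattice_norm:
  assumes "even_lattice L" "x \<in> L"
  shows "\<exists>m::nat. x \<bullet> x = 2 * real m"
proof -
  obtain k :: int where k: "x \<bullet> x = 2 * of_int k" using assms by (auto simp: even_lattice_def)
  then have "k \<ge> 0" using inner_ge_zero[of x] by linarith
  then show ?thesis using k by (intro exI[of _ "nat k"]) simp
qed

lemma theta_coeff_sums:
  fixes L :: "(real ^ 'n::finite) set"
  assumes L: "is_lattice L" "even_lattice L" and P: "harmonic_poly d P c" and t: "t > 0"
  shows "(\<lambda>m. theta_coeff L P m * of_real (exp (- 2 * pi * t))^m) sums theta L P t"
proof -
  define e where "e x = nat \<lfloor>(x \<bullet> x) / 2\<rfloor>" for x :: "real ^ 'n"
  have e: "x \<bullet> x = 2 * real (e x)" if "x \<in> L" for x using even_lattice_norm[OF L(2) that] by (auto simp: e_def)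
  have sh: "shell L (2 * real m) = {x \<in> L. e x = m}" for m
    using e by (auto simp: shell_def)
  have "(\<lambda>m. \<Sum>x\<in>{x \<in> L. e x = m}. complex_of_real (P x * exp (- pi * t * norm x^2))) sums theta L P t"
    unfolding theta_def by (rule fiber_sums[OF theta_summable[OF L(1) P t]]) (simp add: sh[symmetric] finite_shell[OF L(1)])
  moreover have "(\<Sum>x\<in>{x \<in> L. e x = m}. complex_of_real (P x * exp (- pi * t * norm x^2))) = theta_coeff L P m * of_real (exp (- 2 * pi * t))^m" for m
  proof -
    have "exp (- pi * t * norm x^2) = exp (- 2 * pi * t)^m" if "x \<in> L" "e x = m" for x
      using e[OF that(1)] that(2) by (simp add: power2_norm_eq_inner exp_of_nat_mult[symmetric] mult_ac)
    then have "(\<Sum>x\<in>{x \<in> L. e x = m}. complex_of_real (P x * exp (- pi * t * norm x^2))) = (\<Sum>x\<in>{x \<in> L. e x = m}. of_real (P x) * of_real (exp (- 2 * pi * t))^m)"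
      by (intro sum.cong) auto
    then show ?thesis by (simp add: theta_coeff_def sh sum_distrib_right)
  qed
  ultimately show ?thesis by simp
qed

text \<open>Convergence at a real \<open>r\<close> between \<open>norm q\<close> and 1 is that of
  the theta series at \<open>t = - ln r / (2 * pi)\<close>; a power series then converges inside the
  circle of radius \<open>r\<close>.\<close>

lemma theta_qseries:
  assumes "is_lattice (L :: (real ^ 'n::finite) set)" "even_lattice L" "harmonic_poly d P c"
  shows "qseries (theta_coeff L P)"
proof
  fix q :: complex assume q: "norm q < 1"
  define r where "r = (1 + norm q) / 2"
  have r: "0 < r" "norm q < r" "r < 1" using q norm_ge_zero[of q] by (auto simp: r_def simp del: norm_ge_zero intro: add_pos_nonneg)
  define t where "t = - ln r / (2 * pi)"
  have t: "t > 0" using r by (simp add: t_def divide_neg_pos)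
  have "exp (- 2 * pi * t) = r" using r by (simp add: t_def)
  then have "summable (\<lambda>m. theta_coeff L P m * (of_real r)^m)"
    using theta_coeff_sums[OF assms t] by (auto intro: sums_summable)
  then show "summable (\<lambda>m. theta_coeff L P m * q^m)"
    by (rule powser_inside) (use r in auto)
qed

lemma connected_uhp: "connected uhp"
  unfolding uhp_def by (intro convex_connected convex_halfspace_Im_gt)

text \<open>The functional equation holds on the imaginary axis, hence everywhere by analytic continuation.\<close>

lemma theta_modular:
  fixes L :: "(real ^ 'n::finite) set"
  assumes L: "selfdual_lattice L" "even_lattice L" and P: "harmonic_poly d P c"
    and n: "CARD('n) = 8 * j" and d: "even d"
  shows "modular_qseries (theta_coeff L P) (4 * j + d)"
proof -
  have lat: "is_lattice L" using L by (simp add: selfdual_lattice_def)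
  interpret qseries "theta_coeff L P" by (rule theta_qseries[OF lat L(2) P])
  have F_axis: "F (\<i> * of_real t) = theta L P t" if "t > 0" for t
  proof -
    have "exp (2 * pi * \<i> * (\<i> * of_real t)) = of_real (exp (- 2 * pi * t))"
      by (simp add: exp_of_real[symmetric] mult_ac)
    then show ?thesis using theta_coeff_sums[OF lat L(2) P that] by (simp add: F_def sums_iff)
  qed
  have S_axis: "F (- 1 / (\<i> * of_real t)) = (\<i> * of_real t)^(4*j+d) * F (\<i> * of_real t)" if t: "t > 0" for t
  proof -
    have "- 1 / (\<i> * of_real t) = \<i> * of_real (1/t)" using t by (simp add: field_simps)
    then have 1: "F (- 1 / (\<i> * of_real t)) = theta L P (1/t)" using F_axis[of "1/t"] t by simp
    have 2: "theta L P t = (\<i> / t)^d / of_real (sqrt t ^ CARD('n)) * theta L P (1/t)"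
      by (rule theta_inversion[OF L(1) P t])
    \<comment> \<open>Rank divisible by 8 makes the root an integral power and gives
      \<open>\<i>^(4*j) = 1\<close>; even \<open>d\<close> makes the two factors
      \<open>\<i>^d\<close> cancel. Together they yield the transformation law without a
      multiplier.\<close>
    have "sqrt t ^ CARD('n) = (sqrt t ^ 2)^(4*j)" unfolding power_mult[symmetric] n by simp
    then have 3: "sqrt t ^ CARD('n) = t^(4*j)" using t by simp
    have 4: "\<i>^(4*j) = 1" by (simp add: power_mult)
    have 5: "\<i>^d * \<i>^d = 1"
    proof -
      obtain l where "d = 2 * l" using d by auto
      then show ?thesis by (simp add: power_mult power_mult_distrib[symmetric])
    qed
    have "(\<i> * of_real t)^(4*j+d) * ((\<i> / t)^d / of_real (t^(4*j))) = \<i>^(4*j) * (\<i>^d * \<i>^d)"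
      using t by (simp add: power_add power_mult_distrib power_divide)
    then show ?thesis unfolding 1 F_axis[OF t] 2 3 4 5 by (simp add: mult.assoc[symmetric])
  qed
  show ?thesis
  proof
    fix \<tau> assume \<tau>: "Im \<tau> > 0"
    define D where "D \<tau> = F (- 1 / \<tau>) - \<tau>^(4*j+d) * F \<tau>" for \<tau>
    have "D \<tau> = 0"
    proof (rule analytic_continuation[where f = D and S = uhp and U = "(\<lambda>t. \<i> * of_real t) ` {0<..}" and \<xi> = \<i>])
      have "(F \<circ> (\<lambda>\<tau>. - 1 / \<tau>)) holomorphic_on uhp"
      proof (rule holomorphic_on_compose_gen[OF _ F_holomorphic])
        show "(\<lambda>\<tau>. - 1 / \<tau>) holomorphic_on uhp" by (intro holomorphic_intros) (auto simp: uhp_def)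
        show "(\<lambda>\<tau>. - 1 / \<tau>) ` uhp \<subseteq> uhp"
        proof
          fix w assume "w \<in> (\<lambda>\<tau>. - 1 / \<tau>) ` uhp"
          then obtain v where v: "Im v > 0" "w = - 1 / v" by (auto simp: uhp_def)
          then have "v \<noteq> 0" by auto
          then show "w \<in> uhp" using v by (simp add: uhp_def Im_divide divide_pos_pos sum_power2_gt_zero_iff complex_eq_iff)
        qed
      qed
      then show "D holomorphic_on uhp" unfolding D_def using F_holomorphic
        by (intro holomorphic_intros) (auto simp: o_def)
      show "\<i> islimpt (\<lambda>t. \<i> * of_real t) ` {0<..}"
        unfolding islimpt_approachable
      proof (intro allI impI)
        fix e :: real assume "e > 0"
        then show "\<exists>x'\<in>(\<lambda>t. \<i> * complex_of_real t) ` {0<..}. x' \<noteq> \<i> \<and> dist x' \<i> < e"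
          by (intro bexI[of _ "\<i> * complex_of_real (1 + e/2)"] conjI)
            (auto simp: complex_eq_iff dist_norm algebra_simps norm_mult intro!: image_eqI[of _ _ "1 + e/2"])
      qed
      show "D z = 0" if "z \<in> (\<lambda>t. \<i> * of_real t) ` {0<..}" for z
        using that S_axis by (auto simp: D_def)
    qed (use \<tau> in \<open>auto simp: uhp_def open_uhp[unfolded uhp_def] connected_uhp[unfolded uhp_def]\<close>)
    then show "F (- 1 / \<tau>) = \<tau>^(4*j+d) * F \<tau>" by (simp add: D_def)
  qed
qed

text \<open>Positive degree gives \<open>P 0 = 0\<close>, which removes the constant coefficient;
  the bound on the minimum empties the other shells below index \<open>r\<close>. So the theta
  series has vanishing order at least \<open>r\<close> and weight \<open>4 * j + d\<close>. Shells
  of other norms are empty by evenness.\<close>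

theorem shell_design_cond:
  fixes L :: "(real ^ 'n::finite) set"
  assumes L: "selfdual_lattice L" "even_lattice L" and n: "CARD('n) = 8 * j"
    and d: "even d" "d > 0" and min: "\<And>x. x \<in> L \<Longrightarrow> x \<noteq> 0 \<Longrightarrow> x \<bullet> x \<ge> 2 * real r"
    and cases: "r = 1 \<and> 4 * j + d \<le> 10 \<or> r = 1 \<and> 4 * j + d = 14 \<or> r = 2 \<and> 4 * j + d \<le> 20 \<or>
      r = 2 \<and> 4 * j + d = 22 \<or> r = 2 \<and> 4 * j + d = 26"
  shows "design_cond (shell L s) d"
  unfolding design_cond_def
proof (intro allI impI, elim conjE)
  fix P :: "real ^ 'n \<Rightarrow> real" assume hom: "homogeneous_poly d P" and harm: "harmonic P"
  obtain c where c: "\<And>x. P x = (\<Sum>\<alpha>\<in>multi_idx d. c \<alpha> * monom_fn \<alpha> x)"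
    using hom unfolding homogeneous_poly_def multi_idx_def monom_fn_def by blast
  have P: "harmonic_poly d P c" by standard (use c harm in auto)
  interpret P: harmonic_poly d P c by fact
  interpret modular_qseries "theta_coeff L P" "4 * j + d" by (rule theta_modular[OF L P n d(1)])
  have P0: "P 0 = 0" using P.P_bound d(2) by (auto simp: power_0_left dest: spec[of _ 0])
  have "theta_coeff L P m = 0" if "m < r" for m
  proof -
    have "P x = 0" if "x \<in> shell L (2 * real m)" for x
      using min[of x] that \<open>m < r\<close> P0 by (cases "x = 0") (auto simp: shell_def)
    then show ?thesis by (simp add: theta_coeff_def)
  qed
  then have coeff: "theta_coeff L P m = 0" for m by (rule coeffs_vanish[OF _ cases])
  show "(\<Sum>x\<in>shell L s. P x) = 0"
  proof (cases "shell L s = {}")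
    case False
    then obtain x where "x \<in> L" "x \<bullet> x = s" by (auto simp: shell_def)
    then obtain m :: nat where "s = 2 * real m" using even_lattice_norm[OF L(2)] by metis
    then show ?thesis using coeff[of m] by (simp add: theta_coeff_def flip: of_real_sum)
  qed simp
qed

section \<open>The lattice W8\<close>

lemma independent_familyI:
  fixes B :: "'n::finite \<Rightarrow> 'a::real_vector"
  assumes "\<And>z j. (\<Sum>i\<in>UNIV. z i *\<^sub>R B i) = 0 \<Longrightarrow> z j = 0"
  shows "inj B" "independent (range B)"
proof -
  show inj: "inj B"
  proof (rule injI, rule ccontr)
    fix i j assume ij: "B i = B j" "i \<noteq> j"
    define z :: "'n \<Rightarrow> real" where "z l = (if l = i then 1 else 0) - (if l = j then 1 else 0)" for l
    have "(\<Sum>l\<in>UNIV. z l *\<^sub>R B l) = (\<Sum>l\<in>UNIV. (if l = i then B l else 0) - (if l = j then B l else 0))"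
      by (rule sum.cong) (auto simp: z_def scaleR_diff_left)
    also have "\<dots> = 0" using ij by (simp add: sum_subtractf)
    finally have "z i = 0" by (rule assms)
    then show False using ij by (simp add: z_def)
  qed
  show "independent (range B)"
  proof (rule independent_if_scalars_zero)
    fix f x assume s: "(\<Sum>x\<in>range B. f x *\<^sub>R x) = 0" and x: "x \<in> range B"
    then obtain j where j: "x = B j" by auto
    have "(\<Sum>i\<in>UNIV. f (B i) *\<^sub>R B i) = 0" using s by (simp add: sum.reindex[OF inj])
    then have "f (B j) = 0" by (rule assms[where z = "\<lambda>i. f (B i)"])
    then show "f x = 0" by (simp add: j)
  qed simp
qed

lemma W8_add: "x \<in> W8 \<Longrightarrow> y \<in> W8 \<Longrightarrow> x + y \<in> W8"
proof -
  assume x: "x \<in> W8" and y: "y \<in> W8"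
  obtain k l :: int where kl: "(\<Sum>i\<in>UNIV. x $ i) = 2 * of_int k" "(\<Sum>i\<in>UNIV. y $ i) = 2 * of_int l"
    using x y by (auto simp: W8_def)
  have "2 * (x + y) $ i \<in> \<int>" for i
    using x y Ints_add[of "2 * x $ i" "2 * y $ i"] by (simp add: W8_def distrib_left)
  moreover have "(x + y) $ i - (x + y) $ 0 \<in> \<int>" for i
    using x y Ints_add[of "x $ i - x $ 0" "y $ i - y $ 0"] by (simp add: W8_def algebra_simps)
  moreover have "(\<Sum>i\<in>UNIV. (x + y) $ i) = 2 * of_int (k + l)" using kl by (simp add: sum.distrib)
  ultimately show ?thesis unfolding W8_def by blast
qed

lemma W8_scale: "x \<in> W8 \<Longrightarrow> of_int c *\<^sub>R x \<in> W8"
proof -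
  assume x: "x \<in> W8"
  obtain k :: int where k: "(\<Sum>i\<in>UNIV. x $ i) = 2 * of_int k" using x by (auto simp: W8_def)
  have "2 * (of_int c *\<^sub>R x) $ i \<in> \<int>" for i
    using x Ints_mult[of "of_int c" "2 * x $ i"] by (simp add: W8_def mult.left_commute)
  moreover have "(of_int c *\<^sub>R x) $ i - (of_int c *\<^sub>R x) $ 0 \<in> \<int>" for i
    using x Ints_mult[of "of_int c" "x $ i - x $ 0"] by (simp add: W8_def right_diff_distrib)
  moreover have "(\<Sum>i\<in>UNIV. (of_int c *\<^sub>R x) $ i) = 2 * of_int (c * k)" using k by (simp add: sum_distrib_left[symmetric])
  ultimately show ?thesis unfolding W8_def by blast
qed

lemma W8_sum: "finite A \<Longrightarrow> (\<And>i. i \<in> A \<Longrightarrow> f i \<in> W8) \<Longrightarrow> sum f A \<in> W8"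
proof (induction A rule: finite_induct)
  case empty
  have "0 \<in> W8" by (auto simp: W8_def intro!: exI[of _ 0])
  then show ?case by simp
qed (auto intro: W8_add)

text \<open>With \<open>x $ i = c/2 + m i\<close>, the condition on the coordinate sum makes the sum
  of the \<open>m i\<close> even; squares have the parity of their bases, so the sum of squares is
  even as well, and the halves contribute \<open>8 * c^2 / 4\<close>.\<close>

lemma W8_even: "even_lattice W8"
  unfolding even_lattice_def
proof
  fix x assume x: "x \<in> W8"
  obtain c :: int where c: "2 * x $ 0 = of_int c" using x by (auto simp: W8_def Ints_def)
  have "\<forall>i. \<exists>m::int. x $ i - x $ 0 = of_int m" using x by (auto simp: W8_def Ints_def)
  then obtain m :: "8 \<Rightarrow> int" where m: "\<And>i. x $ i - x $ 0 = of_int (m i)" by metis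
  obtain k :: int where k: "(\<Sum>i\<in>UNIV. x $ i) = 2 * of_int k" using x by (auto simp: W8_def)
  have xi: "x $ i = of_int c / 2 + of_int (m i)" for i using m[of i] c by (simp add: field_simps)
  have "(\<Sum>i\<in>UNIV. x $ i) = 4 * of_int c + of_int (\<Sum>i\<in>UNIV. m i)" unfolding xi by (simp add: sum.distrib)
  then have "real_of_int (\<Sum>i\<in>UNIV. m i) = of_int (2 * k - 4 * c)" using k by simp
  then have N: "(\<Sum>i\<in>UNIV. m i) = 2 * k - 4 * c" by (simp only: of_int_eq_iff)
  have "even (\<Sum>i\<in>UNIV. (m i)^2 - m i)" by (rule dvd_sum) auto
  then obtain l where l: "(\<Sum>i\<in>UNIV. (m i)^2 - m i) = 2 * l" by (auto elim: evenE)
  then have sq: "(\<Sum>i\<in>UNIV. (m i)^2) = 2 * l + (2 * k - 4 * c)" using N by (simp add: sum_subtractf)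
  have "x \<bullet> x = (\<Sum>i\<in>UNIV. (of_int c)^2 / 4 + of_int c * of_int (m i) + (of_int (m i))^2)"
    unfolding inner_vec_def by (rule sum.cong) (auto simp: xi power2_eq_square algebra_simps)
  also have "\<dots> = 2 * (of_int c)^2 + of_int c * of_int (\<Sum>i\<in>UNIV. m i) + of_int (\<Sum>i\<in>UNIV. (m i)^2)"
    by (simp add: sum.distrib sum_distrib_left[symmetric])
  also have "\<dots> = 2 * of_int (c^2 + c * (k - 2 * c) + l + (k - 2 * c))"
    unfolding N sq by (simp add: algebra_simps power2_eq_square)
  finally show "\<exists>k::int. x \<bullet> x = 2 * of_int k" by blast
qed

text \<open>Polarization of the even norm form.\<close>

lemma W8_integral: "integral_lattice W8"
  unfolding integral_lattice_def
proof (intro ballI)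
  fix x y assume x: "x \<in> W8" and y: "y \<in> W8"
  obtain a b c :: int where "x \<bullet> x = 2 * of_int a" "y \<bullet> y = 2 * of_int b" "(x + y) \<bullet> (x + y) = 2 * of_int c"
    using W8_even x y W8_add[OF x y] unfolding even_lattice_def by metis
  then have "x \<bullet> y = of_int (c - a - b)"
    by (simp add: inner_add_left inner_add_right inner_commute[of y x])
  then show "x \<bullet> y \<in> \<int>" by simp
qed

lemma W8_roots:
  assumes "i \<noteq> (0::8)"
  shows "axis i 1 - axis 0 1 \<in> W8" "axis i 1 + axis 0 1 \<in> W8"
proof -
  have s: "(\<Sum>j\<in>UNIV. (axis i (1::real) :: real ^ 8) $ j) = 1" for i
    by (simp add: axis_def)
  have "(\<Sum>j\<in>UNIV. (axis i 1 - axis 0 1 :: real ^ 8) $ j) = 2 * of_int 0" by (simp add: sum_subtractf s)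
  moreover have "(\<Sum>j\<in>UNIV. (axis i 1 + axis 0 1 :: real ^ 8) $ j) = 2 * of_int 1" by (simp add: sum.distrib s)
  ultimately show "axis i 1 - axis 0 1 \<in> W8" "axis i 1 + axis 0 1 \<in> W8"
    unfolding W8_def by (auto simp: axis_def)
qed

lemma W8_half: "(\<chi> j. 1/2) \<in> W8"
proof -
  have "(\<Sum>j\<in>UNIV. ((\<chi> j. 1/2) :: real ^ 8) $ j) = 2 * of_int 2" by simp
  then show ?thesis unfolding W8_def by auto
qed

text \<open>Pairing with \<open>axis i 1 - axis 0 1\<close> gives integral differences, pairing with
  \<open>axis i 1 + axis 0 1\<close> then gives half-integral coordinates, and pairing with the
  all-halves vector gives the even coordinate sum.\<close>

lemma W8_dual: "dual_lattice W8 = W8"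
proof
  show "W8 \<subseteq> dual_lattice W8" using W8_integral by (auto simp: integral_lattice_def dual_lattice_def)
  show "dual_lattice W8 \<subseteq> W8"
  proof
    fix y assume y: "y \<in> dual_lattice W8"
    have d: "y $ i - y $ 0 \<in> \<int>" for i
      using y W8_roots(1)[of i] by (cases "i = 0") (auto simp: dual_lattice_def inner_diff_left inner_axis')
    have s: "y $ i + y $ 0 \<in> \<int>" if "i \<noteq> 0" for i
      using y W8_roots(2)[OF that] by (auto simp: dual_lattice_def inner_add_left inner_axis')
    have "2 * y $ i \<in> \<int>" for i
    proof (cases "i = 0")
      case True
      \<comment> \<open>Coordinate 0 needs a partner; any other index would do.\<close>
      have "(y $ 1 + y $ 0) - (y $ 1 - y $ 0) \<in> \<int>" by (intro Ints_diff s d) simp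
      then show ?thesis using True by simp
    next
      case False
      have "(y $ i + y $ 0) + (y $ i - y $ 0) \<in> \<int>" by (intro Ints_add s d False)
      then show ?thesis by simp
    qed
    moreover have "(\<chi> j. 1/2) \<bullet> y \<in> \<int>" using y W8_half by (auto simp: dual_lattice_def)
    then obtain k :: int where "(\<chi> j. 1/2) \<bullet> y = of_int k" by (auto simp: Ints_def)
    then have "(\<Sum>i\<in>UNIV. y $ i) = 2 * of_int k"
      by (simp add: inner_vec_def sum_divide_distrib[symmetric])
    ultimately show "y \<in> W8" using d unfolding W8_def by blast
  qed
qed

text \<open>Coordinates 0 and 1 play a special role: \<open>W8\<close> is the direct sum of the multiples of
  \<open>(1/2, \<dots>, 1/2)\<close> and of a copy of \<open>D\<^sub>7\<close> in the hyperplane \<open>x\<^sub>0 = 0\<close>.\<close>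

definition W8_basis :: "8 \<Rightarrow> real ^ 8" where
  "W8_basis i = (if i = 0 then (\<chi> j. 1/2) else if i = 1 then 2 *\<^sub>R axis 1 1 else axis i 1 - axis 1 1)"

lemma W8_basis_comb:
  "(\<Sum>i\<in>UNIV. z i *\<^sub>R W8_basis i) $ j =
    z 0 / 2 + (if j = 0 then 0 else if j = 1 then 2 * z 1 - (\<Sum>i\<in>UNIV-{0,1}. z i) else z j)"
proof -
  have "(\<Sum>i\<in>UNIV. z i *\<^sub>R W8_basis i) = z 0 *\<^sub>R W8_basis 0 + (z 1 *\<^sub>R W8_basis 1 + (\<Sum>i\<in>UNIV-{0,1}. z i *\<^sub>R W8_basis i))"
    by (simp add: sum.remove[of _ 0] sum.remove[of _ 1] insert_commute Diff_insert2[symmetric])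
  then have "(\<Sum>i\<in>UNIV. z i *\<^sub>R W8_basis i) $ j = z 0 / 2 + (2 * z 1 * axis 1 1 $ j + (\<Sum>i\<in>UNIV-{0,1}. z i * (axis i 1 $ j - axis 1 1 $ j)))"
    by (simp add: W8_basis_def)
  also have "(\<Sum>i\<in>UNIV-{0,1}. z i * (axis i 1 $ j - axis 1 1 $ j)) =
     (\<Sum>i\<in>UNIV-{0,1}. if i = j then z i else 0) - (\<Sum>i\<in>UNIV-{0,1}. z i) * axis 1 1 $ j"
    unfolding sum_distrib_right sum_subtractf[symmetric] by (rule sum.cong) (auto simp: axis_def algebra_simps)
  finally show ?thesis by (auto simp: axis_def)
qed

lemma W8_is_lattice: "is_lattice W8"
  unfolding is_lattice_def
proof (intro exI conjI)
  have z: "z j = 0" if "(\<Sum>i\<in>UNIV. z i *\<^sub>R W8_basis i) = 0" for z :: "8 \<Rightarrow> real" and j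
  proof -
    have c: "z 0 / 2 + (if j = 0 then 0 else if j = 1 then 2 * z 1 - (\<Sum>i\<in>UNIV-{0,1}. z i) else z j) = 0" for j
      unfolding W8_basis_comb[symmetric] that by simp
    have z0: "z 0 = 0" using c[of 0] by simp
    have zj: "z j = 0" if "j \<noteq> 0" "j \<noteq> 1" for j using c[of j] z0 that by simp
    then have "(\<Sum>i\<in>UNIV-{0,1}. z i) = 0" by (intro sum.neutral) auto
    then have "z 1 = 0" using c[of 1] z0 by simp
    then show ?thesis using z0 zj[of j] by fastforce
  qed
  show "inj W8_basis" "independent (range W8_basis)"
    by (rule independent_familyI, erule z)+
  show "W8 = {(\<Sum>i\<in>UNIV. of_int (z i) *\<^sub>R W8_basis i) | z :: 8 \<Rightarrow> int. True}"
  proof (intro equalityI subsetI)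
    fix x assume x: "x \<in> W8"
    obtain c :: int where c: "2 * x $ 0 = of_int c" using x by (auto simp: W8_def Ints_def)
    have "\<forall>i. \<exists>m::int. x $ i - x $ 0 = of_int m" using x by (auto simp: W8_def Ints_def)
    then obtain m :: "8 \<Rightarrow> int" where m: "\<And>i. x $ i - x $ 0 = of_int (m i)" by metis
    obtain k :: int where k: "(\<Sum>i\<in>UNIV. x $ i) = 2 * of_int k" using x by (auto simp: W8_def)
    \<comment> \<open>Obtained by solving \<open>W8_basis_comb\<close>: as \<open>m 0 = 0\<close>,
      coordinate 1 requires \<open>2 * z 1\<close> to be the sum of all \<open>m i\<close>, which is
      \<open>2 * k - 4 * c\<close>.\<close>
    define z where "z i = (if i = 0 then c else if i = 1 then k - 2 * c else m i)" for i
    have xi: "x $ i = of_int c / 2 + of_int (m i)" for i using m[of i] c by (simp add: field_simps)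
    have m0: "m 0 = 0" using m[of 0] by simp
    have "(\<Sum>i\<in>UNIV. x $ i) = 4 * of_int c + (\<Sum>i\<in>UNIV. of_int (m i))" unfolding xi by (simp add: sum.distrib)
    also have "(\<Sum>i\<in>UNIV. real_of_int (m i)) = of_int (m 0) + (of_int (m 1) + (\<Sum>i\<in>UNIV-{0,1}. of_int (m i)))"
      by (simp add: sum.remove[of _ 0] sum.remove[of _ 1] insert_commute Diff_insert2[symmetric])
    also have "(\<Sum>i\<in>UNIV-{0,1}. real_of_int (m i)) = (\<Sum>i\<in>UNIV-{0,1}. of_int (z i))"
      by (rule sum.cong) (auto simp: z_def)
    finally have m1: "of_int (m 1) = 2 * of_int (k - 2 * c) - (\<Sum>i\<in>UNIV-{0,1}. real_of_int (z i))"
      using k m0 by simp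
    have "x = (\<Sum>i\<in>UNIV. of_int (z i) *\<^sub>R W8_basis i)"
      unfolding vec_eq_iff W8_basis_comb xi using m0 m1 by (auto simp: z_def)
    then show "x \<in> {(\<Sum>i\<in>UNIV. of_int (z i) *\<^sub>R W8_basis i) | z :: 8 \<Rightarrow> int. True}" by blast
  next
    fix x assume "x \<in> {(\<Sum>i\<in>UNIV. of_int (z i) *\<^sub>R W8_basis i) | z :: 8 \<Rightarrow> int. True}"
    then obtain z :: "8 \<Rightarrow> int" where z: "x = (\<Sum>i\<in>UNIV. of_int (z i) *\<^sub>R W8_basis i)" by blast
    have "W8_basis i \<in> W8" for i
    proof -
      have r: "axis i 1 - axis 0 1 \<in> W8" for i
      proof (cases "i = 0")
        case True
        have "(0 :: real ^ 8) \<in> W8" using W8_sum[of "{}"] by simp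
        then show ?thesis using True by simp
      qed (rule W8_roots)
      have eq: "axis i 1 - axis 1 1 = (axis i 1 - axis 0 1) + of_int (-1) *\<^sub>R (axis 1 1 - axis 0 1 :: real ^ 8)" by simp
      have eq2: "2 *\<^sub>R axis 1 1 = (axis 1 1 - axis 0 1) + (axis 1 1 + axis 0 1 :: real ^ 8)" by (simp add: scaleR_2)
      have "axis i 1 - axis 1 1 \<in> W8" unfolding eq by (intro W8_add W8_scale r)
      moreover have "2 *\<^sub>R axis 1 1 \<in> W8" unfolding eq2 by (intro W8_add W8_roots) auto
      ultimately show ?thesis using W8_half by (simp add: W8_basis_def)
    qed
    then show "x \<in> W8" unfolding z by (intro W8_sum W8_scale) auto
  qed
qed

lemma W8_selfdual: "selfdual_lattice W8"
  using W8_is_lattice W8_integral W8_dual by (simp add: selfdual_lattice_def)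

section \<open>Shells of even selfdual lattices as designs\<close>

lemma antipodal_shell:
  assumes "is_lattice L"
  shows "antipodal (shell L m)"
proof -
  have "- x \<in> L" if x: "x \<in> L" for x
  proof -
    obtain B Bd where B: "dual_bases B Bd" "L = range (dual_bases.lat B)" by (rule lattice_dual_bases[OF assms])
    interpret dual_bases B Bd by fact
    obtain z where "x = lat z" using x B(2) by auto
    then have "- x = lat (\<lambda>i. - z i)" by (simp add: lat_def sum_negf)
    then show ?thesis using B(2) by simp
  qed
  then show ?thesis by (auto simp: antipodal_def shell_def)
qed

lemma even_lattice_min_2:
  assumes "even_lattice L" "x \<in> L" "x \<noteq> 0"
  shows "x \<bullet> x \<ge> 2 * real 1"
proof -
  obtain m :: nat where m: "x \<bullet> x = 2 * real m" using even_lattice_norm assms by blast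
  moreover have "x \<bullet> x > 0" using assms by simp
  ultimately show ?thesis by simp
qed

lemma lattice_min_le:
  assumes "x \<in> L" "x \<noteq> 0"
  shows "lattice_min L \<le> x \<bullet> x"
  unfolding lattice_min_def by (rule cInf_lower) (use assms in \<open>auto intro!: bdd_belowI[of _ 0]\<close>)

theorem theorem11p3:
  shows "(\<forall>m. shell W8 m \<noteq> {} \<longrightarrow> spherical_half_design 3 (shell W8 m))
    \<and> (\<forall>L :: (real ^ 16) set. even_lattice L \<and> selfdual_lattice L \<longrightarrow>
         (\<forall>m. shell L m \<noteq> {} \<longrightarrow> spherical_half_design 1 (shell L m)))
    \<and> (\<forall>L :: (real ^ 24) set. even_lattice L \<and> selfdual_lattice L \<and> lattice_min L = 4 \<longrightarrow>
         (\<forall>m. shell L m \<noteq> {} \<longrightarrow> spherical_half_design 5 (shell L m)))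
    \<and> (\<forall>L :: (real ^ 24) set. even_lattice L \<and> selfdual_lattice L \<and> lattice_min L = 2 \<longrightarrow>
         (\<forall>m. shell L m \<noteq> {} \<longrightarrow> spherical_design 3 (shell L m)))"
proof (intro conjI allI impI, goal_cases)
  case (1 m)
  \<comment> \<open>The weights \<open>4 + 2 * i\<close> are 6, 8, 10 and 14.\<close>
  have "design_cond (shell W8 m) (2 * i)" if "1 \<le> i \<and> i \<le> 3 \<or> i = 5" for i
    by (rule shell_design_cond[OF W8_selfdual W8_even, where j = 1 and r = 1])
      (use that even_lattice_min_2[OF W8_even] in auto)
  from this this[of 5] show ?case
    by (simp add: spherical_half_design_def finite_shell[OF W8_is_lattice] antipodal_shell[OF W8_is_lattice])
next
  case (2 L m)
  then have L: "even_lattice L" "selfdual_lattice L" "is_lattice L" by (auto simp: selfdual_lattice_def)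
  \<comment> \<open>The weights \<open>8 + 2 * i\<close> are 10 and 14.\<close>
  have "design_cond (shell L m) (2 * i)" if "i = 1 \<or> i = 3" for i
    by (rule shell_design_cond[OF L(2,1), where j = 2 and r = 1])
      (use that even_lattice_min_2[OF L(1)] in auto)
  from this[of 1] this[of 3] show ?case
    by (auto simp: spherical_half_design_def finite_shell[OF L(3)] antipodal_shell[OF L(3)] dest: le_antisym)
next
  case (3 L m)
  then have L: "even_lattice L" "selfdual_lattice L" "is_lattice L" "lattice_min L = 4" by (auto simp: selfdual_lattice_def)
  \<comment> \<open>The weights \<open>12 + 2 * i\<close> are 14, 16, 18, 20, 22 and 26; minimum 4
    gives vanishing order 2.\<close>
  have "design_cond (shell L m) (2 * i)" if "1 \<le> i \<and> i \<le> 5 \<or> i = 7" for i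
    by (rule shell_design_cond[OF L(2,1), where j = 3 and r = 2])
      (use that lattice_min_le[of _ L] L(4) in auto)
  from this this[of 7] show ?case
    by (simp add: spherical_half_design_def finite_shell[OF L(3)] antipodal_shell[OF L(3)])
next
  case (4 L m)
  then have L: "even_lattice L" "selfdual_lattice L" "is_lattice L" by (auto simp: selfdual_lattice_def)
  \<comment> \<open>Only \<open>i = 1\<close> occurs, with weight 14 and vanishing order 1.\<close>
  have "design_cond (shell L m) (2 * i)" if "1 \<le> i \<and> 2 * i \<le> 3" for i
    by (rule shell_design_cond[OF L(2,1), where j = 3 and r = 1])
      (use that even_lattice_min_2[OF L(1)] in auto)
  then show ?case
    by (simp add: spherical_design_def finite_shell[OF L(3)] antipodal_shell[OF L(3)])
qed

end
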